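(* Let $n\ge1$ and let $\Phi\in C^\infty(\mathbb R^n\setminus\{0\})$ be a real-valued function such that (i) $|\nabla\Phi(\xi)|\neq 0$ for all $\xi\ne 0$; (ii) there is a constant $\mu\ge 1$ such that $\mu^{-1}\le|\Phi(\xi)|\le\mu$ for all $\xi$ with $|\xi|=1$; (iii) there is a constant $m\ge 1$ such that $\Phi(\lambda\xi)=\lambda^m\Phi(\xi)$ for all $\lambda>0$ and all $\xi\neq 0$; (iv) the Hessian matrix of $\Phi$ has rank at least $1$ at every $\xi\ne0$. Let $1<q_0,r_0\le2$. Suppose that for every $\epsilon>0$ there is a constant $C_\epsilon$ such that $$\|\mathfrak R(\chi_{\mathbb I_R\times\mathbb B_R}f)\|_{L^2(d\sigma)}\le C_\epsilon R^\epsilon\|f\|_{L_x^{q_0}(\mathbb R^n;L_t^{r_0}(\mathbb R))}$$ for all $R>1$ and all $f\in L_x^{q_0}(\mathbb R^n;L_t^{r_0}(\mathbb R))$. Then for any $1\le q<q_0$ and $1\le r<r_0$ there is a constant $C$ such that $$\|\mathfrak Rf\|_{L^2(d\sigma)}\le C\|f\|_{L_x^{q}(\mathbb R^n;L_t^{r}(\mathbb R))}$$ for all $f\in L_x^q(\mathbb R^n;L_t^r(\mathbb R))$.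
   Context: Points of $\mathbb R^{n+1}$ are written $(x,t)$ with $x\in\mathbb R^n$, $t\in\mathbb R$. Let $S=\{(\xi,\Phi(\xi))\in\mathbb R^n\times\mathbb R:1/2\le|\xi|\le2\}$, with induced surface (Lebesgue) measure $d\sigma$. The Fourier restriction operator is $\mathfrak Rf=\hat f|_S$, where $\hat f$ is the Fourier transform on $\mathbb R^{n+1}$; it is defined pointwise for integrable $f$, and an estimate for all $f$ in a mixed-norm space is understood for all integrable $f$ in that space and then, by density, as a bounded extension to the whole space. $\mathbb I_R=(0,R)$, $\mathbb B_R$ is the ball of radius $R$ centered at the origin of $\mathbb R^n$, and $\chi_{\mathbb I_R\times\mathbb B_R}$ is the indicator function of $\{(x,t):t\in\mathbb I_R,\ x\in\mathbb B_R\}$. The mixed norm is $\|f\|_{L_x^q(\mathbb R^n;L_t^r(\mathbb R))}=\left(\int_{\mathbb R^n}\left(\int_{\mathbb R}|f(x,t)|^r\,dt\right)^{q/r}dx\right)^{1/q}$. *)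

theory Defs
  imports "HOL-Analysis.Analysis"
begin

section \<open>Smooth functions, gradient and Hessian\<close>

text \<open>Intended for open \<open>S\<close>: all iterated directional derivatives up to order \<open>k\<close>
  exist as Frechet derivatives on \<open>S\<close>, and those of order \<open>k\<close> are continuous.\<close>

primrec Ck_on :: "nat \<Rightarrow> ('a::real_normed_vector \<Rightarrow> 'b::real_normed_vector) \<Rightarrow> 'a set \<Rightarrow> bool" where
  "Ck_on 0 f S \<longleftrightarrow> continuous_on S f"
| "Ck_on (Suc k) f S \<longleftrightarrow>
     (\<forall>x\<in>S. f differentiable (at x)) \<and> (\<forall>v. Ck_on k (\<lambda>x. frechet_derivative f (at x) v) S)"

definition smooth_on :: "('a::real_normed_vector \<Rightarrow> 'b::real_normed_vector) \<Rightarrow> 'a set \<Rightarrow> bool" where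
  "smooth_on f S \<longleftrightarrow> (\<forall>k. Ck_on k f S)"

definition partial_deriv :: "'n::finite \<Rightarrow> (real^'n \<Rightarrow> real) \<Rightarrow> real^'n \<Rightarrow> real" where
  "partial_deriv i f x = frechet_derivative f (at x) (axis i 1)"

definition gradient :: "(real^'n::finite \<Rightarrow> real) \<Rightarrow> real^'n \<Rightarrow> real^'n" where
  "gradient f x = (\<chi> i. partial_deriv i f x)"

definition hessian :: "(real^'n::finite \<Rightarrow> real) \<Rightarrow> real^'n \<Rightarrow> real^'n^'n" where
  "hessian f x = (\<chi> i j. partial_deriv i (partial_deriv j f) x)"

section \<open>The surface and its measure\<close>

definition annulus :: "(real^'n::finite) set" where
  "annulus = {\<xi>. 1 / 2 \<le> norm \<xi> \<and> norm \<xi> \<le> 2}"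

definition surface :: "(real^'n::finite \<Rightarrow> real) \<Rightarrow> ((real^'n) \<times> real) set" where
  "surface \<Phi> = (\<lambda>\<xi>. (\<xi>, \<Phi> \<xi>)) ` annulus"

text \<open>The surface measure of a graph: its area element in the coordinate \<open>\<xi>\<close> is
  \<open>sqrt (1 + |\<nabla>\<Phi>(\<xi>)|\<^sup>2) d\<xi>\<close>.  It is a Borel measure on the whole
  of \<open>R^n \<times> R\<close>, concentrated on \<open>surface \<Phi>\<close>.\<close>

definition surface_measure :: "(real^'n::finite \<Rightarrow> real) \<Rightarrow> ((real^'n) \<times> real) measure" where
  "surface_measure \<Phi> =
     distr
       (density lborel (\<lambda>\<xi>. ennreal (indicator annulus \<xi> * sqrt (1 + (norm (gradient \<Phi> \<xi>))\<^sup>2))))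
       borel (\<lambda>\<xi>. (\<xi>, \<Phi> \<xi>))"

section \<open>Norms\<close>

text \<open>Only positive exponents are used, so \<open>\<infinity>\<close> is mapped to itself.\<close>

definition ennpowr :: "ennreal \<Rightarrow> real \<Rightarrow> ennreal" where
  "ennpowr a p = (if a = \<infinity> then \<infinity> else ennreal (enn2real a powr p))"

definition mixed_norm :: "real \<Rightarrow> real \<Rightarrow> ((real^'n::finite) \<times> real \<Rightarrow> complex) \<Rightarrow> ennreal" where
  "mixed_norm q r f =
     ennpowr (\<integral>\<^sup>+x. ennpowr (\<integral>\<^sup>+t. ennreal (norm (f (x, t)) powr r) \<partial>lborel) (q / r) \<partial>lborel) (1 / q)"

text \<open>The mixed-norm space, represented by functions rather than by almost-everywhere classes;
  every class has a Borel measurable representative.\<close>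

definition mixed_Lp :: "real \<Rightarrow> real \<Rightarrow> ((real^'n::finite) \<times> real \<Rightarrow> complex) set" where
  "mixed_Lp q r = {f. f \<in> borel_measurable lborel \<and> mixed_norm q r f < \<infinity>}"

definition L2_norm :: "'a measure \<Rightarrow> ('a \<Rightarrow> complex) \<Rightarrow> ennreal" where
  "L2_norm M g = ennpowr (\<integral>\<^sup>+z. ennreal ((norm (g z))\<^sup>2) \<partial>M) (1 / 2)"

section \<open>The Fourier restriction operator\<close>

text \<open>On \<open>R^n \<times> R\<close> the inner product is
  \<open>(x, t) \<bullet> (\<xi>, \<tau>) = x \<bullet> \<xi> + t * \<tau>\<close>.\<close>

definition fourier_transform :: "('a::euclidean_space \<Rightarrow> complex) \<Rightarrow> 'a \<Rightarrow> complex" where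
  "fourier_transform f \<zeta> = (LINT z|lborel. exp (- \<i> * complex_of_real (z \<bullet> \<zeta>)) * f z)"

definition restriction_op ::
  "(real^'n::finite \<Rightarrow> real) \<Rightarrow> ((real^'n) \<times> real \<Rightarrow> complex) \<Rightarrow> (real^'n) \<times> real \<Rightarrow> complex" where
  "restriction_op \<Phi> f = restrict (fourier_transform f) (surface \<Phi>)"

text \<open>Multiplication of \<open>f\<close> by the indicator function of
  \<open>{(x, t). 0 < t < R, |x| < R}\<close>.\<close>

definition cutoff :: "real \<Rightarrow> ((real^'n::finite) \<times> real \<Rightarrow> complex) \<Rightarrow> (real^'n) \<times> real \<Rightarrow> complex" where
  "cutoff R f = (\<lambda>z. indicator (ball 0 R \<times> {0<..<R}) z * f z)"

text \<open>The meaning of \<open>\<parallel>Rf\<parallel> \<le> C \<parallel>f\<parallel>\<close> for all \<open>f\<close> in the mixed-norm space: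
  the inequality holds for all integrable \<open>f\<close> in the space, where \<open>Rf\<close> is defined
  pointwise, and the map \<open>f \<mapsto> Rf\<close> extends from these to a linear operator \<open>T\<close> on the whole space,
  with values in \<open>L\<^sup>2(d\<sigma>)\<close> and with the same bound.  Equalities in \<open>L\<^sup>2(d\<sigma>)\<close> are
  almost everywhere.\<close>

definition restriction_estimate :: "(real^'n::finite \<Rightarrow> real) \<Rightarrow> real \<Rightarrow> real \<Rightarrow> real \<Rightarrow> bool" where
  "restriction_estimate \<Phi> q r C \<longleftrightarrow>
     (\<forall>f\<in>mixed_Lp q r. integrable lborel f \<longrightarrow>
        L2_norm (surface_measure \<Phi>) (restriction_op \<Phi> f) \<le> ennreal C * mixed_norm q r f) \<and>
     (\<exists>T. (\<forall>f\<in>mixed_Lp q r. integrable lborel f \<longrightarrow>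
             (AE \<zeta> in surface_measure \<Phi>. T f \<zeta> = restriction_op \<Phi> f \<zeta>)) \<and>
          (\<forall>f\<in>mixed_Lp q r. \<forall>g\<in>mixed_Lp q r.
             AE \<zeta> in surface_measure \<Phi>. T (\<lambda>z. f z + g z) \<zeta> = T f \<zeta> + T g \<zeta>) \<and>
          (\<forall>c. \<forall>f\<in>mixed_Lp q r.
             AE \<zeta> in surface_measure \<Phi>. T (\<lambda>z. c * f z) \<zeta> = c * T f \<zeta>) \<and>
          (\<forall>f\<in>mixed_Lp q r. T f \<in> borel_measurable (surface_measure \<Phi>) \<and>
             L2_norm (surface_measure \<Phi>) (T f) \<le> ennreal C * mixed_norm q r f))"

end

(*
  Write S(f) for the L2 norm of the Fourier transform of f on the surface; S(f)^2 is the quadratic form with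
  kernel the Fourier transform of the surface measure.  On pieces of the annulus this kernel decays like
  |z|^(-1/2): where the Hessian is nonzero some second directional derivative of Phi is nonzero, and van der
  Corput's lemma applies on lines in that direction.

  Averaging S(f 1_(U+y))^2 over the translates U + y of a cylinder of size R reproduces S(f)^2 up to the
  contribution of the kernel at distance >= R, so that for every R > 1
    S(f)^2 <= C R^epsilon |f|_(q0,r0)^2 + C R^(-1/2) |f|_1^2.

  The frequencies on the surface are bounded, so f may be replaced by its average over small cylinders and
  is then bounded.  Splitting it into level sets { |f| ~ 2^(-k) } makes the (q0,r0) norm decay in k and the
  L1 norm grow at most exponentially; choosing R a large power of 2^k and epsilon small enough, both terms
  decay geometrically and the pieces can be summed.
*)
theory Submission
  imports Defs
begin

section \<open>Oscillatory integrals on lines\<close>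

text \<open>Any positive power of kernel decay suffices: the radius \<open>R\<close> is chosen only
  after the level \<open>k\<close>, and the loss \<open>R powr \<epsilon>\<close> can be kept below
  what the level gains. That gain exists because \<open>q < q0\<close> and \<open>r < r0\<close>
  hold strictly. In a mixed norm, a lower bound for |f| on a level does not by itself control the L1
  norm, since the exponents in space and time differ. Besides boundedness, smoothing therefore has
  to supply one function of \<open>x\<close> that dominates both the values and the time slices; the
  levels are measured against it. Localisation needs the squares of the norms of translated pieces
  to add up, and this is where exponents at most 2 enter. The annulus is not convex, while the
  argument on lines wants sets that meet each line in a segment. The pieces are therefore
  differences of two compact convex sets. Constants are immaterial, so elementary inequalities with
  lost factors stand in for those of Hoelder, Jensen and Minkowski; the factors 4, 8 and 32 arise in
  this way.\<close>

lemma cis_has_vector_derivative: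
  assumes "(\<phi> has_real_derivative P) (at s within T)"
  shows "((\<lambda>s. cis (\<phi> s)) has_vector_derivative (\<i> * P * cis (\<phi> s))) (at s within T)"
proof -
  have "(cis has_vector_derivative \<i> * cis (\<phi> s)) (at (\<phi> s) within \<phi> ` T)"
    by (rule has_vector_derivative_at_within)
      (auto simp: has_vector_derivative_complex_iff scaleR_conv_of_real intro!: derivative_eq_intros)
  moreover have "(\<phi> has_vector_derivative P) (at s within T)"
    using assms by (simp add: has_real_derivative_iff_has_vector_derivative)
  ultimately show ?thesis
    using vector_diff_chain_within[of \<phi> P s T cis "\<i> * cis (\<phi> s)"]
    by (simp add: o_def scaleR_conv_of_real mult_ac)
qed

text \<open>Integration by parts against a free multiplier \<open>Q\<close>: the derivative of
  \<open>Q s * cis (\<phi> s)\<close> misses \<open>\<i> * cis (\<phi> s)\<close> by at most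
  \<open>\<bar>1 - P s * Q s\<bar> + \<bar>Q' s\<bar>\<close>. With a primitive \<open>A\<close> of
  a majorant of this error, each later bound becomes a choice of \<open>Q\<close> and
  \<open>A\<close>.\<close>

lemma norm_oscillatory_integral_le:
  fixes \<phi> P A A' Q Q' :: "real \<Rightarrow> real"
  assumes "a \<le> b"
    and \<phi>: "\<And>s. s \<in> {a..b} \<Longrightarrow> (\<phi> has_real_derivative P s) (at s within {a..b})"
    and Q: "\<And>s. s \<in> {a..b} \<Longrightarrow> (Q has_real_derivative Q' s) (at s within {a..b})"
    and A: "\<And>s. s \<in> {a..b} \<Longrightarrow> (A has_real_derivative A' s) (at s within {a..b})"
    and le: "\<And>s. s \<in> {a..b} \<Longrightarrow> \<bar>1 - P s * Q s\<bar> + \<bar>Q' s\<bar> \<le> A' s"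
  shows "norm (integral {a..b} (\<lambda>s. cis (\<phi> s))) \<le> \<bar>Q a\<bar> + \<bar>Q b\<bar> + (A b - A a)"
proof -
  define W where "W s = of_real (Q s) * cis (\<phi> s)" for s
  define W' where "W' s = of_real (Q' s) * cis (\<phi> s) + of_real (Q s) * (\<i> * P s * cis (\<phi> s))" for s
  have W: "(W has_vector_derivative W' s) (at s within {a..b})" if "s \<in> {a..b}" for s
  proof -
    have "((\<lambda>s. complex_of_real (Q s)) has_vector_derivative of_real (Q' s)) (at s within {a..b})"
      using Q[OF that] by (intro has_vector_derivative_of_real) (simp add: has_real_derivative_iff_has_vector_derivative)
    from has_vector_derivative_mult[OF this cis_has_vector_derivative[OF \<phi>[OF that]]]
    show ?thesis unfolding W_def[abs_def] W'_def by (simp add: add.commute)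
  qed
  have "(W' has_integral (W b - W a)) {a..b}"
    by (intro fundamental_theorem_of_calculus assms(1) W)
  moreover have cont: "continuous_on {a..b} \<phi>"
    using \<phi> by (meson DERIV_continuous continuous_on_eq_continuous_within)
  hence "continuous_on {a..b} (\<lambda>s. cis (\<phi> s))"
    by (intro continuous_intros continuous_on_cis)
  hence int: "(\<lambda>s. cis (\<phi> s)) integrable_on {a..b}"
    by (rule integrable_continuous_real)
  ultimately have E: "((\<lambda>s. \<i> * cis (\<phi> s) - W' s) has_integral (\<i> * integral {a..b} (\<lambda>s. cis (\<phi> s)) - (W b - W a))) {a..b}"
    by (intro has_integral_diff has_integral_mult_right integrable_integral)
  have A_int: "(A' has_integral (A b - A a)) {a..b}"
    using A assms(1) by (intro fundamental_theorem_of_calculus) (auto simp: has_real_derivative_iff_has_vector_derivative)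
  have "norm (\<i> * cis (\<phi> s) - W' s) \<le> A' s" if "s \<in> {a..b}" for s
  proof -
    have "\<i> * cis (\<phi> s) - W' s = (\<i> * of_real (1 - P s * Q s) - of_real (Q' s)) * cis (\<phi> s)"
      by (simp add: W'_def algebra_simps)
    also have "norm \<dots> \<le> norm (\<i> * complex_of_real (1 - P s * Q s)) + norm (complex_of_real (Q' s))"
      unfolding norm_mult[of _ "cis (\<phi> s)"] norm_cis mult_1_right by (rule norm_triangle_ineq4)
    also have "\<dots> \<le> A' s"
      using le[OF that] by (simp add: norm_mult del: of_real_diff of_real_mult)
    finally show ?thesis .
  qed
  hence "norm (\<i> * integral {a..b} (\<lambda>s. cis (\<phi> s)) - (W b - W a)) \<le> A b - A a"
    using E A_int by (metis (no_types, lifting) has_integral_integrable integral_unique integral_norm_bound_integral)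
  moreover have "norm (\<i> * integral {a..b} (\<lambda>s. cis (\<phi> s))) \<le>
      norm (\<i> * integral {a..b} (\<lambda>s. cis (\<phi> s)) - (W b - W a)) + (norm (W b) + norm (W a))"
    by (smt (verit) norm_triangle_ineq norm_triangle_ineq4 diff_add_cancel)
  moreover have "norm (W s) = \<bar>Q s\<bar>" for s
    by (simp add: W_def norm_mult)
  ultimately show ?thesis by (simp add: norm_mult)
qed

text \<open>The multiplier is \<open>1 / P\<close>, with a linear \<open>A\<close>. A bound on
  \<open>P'\<close> takes the place of the usual monotonicity of \<open>P\<close>, at the price of a
  term proportional to the length of the interval.\<close>

lemma van_der_Corput_first:
  fixes \<phi> P P' :: "real \<Rightarrow> real"
  assumes "a \<le> b" "0 < \<delta>" "0 \<le> M"
    and \<phi>: "\<And>s. s \<in> {a..b} \<Longrightarrow> (\<phi> has_real_derivative P s) (at s within {a..b})"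
    and P: "\<And>s. s \<in> {a..b} \<Longrightarrow> (P has_real_derivative P' s) (at s within {a..b})"
    and lower: "\<And>s. s \<in> {a..b} \<Longrightarrow> \<delta> \<le> \<bar>P s\<bar>"
    and upper: "\<And>s. s \<in> {a..b} \<Longrightarrow> \<bar>P' s\<bar> \<le> M"
  shows "norm (integral {a..b} (\<lambda>s. cis (\<phi> s))) \<le> 2 / \<delta> + M * (b - a) / \<delta>\<^sup>2"
proof -
  have nz: "P s \<noteq> 0" if "s \<in> {a..b}" for s
    using lower[OF that] assms(2) by auto
  have "norm (integral {a..b} (\<lambda>s. cis (\<phi> s))) \<le> \<bar>1 / P a\<bar> + \<bar>1 / P b\<bar> + (M / \<delta>\<^sup>2 * b - M / \<delta>\<^sup>2 * a)"
  proof (rule norm_oscillatory_integral_le[OF assms(1) \<phi>])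
    fix s assume s: "s \<in> {a..b}"
    show "((\<lambda>s. 1 / P s) has_real_derivative - P' s / (P s)\<^sup>2) (at s within {a..b})"
      using nz[OF s] by (auto intro!: derivative_eq_intros P[OF s] simp: power2_eq_square)
    show "((\<lambda>s. M / \<delta>\<^sup>2 * s) has_real_derivative M / \<delta>\<^sup>2) (at s within {a..b})"
      by (rule DERIV_cmult_Id)
    have "\<delta>\<^sup>2 \<le> (P s)\<^sup>2"
      using lower[OF s] assms(2) by (metis power2_abs power_mono less_imp_le)
    hence "\<bar>P' s\<bar> / (P s)\<^sup>2 \<le> M / \<delta>\<^sup>2"
      using upper[OF s] assms(2,3) by (intro frac_le) auto
    thus "\<bar>1 - P s * (1 / P s)\<bar> + \<bar>- P' s / (P s)\<^sup>2\<bar> \<le> M / \<delta>\<^sup>2"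
      using nz[OF s] by (simp add: abs_mult)
  qed
  moreover have bd: "\<bar>1 / P s\<bar> \<le> 1 / \<delta>" if "s \<in> {a..b}" for s
    using lower[OF that] assms(2) by (simp add: field_simps)
  from bd[of a] bd[of b] have "\<bar>1 / P a\<bar> \<le> 1 / \<delta>" "\<bar>1 / P b\<bar> \<le> 1 / \<delta>"
    using assms(1) by auto
  ultimately have "norm (integral {a..b} (\<lambda>s. cis (\<phi> s))) \<le> 1 / \<delta> + 1 / \<delta> + (M / \<delta>\<^sup>2 * b - M / \<delta>\<^sup>2 * a)"
    by linarith
  thus ?thesis by (simp add: right_diff_distrib diff_divide_distrib)
qed

text \<open>No neighbourhood of a stationary point has to be cut out: the regularised multiplier
  stays below \<open>1 / (2 * \<kappa>)\<close> even where \<open>P\<close> vanishes. In units of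
  \<open>1 / \<kappa>\<close>, the constant 9 is 1 from the two endpoints plus twice an arctan
  variation below 4.\<close>

lemma van_der_Corput_second_pos:
  fixes \<phi> P P' :: "real \<Rightarrow> real"
  assumes "a \<le> b" "0 < \<delta>"
    and \<phi>: "\<And>s. s \<in> {a..b} \<Longrightarrow> (\<phi> has_real_derivative P s) (at s within {a..b})"
    and P: "\<And>s. s \<in> {a..b} \<Longrightarrow> (P has_real_derivative P' s) (at s within {a..b})"
    and lower: "\<And>s. s \<in> {a..b} \<Longrightarrow> \<delta> \<le> P' s"
  shows "norm (integral {a..b} (\<lambda>s. cis (\<phi> s))) \<le> 9 / sqrt \<delta>"
proof -
  define \<kappa> where "\<kappa> = sqrt \<delta>"
  have \<kappa>: "0 < \<kappa>" "\<kappa>\<^sup>2 = \<delta>" using assms(2) by (auto simp: \<kappa>_def)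
  have pos: "0 < (P s)\<^sup>2 + \<kappa>\<^sup>2" for s using \<kappa>(1) by (simp add: sum_power2_gt_zero_iff)
  text \<open>Integrate by parts with \<open>P / (P\<^sup>2 + \<kappa>\<^sup>2)\<close> in place of \<open>1 / P\<close>;
    both error terms are then dominated by the derivative of \<open>arctan (P / \<kappa>)\<close>.\<close>
  have "norm (integral {a..b} (\<lambda>s. cis (\<phi> s))) \<le> \<bar>P a / ((P a)\<^sup>2 + \<kappa>\<^sup>2)\<bar> + \<bar>P b / ((P b)\<^sup>2 + \<kappa>\<^sup>2)\<bar>
      + (2 / \<kappa> * arctan (P b / \<kappa>) - 2 / \<kappa> * arctan (P a / \<kappa>))"
  proof (rule norm_oscillatory_integral_le[OF assms(1) \<phi>])
    fix s assume s: "s \<in> {a..b}"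
    show "((\<lambda>s. P s / ((P s)\<^sup>2 + \<kappa>\<^sup>2)) has_real_derivative P' s * (\<kappa>\<^sup>2 - (P s)\<^sup>2) / ((P s)\<^sup>2 + \<kappa>\<^sup>2)\<^sup>2) (at s within {a..b})"
      using pos[of s] 
      by (auto intro!: derivative_eq_intros P[OF s] simp: power2_eq_square field_simps)
    have "((\<lambda>s. 2 / \<kappa> * arctan (P s / \<kappa>)) has_real_derivative 2 / \<kappa> * (inverse (1 + (P s / \<kappa>)\<^sup>2) * (P' s / \<kappa>))) (at s within {a..b})"
      by (intro DERIV_cmult DERIV_chain2[OF DERIV_arctan] DERIV_cdivide P[OF s])
    moreover have "2 / \<kappa> * (inverse (1 + (P s / \<kappa>)\<^sup>2) * (P' s / \<kappa>)) = 2 * P' s / ((P s)\<^sup>2 + \<kappa>\<^sup>2)"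
    proof -
      have "1 + (P s / \<kappa>)\<^sup>2 = ((P s)\<^sup>2 + \<kappa>\<^sup>2) / \<kappa>\<^sup>2" using \<kappa>(1) by (simp add: power_divide field_simps)
      thus ?thesis using \<kappa>(1) by (simp add: power2_eq_square)
    qed
    ultimately show "((\<lambda>s. 2 / \<kappa> * arctan (P s / \<kappa>)) has_real_derivative 2 * P' s / ((P s)\<^sup>2 + \<kappa>\<^sup>2)) (at s within {a..b})"
      by simp
    have "1 - P s * (P s / ((P s)\<^sup>2 + \<kappa>\<^sup>2)) = \<kappa>\<^sup>2 / ((P s)\<^sup>2 + \<kappa>\<^sup>2)"
      using pos[of s] \<kappa>(1) by (simp add: divide_simps) (simp add: power2_eq_square)
    hence "\<bar>1 - P s * (P s / ((P s)\<^sup>2 + \<kappa>\<^sup>2))\<bar> \<le> P' s / ((P s)\<^sup>2 + \<kappa>\<^sup>2)"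
      using pos[of s] lower[OF s] \<kappa> assms(2) by (simp add: divide_right_mono)
    moreover have "\<bar>P' s * (\<kappa>\<^sup>2 - (P s)\<^sup>2) / ((P s)\<^sup>2 + \<kappa>\<^sup>2)\<^sup>2\<bar> \<le> P' s / ((P s)\<^sup>2 + \<kappa>\<^sup>2)"
    proof -
      have "\<bar>P' s * (\<kappa>\<^sup>2 - (P s)\<^sup>2) / ((P s)\<^sup>2 + \<kappa>\<^sup>2)\<^sup>2\<bar> = P' s * \<bar>\<kappa>\<^sup>2 - (P s)\<^sup>2\<bar> / ((P s)\<^sup>2 + \<kappa>\<^sup>2)\<^sup>2"
        using lower[OF s] assms(2) by (simp add: abs_mult)
      also have "\<dots> \<le> P' s * ((P s)\<^sup>2 + \<kappa>\<^sup>2) / ((P s)\<^sup>2 + \<kappa>\<^sup>2)\<^sup>2"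
        using lower[OF s] assms(2) by (intro divide_right_mono mult_left_mono) (auto simp: abs_le_iff)
      also have "\<dots> = P' s / ((P s)\<^sup>2 + \<kappa>\<^sup>2)"
        using pos[of s] by (simp add: power2_eq_square)
      finally show ?thesis .
    qed
    ultimately show "\<bar>1 - P s * (P s / ((P s)\<^sup>2 + \<kappa>\<^sup>2))\<bar> + \<bar>P' s * (\<kappa>\<^sup>2 - (P s)\<^sup>2) / ((P s)\<^sup>2 + \<kappa>\<^sup>2)\<^sup>2\<bar>
        \<le> 2 * P' s / ((P s)\<^sup>2 + \<kappa>\<^sup>2)"
      by simp
  qed
  moreover have bd: "\<bar>P s / ((P s)\<^sup>2 + \<kappa>\<^sup>2)\<bar> \<le> 1 / (2 * \<kappa>)" for s
  proof -
    have "2 * \<kappa> * \<bar>P s\<bar> \<le> (P s)\<^sup>2 + \<kappa>\<^sup>2"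
      using sum_squares_bound[of \<kappa> "\<bar>P s\<bar>"] by simp
    thus ?thesis using \<kappa>(1) pos[of s] by (simp add: field_simps)
  qed
  moreover have "2 / \<kappa> * arctan (P b / \<kappa>) - 2 / \<kappa> * arctan (P a / \<kappa>) \<le> 2 / \<kappa> * 4"
  proof -
    have "arctan (P b / \<kappa>) - arctan (P a / \<kappa>) \<le> 4"
      using arctan_ubound[of "P b / \<kappa>"] arctan_lbound[of "P a / \<kappa>"] pi_less_4
      by linarith
    thus ?thesis using \<kappa>(1) unfolding right_diff_distrib[symmetric] by (intro mult_left_mono) auto
  qed
  ultimately have "norm (integral {a..b} (\<lambda>s. cis (\<phi> s))) \<le> 1 / (2 * \<kappa>) + 1 / (2 * \<kappa>) + 2 / \<kappa> * 4"
    using bd[of a] bd[of b] by linarith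
  thus ?thesis using \<kappa>(1) by (simp add: \<kappa>_def field_simps)
qed

lemma van_der_Corput_second:
  fixes \<phi> P P' :: "real \<Rightarrow> real"
  assumes "a \<le> b" "0 < \<delta>"
    and \<phi>: "\<And>s. s \<in> {a..b} \<Longrightarrow> (\<phi> has_real_derivative P s) (at s within {a..b})"
    and P: "\<And>s. s \<in> {a..b} \<Longrightarrow> (P has_real_derivative P' s) (at s within {a..b})"
    and lower: "(\<forall>s\<in>{a..b}. \<delta> \<le> P' s) \<or> (\<forall>s\<in>{a..b}. P' s \<le> - \<delta>)"
  shows "norm (integral {a..b} (\<lambda>s. cis (\<phi> s))) \<le> 9 / sqrt \<delta>"
  using lower
proof
  assume "\<forall>s\<in>{a..b}. \<delta> \<le> P' s"
  thus ?thesis using van_der_Corput_second_pos[OF assms(1,2) \<phi> P] by blast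
next
  assume neg: "\<forall>s\<in>{a..b}. P' s \<le> - \<delta>"
  have "norm (integral {a..b} (\<lambda>s. cis (- \<phi> s))) \<le> 9 / sqrt \<delta>"
    using neg by (intro van_der_Corput_second_pos[OF assms(1,2), where P = "\<lambda>s. - P s" and P' = "\<lambda>s. - P' s"])
      (auto intro!: DERIV_minus \<phi> P simp: le_minus_iff)
  \<comment> \<open>Negating the phase conjugates the integral and leaves its norm
    unchanged.\<close>
  also have "integral {a..b} (\<lambda>s. cis (- \<phi> s)) = cnj (integral {a..b} (\<lambda>s. cis (\<phi> s)))"
    by (simp add: cis_cnj[symmetric] integral_cnj)
  finally show ?thesis by simp
qed

section \<open>Translation and reflection of Lebesgue measure\<close>

lemma nn_integral_lborel_translate:
  fixes f :: "'a::euclidean_space \<Rightarrow> ennreal"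
  assumes [measurable]: "f \<in> borel_measurable borel"
  shows "(\<integral>\<^sup>+x. f (x + a) \<partial>lborel) = (\<integral>\<^sup>+x. f x \<partial>lborel)"
proof -
  have "(\<integral>\<^sup>+x. f x \<partial>lborel) = (\<integral>\<^sup>+x. f x \<partial>(distr lborel borel ((+) a)))"
    by (simp add: lborel_distr_plus)
  thus ?thesis by (simp add: nn_integral_distr add.commute)
qed

lemma lborel_integral_translate:
  fixes f :: "'a::euclidean_space \<Rightarrow> 'b::{banach,second_countable_topology}"
  assumes [measurable]: "f \<in> borel_measurable borel"
  shows "(LINT x|lborel. f (x + a)) = (LINT x|lborel. f x)"
proof -
  have "(LINT x|lborel. f x) = (LINT x|distr lborel borel ((+) a). f x)"
    by (simp add: lborel_distr_plus)
  thus ?thesis by (simp add: integral_distr add.commute)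
qed

lemma nn_integral_lborel_reflect:
  fixes f :: "'a::euclidean_space \<Rightarrow> ennreal"
  assumes [measurable]: "f \<in> borel_measurable borel"
  shows "(\<integral>\<^sup>+x. f (- x) \<partial>lborel) = (\<integral>\<^sup>+x. f x \<partial>lborel)"
proof -
  have "(\<integral>\<^sup>+x. f x \<partial>lborel) = (\<integral>\<^sup>+x. f x \<partial>(distr lborel borel uminus))"
    using lborel_affine[of "-1" "0 :: 'a"] by (simp add: density_1)
  thus ?thesis by (simp add: nn_integral_distr)
qed

lemma nn_integral_lborel_diff:
  fixes f :: "'a::euclidean_space \<Rightarrow> ennreal"
  assumes [measurable]: "f \<in> borel_measurable borel"
  shows "(\<integral>\<^sup>+x. f (a - x) \<partial>lborel) = (\<integral>\<^sup>+x. f x \<partial>lborel)"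
  using nn_integral_lborel_translate[of "\<lambda>x. f (- x)" "- a"] nn_integral_lborel_reflect[of f] by simp

lemma nn_integral_lborel_diff':
  fixes f :: "'a::euclidean_space \<Rightarrow> ennreal"
  assumes [measurable]: "f \<in> borel_measurable borel"
  shows "(\<integral>\<^sup>+x. f (x - a) \<partial>lborel) = (\<integral>\<^sup>+x. f x \<partial>lborel)"
  using nn_integral_lborel_translate[of f "- a"] by simp

lemma nn_integral_lborel_pair:
  fixes F :: "'a::euclidean_space \<times> 'b::euclidean_space \<Rightarrow> ennreal"
  assumes "F \<in> borel_measurable borel"
  shows "(\<integral>\<^sup>+z. F z \<partial>lborel) = (\<integral>\<^sup>+x. \<integral>\<^sup>+t. F (x, t) \<partial>lborel \<partial>lborel)"
proof -
  have "F \<in> borel_measurable (lborel \<Otimes>\<^sub>M lborel)" using assms by (simp add: lborel_prod)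
  thus ?thesis by (simp only: lborel.nn_integral_fst lborel_prod)
qed

lemma integrable_lborel_translate:
  fixes f :: "'a::euclidean_space \<Rightarrow> 'b::{banach,second_countable_topology}"
  assumes "integrable lborel f"
  shows "integrable lborel (\<lambda>x. f (x + a))"
proof -
  have [measurable]: "f \<in> borel_measurable borel" using assms by simp
  have "integrable (distr lborel borel ((+) a)) f" using assms by (simp only: lborel_distr_plus)
  thus ?thesis by (subst (asm) integrable_distr_eq) (auto simp: add.commute)
qed

lemma
  fixes U :: "'a::euclidean_space set"
  assumes [measurable]: "U \<in> sets borel" and fin: "emeasure lborel U < \<infinity>"
  shows integrable_indicator_diff: "integrable lborel (\<lambda>y. indicat_real U (z - y))"
    and integral_indicator_diff: "(LINT y|lborel. indicat_real U (z - y)) = measure lborel U"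
proof -
  have *: "(\<integral>\<^sup>+y. ennreal (indicator U (z - y)) \<partial>lborel) = emeasure lborel U"
    using nn_integral_lborel_diff[of "indicator U" z] by (simp add: ennreal_indicator)
  show "integrable lborel (\<lambda>y. indicat_real U (z - y))"
    using fin * by (intro integrableI_nonneg) auto
  show "(LINT y|lborel. indicat_real U (z - y)) = measure lborel U"
    using * by (subst integral_eq_nn_integral) (auto simp: measure_def)
qed

lemma borel_measurable_cis [measurable]: "cis \<in> borel_measurable borel"
  by (intro borel_measurable_continuous_onI continuous_on_cis continuous_intros)

section \<open>Decay of the Fourier transform of the surface measure\<close>

text \<open>By translation invariance the integral over \<open>C\<close> is an average of integrals over
  segments in direction \<open>v\<close>, so no change of coordinates is needed to use a bound on lines.\<close>

lemma norm_integral_compact_convex_le: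
  fixes C :: "'a::euclidean_space set" and \<psi> :: "'a \<Rightarrow> real"
  assumes C: "compact C" "convex C" "C \<subseteq> cball c \<rho>" and v: "norm v \<le> 1"
    and cont: "continuous_on C \<psi>" and "0 \<le> B"
    and B: "\<And>\<xi> a b. 0 \<le> a \<Longrightarrow> a \<le> b \<Longrightarrow> b \<le> 1 \<Longrightarrow> (\<And>s. s \<in> {a..b} \<Longrightarrow> \<xi> + s *\<^sub>R v \<in> C) \<Longrightarrow>
      norm (integral {a..b} (\<lambda>s. cis (\<psi> (\<xi> + s *\<^sub>R v)))) \<le> B"
  shows "norm (LINT \<xi>:C|lborel. cis (\<psi> \<xi>)) \<le> B * measure lborel (cball c (\<rho> + 1))"
proof -
  define F where "F \<xi> = indicator C \<xi> *\<^sub>R cis (\<psi> \<xi>)" for \<xi>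
  have closed: "closed C" using C(1) by (rule compact_imp_closed)
  have F[measurable]: "F \<in> borel_measurable borel"
    unfolding F_def
    using closed cont
    by (intro borel_measurable_continuous_on_indicator continuous_on_cis) auto
  \<comment> \<open>A shift by \<open>s *\<^sub>R v\<close> moves a point by at most 1, so the
    shifted integrand lives on a ball enlarged by 1. This box justifies Fubini and is the origin of
    the radius \<open>\<rho> + 1\<close>.\<close>
  define X where "X = {0..1::real} \<times> cball c (\<rho> + 1)"
  have X: "X \<in> sets (lborel \<Otimes>\<^sub>M lborel)" "emeasure (lborel \<Otimes>\<^sub>M lborel) X < \<infinity>"
    unfolding X_def by (auto simp: lborel.emeasure_pair_measure_Times ennreal_mult_less_top
        emeasure_lborel_cball_finite[unfolded infinity_ennreal_def])
  have bound: "norm (indicator {0..1} s *\<^sub>R F (\<xi> + s *\<^sub>R v)) \<le> indicator X (s, \<xi>)" for s \<xi>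
  proof (cases "s \<in> {0..1} \<and> \<xi> + s *\<^sub>R v \<in> C")
    case True
    have "dist c (\<xi> + s *\<^sub>R v) \<le> \<rho>" using True C(3) by auto
    moreover have "dist (\<xi> + s *\<^sub>R v) \<xi> \<le> 1"
      using True v by (simp add: dist_norm mult_le_one)
    ultimately have "dist c \<xi> \<le> \<rho> + 1"
      by (metis add_mono dist_triangle_le dist_triangle order_trans)
    thus ?thesis using True by (simp add: X_def F_def)
  qed (auto simp: F_def)
  have int: "integrable (lborel \<Otimes>\<^sub>M lborel) (\<lambda>(s, \<xi>). indicator {0..1} s *\<^sub>R F (\<xi> + s *\<^sub>R v))"
  proof (rule Bochner_Integration.integrable_bound)
    show "integrable (lborel \<Otimes>\<^sub>M lborel) (indicator X :: real \<times> 'a \<Rightarrow> real)"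
      using X by (simp add: integrable_indicator_iff)
    show "AE x in lborel \<Otimes>\<^sub>M lborel. norm (case x of (s, \<xi>) \<Rightarrow> indicator {0..1} s *\<^sub>R F (\<xi> + s *\<^sub>R v))
          \<le> norm (indicator X x :: real)"
      using bound by (auto simp: split_beta)
  qed measurable
  have line: "norm (LINT s|lborel. indicator {0..1} s *\<^sub>R F (\<xi> + s *\<^sub>R v)) \<le> B * indicator (cball c (\<rho> + 1)) \<xi>" for \<xi>
  proof -
    \<comment> \<open>Compactness and convexity of \<open>C\<close> make the set of admissible
      shifts a closed interval, possibly empty.\<close>
    define J where "J = {s \<in> {0..1}. \<xi> + s *\<^sub>R v \<in> C}"
    have J_eq: "J = {0..1} \<inter> (\<lambda>s. \<xi> + s *\<^sub>R v) -` C" by (auto simp: J_def)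
    have "closed J" unfolding J_eq 
      by (intro closed_Int closed_vimage closed continuous_intros)
    moreover have "bounded J" by (rule bounded_subset[of "{0..1::real}"]) (auto simp: J_def)
    ultimately have "compact J" by (simp add: compact_eq_bounded_closed)
    have "convex J"
    proof (rule convexI)
      fix x y u w :: real assume *: "x \<in> J" "y \<in> J" "0 \<le> u" "0 \<le> w" "u + w = 1"
      have "u *\<^sub>R x + w *\<^sub>R y \<in> {0..1}"
        using * by (intro convexD[OF convex_real_interval(5)]) (auto simp: J_def)
      moreover have "u *\<^sub>R (\<xi> + x *\<^sub>R v) + w *\<^sub>R (\<xi> + y *\<^sub>R v) \<in> C"
        using * by (intro convexD[OF C(2)]) (auto simp: J_def)
      moreover have "u *\<^sub>R (\<xi> + x *\<^sub>R v) + w *\<^sub>R (\<xi> + y *\<^sub>R v) = (u + w) *\<^sub>R \<xi> + (u *\<^sub>R x + w *\<^sub>R y) *\<^sub>R v"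
        by (simp add: algebra_simps)
      ultimately show "u *\<^sub>R x + w *\<^sub>R y \<in> J" using *(5) by (simp add: J_def)
    qed
    hence "connected J" by (rule convex_connected)
    show ?thesis
    proof (cases "J = {}")
      case True
      hence "(\<lambda>s. indicator {0..1} s *\<^sub>R F (\<xi> + s *\<^sub>R v)) = (\<lambda>s. 0)"
        by (auto simp: J_def F_def fun_eq_iff indicator_def)
      thus ?thesis using \<open>0 \<le> B\<close> by simp
    next
      case False
      obtain a b where ab: "J = {a..b}"
        using connected_compact_interval_1[of J] \<open>compact J\<close> \<open>connected J\<close> by auto
      hence "a \<le> b" using False by auto
      hence "a \<in> J" "b \<in> J" using ab by auto
      hence ab01: "0 \<le> a" "b \<le> 1" by (auto simp: J_def)
      have in_C: "\<xi> + s *\<^sub>R v \<in> C" if "s \<in> {a..b}" for s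
        using that ab unfolding J_def by blast
      have "(\<lambda>s. indicator {0..1} s *\<^sub>R F (\<xi> + s *\<^sub>R v)) = (\<lambda>s. indicator {a..b} s *\<^sub>R cis (\<psi> (\<xi> + s *\<^sub>R v)))"
        unfolding ab[symmetric] by (auto simp: J_def F_def fun_eq_iff indicator_def)
      hence "(LINT s|lborel. indicator {0..1} s *\<^sub>R F (\<xi> + s *\<^sub>R v)) = (LINT s:{a..b}|lborel. cis (\<psi> (\<xi> + s *\<^sub>R v)))"
        by (simp add: set_lebesgue_integral_def)
      also have "continuous_on {a..b} (\<lambda>s. cis (\<psi> (\<xi> + s *\<^sub>R v)))"
        by (intro continuous_on_cis continuous_on_compose2[OF cont] continuous_intros) (use in_C in auto)
      hence "(LINT s:{a..b}|lborel. cis (\<psi> (\<xi> + s *\<^sub>R v))) = integral {a..b} (\<lambda>s. cis (\<psi> (\<xi> + s *\<^sub>R v)))"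
        by (intro set_borel_integral_eq_integral(2) borel_integrable_atLeastAtMost')
      finally have "norm (LINT s|lborel. indicator {0..1} s *\<^sub>R F (\<xi> + s *\<^sub>R v)) \<le> B"
        using B[OF ab01(1) \<open>a \<le> b\<close> ab01(2) in_C] by simp
      moreover have "\<xi> \<in> cball c (\<rho> + 1)"
        using bound[of a \<xi>] \<open>a \<in> J\<close> by (cases "\<xi> \<in> cball c (\<rho> + 1)") (auto simp: J_def F_def X_def)
      ultimately show ?thesis by simp
    qed
  qed
  have "(LINT \<xi>:C|lborel. cis (\<psi> \<xi>)) = (LINT \<xi>|lborel. F \<xi>)"
    by (simp add: F_def set_lebesgue_integral_def)
  \<comment> \<open>The unit interval has length 1, so integrating its indicator in \<open>s\<close>
    changes nothing; translation invariance may then shift \<open>\<xi>\<close> by a different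
    amount for each \<open>s\<close>.\<close>
  also have "\<dots> = (LINT s|lborel. indicator {0..1::real} s *\<^sub>R (LINT \<xi>|lborel. F \<xi>))"
    by simp
  also have "\<dots> = (LINT s|lborel. LINT \<xi>|lborel. indicator {0..1::real} s *\<^sub>R F (\<xi> + s *\<^sub>R v))"
    by (simp add: lborel_integral_translate)
  also have "\<dots> = (LINT \<xi>|lborel. LINT s|lborel. indicator {0..1::real} s *\<^sub>R F (\<xi> + s *\<^sub>R v))"
    using int by (rule lborel_pair.Fubini_integral[symmetric])
  also have "norm \<dots> \<le> (LINT \<xi>|lborel. B * indicator (cball c (\<rho> + 1)) \<xi>)"
  proof (rule Bochner_Integration.integral_norm_bound_integral)
    show "integrable lborel (\<lambda>\<xi>. LINT s|lborel. indicator {0..1::real} s *\<^sub>R F (\<xi> + s *\<^sub>R v))"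
      using lborel_pair.integrable_snd[OF int] by simp
    show "integrable lborel (\<lambda>\<xi>. B * indicat_real (cball c (\<rho> + 1)) \<xi>)"
      by (intro integrable_mult_right) (auto simp: emeasure_lborel_cball_finite[unfolded infinity_ennreal_def])
  qed (use line in auto)
  finally show ?thesis by simp
qed

subsection \<open>Second derivatives\<close>

abbreviation dir_deriv :: "'a::real_normed_vector \<Rightarrow> ('a \<Rightarrow> real) \<Rightarrow> 'a \<Rightarrow> real" where
  "dir_deriv v f x \<equiv> frechet_derivative f (at x) v"

lemma dir_deriv_on_line:
  assumes "f differentiable (at (x + s *\<^sub>R v))"
  shows "((\<lambda>s. f (x + s *\<^sub>R v)) has_real_derivative dir_deriv v f (x + s *\<^sub>R v)) (at s within T)"
proof -
  have "((\<lambda>s. x + s *\<^sub>R v) has_vector_derivative v) (at s within T)"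
    by (auto intro!: derivative_eq_intros)
  moreover have "(f has_derivative frechet_derivative f (at (x + s *\<^sub>R v))) (at (x + s *\<^sub>R v) within (\<lambda>s. x + s *\<^sub>R v) ` T)"
    using assms by (meson frechet_derivative_works has_derivative_at_withinI)
  ultimately show ?thesis
    using vector_derivative_diff_chain_within[of "\<lambda>s. x + s *\<^sub>R v" v s T f]
    by (simp add: has_real_derivative_iff_has_vector_derivative o_def)
qed

lemma second_difference_mean_value:
  fixes f :: "'a::real_normed_vector \<Rightarrow> real"
  assumes "0 < h"
    and df: "\<And>t s. t \<in> {0..h} \<Longrightarrow> s \<in> {0..h} \<Longrightarrow> f differentiable (at (x + t *\<^sub>R v + s *\<^sub>R w))"
    and ddf: "\<And>t s. t \<in> {0..h} \<Longrightarrow> s \<in> {0..h} \<Longrightarrow> dir_deriv v f differentiable (at (x + t *\<^sub>R v + s *\<^sub>R w))"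
  shows "\<exists>t\<in>{0..h}. \<exists>s\<in>{0..h}. f (x + h *\<^sub>R v + h *\<^sub>R w) - f (x + h *\<^sub>R v) - f (x + h *\<^sub>R w) + f x
           = h\<^sup>2 * dir_deriv w (dir_deriv v f) (x + t *\<^sub>R v + s *\<^sub>R w)"
proof -
  \<comment> \<open>The first difference in direction \<open>w\<close>. The mean value theorem is
    applied to it along \<open>v\<close>, and then to \<open>dir_deriv v f\<close> along
    \<open>w\<close>.\<close>
  define g where "g t = f ((x + h *\<^sub>R w) + t *\<^sub>R v) - f (x + t *\<^sub>R v)" for t
  have "\<exists>t>0. t < h \<and> g h - g 0 = (h - 0) * (dir_deriv v f ((x + h *\<^sub>R w) + t *\<^sub>R v) - dir_deriv v f (x + t *\<^sub>R v))"
  proof (rule MVT2[OF assms(1)])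
    fix t assume "0 \<le> t" "t \<le> h"
    hence "f differentiable (at (x + h *\<^sub>R w + t *\<^sub>R v))" "f differentiable (at (x + t *\<^sub>R v))"
      using df[of t h] df[of t 0] assms(1) by (auto simp: algebra_simps)
    thus "(g has_real_derivative (dir_deriv v f ((x + h *\<^sub>R w) + t *\<^sub>R v) - dir_deriv v f (x + t *\<^sub>R v))) (at t)"
      unfolding g_def[abs_def] by (intro DERIV_diff dir_deriv_on_line)
  qed
  then obtain t where t: "0 < t" "t < h"
    "g h - g 0 = h * (dir_deriv v f ((x + h *\<^sub>R w) + t *\<^sub>R v) - dir_deriv v f (x + t *\<^sub>R v))" by auto
  have "\<exists>s>0. s < h \<and> dir_deriv v f ((x + t *\<^sub>R v) + h *\<^sub>R w) - dir_deriv v f ((x + t *\<^sub>R v) + 0 *\<^sub>R w)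
      = (h - 0) * dir_deriv w (dir_deriv v f) ((x + t *\<^sub>R v) + s *\<^sub>R w)"
    by (rule MVT2[OF assms(1)]) (use ddf t in \<open>auto intro!: dir_deriv_on_line\<close>)
  then obtain s where s: "0 < s" "s < h" "dir_deriv v f ((x + t *\<^sub>R v) + h *\<^sub>R w) - dir_deriv v f (x + t *\<^sub>R v)
      = h * dir_deriv w (dir_deriv v f) ((x + t *\<^sub>R v) + s *\<^sub>R w)" by auto
  have "f (x + h *\<^sub>R v + h *\<^sub>R w) - f (x + h *\<^sub>R v) - f (x + h *\<^sub>R w) + f x = g h - g 0"
    by (simp add: g_def algebra_simps)
  also have "\<dots> = h\<^sup>2 * dir_deriv w (dir_deriv v f) (x + t *\<^sub>R v + s *\<^sub>R w)"
    using t(3) s(3) by (simp add: power2_eq_square algebra_simps)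
  finally show ?thesis using t s by (intro bexI[of _ t] bexI[of _ s]) auto
qed

text \<open>The second difference of \<open>f\<close> over a small parallelogram does not depend on
  the order of the two directions. The mean value theorem expresses it through either mixed
  derivative at a nearby point, and continuity of both at \<open>x\<close> rules out a positive
  gap.\<close>

lemma dir_deriv_commute:
  fixes f :: "'a::real_normed_vector \<Rightarrow> real"
  assumes "open S" "x \<in> S" "Ck_on 2 f S"
  shows "dir_deriv w (dir_deriv v f) x = dir_deriv v (dir_deriv w f) x"
proof (rule ccontr)
  assume ne: "\<not> ?thesis"
  have *: "f differentiable (at y)" "dir_deriv u f differentiable (at y)"
    "continuous_on S (dir_deriv u' (dir_deriv u f))" if "y \<in> S" for y u u'
    using assms(3) that by (auto simp: numeral_2_eq_2)
  define \<epsilon> where "\<epsilon> = \<bar>dir_deriv w (dir_deriv v f) x - dir_deriv v (dir_deriv w f) x\<bar> / 2"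
  have "\<epsilon> > 0" using ne by (simp add: \<epsilon>_def)
  have "continuous (at x) (dir_deriv u' (dir_deriv u f))" for u u'
    using *(3)[OF assms(2)] assms(1,2) by (simp add: continuous_on_eq_continuous_at)
  hence ev: "\<forall>\<^sub>F y in nhds x. dist (dir_deriv u' (dir_deriv u f) y) (dir_deriv u' (dir_deriv u f) x) < \<epsilon>" for u u'
    using \<open>\<epsilon> > 0\<close> by (simp add: tendsto_iff continuous_at eventually_nhds_conv_at)
  have "\<forall>\<^sub>F y in nhds x. y \<in> S \<and> dist (dir_deriv w (dir_deriv v f) y) (dir_deriv w (dir_deriv v f) x) < \<epsilon>
     \<and> dist (dir_deriv v (dir_deriv w f) y) (dir_deriv v (dir_deriv w f) x) < \<epsilon>"
    using eventually_nhds_in_open[OF assms(1,2)] ev[of w v] ev[of v w] by eventually_elim simp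
  then obtain d where d: "d > 0" "\<And>y. dist y x < d \<Longrightarrow> y \<in> S" 
    "\<And>y. dist y x < d \<Longrightarrow> dist (dir_deriv w (dir_deriv v f) y) (dir_deriv w (dir_deriv v f) x) < \<epsilon>"
    "\<And>y. dist y x < d \<Longrightarrow> dist (dir_deriv v (dir_deriv w f) y) (dir_deriv v (dir_deriv w f) x) < \<epsilon>"
    unfolding eventually_nhds_metric by blast
  define N where "N = norm v + norm w + 1"
  define h where "h = d / (2 * N)"
  have nn: "N > 0" by (simp add: N_def add_nonneg_pos)
  have h: "h > 0" using d(1) nn by (simp add: h_def)
  have near: "dist (x + t *\<^sub>R v + s *\<^sub>R w) x < d" if "t \<in> {0..h}" "s \<in> {0..h}" for t s
  proof -
    have "dist (x + t *\<^sub>R v + s *\<^sub>R w) x \<le> t * norm v + s * norm w"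
      using that norm_triangle_ineq[of "t *\<^sub>R v" "s *\<^sub>R w"] by (simp add: dist_norm add.assoc)
    also have "\<dots> \<le> h * norm v + h * norm w" using that by (intro add_mono mult_right_mono) auto
    also have "\<dots> \<le> h * N" using h by (simp add: N_def algebra_simps)
    also have "\<dots> = d / 2" using nn by (simp add: h_def)
    finally show ?thesis using d(1) by simp
  qed
  obtain t s where ts: "t \<in> {0..h}" "s \<in> {0..h}" "f (x + h *\<^sub>R v + h *\<^sub>R w) - f (x + h *\<^sub>R v) - f (x + h *\<^sub>R w) + f x
           = h\<^sup>2 * dir_deriv w (dir_deriv v f) (x + t *\<^sub>R v + s *\<^sub>R w)"
    using second_difference_mean_value[OF h *(1) *(2), of x v w, OF d(2)[OF near] d(2)[OF near]] by blast
  have near': "dist (x + t *\<^sub>R w + s *\<^sub>R v) x < d" if "t \<in> {0..h}" "s \<in> {0..h}" for t s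
    using near[OF that(2,1)] by (simp add: algebra_simps)
  obtain t' s' where ts': "t' \<in> {0..h}" "s' \<in> {0..h}" "f (x + h *\<^sub>R w + h *\<^sub>R v) - f (x + h *\<^sub>R w) - f (x + h *\<^sub>R v) + f x
           = h\<^sup>2 * dir_deriv v (dir_deriv w f) (x + t' *\<^sub>R w + s' *\<^sub>R v)"
    using second_difference_mean_value[OF h *(1) *(2), of x w v, OF d(2)[OF near'] d(2)[OF near']] by blast
  have "h\<^sup>2 * dir_deriv w (dir_deriv v f) (x + t *\<^sub>R v + s *\<^sub>R w) = h\<^sup>2 * dir_deriv v (dir_deriv w f) (x + t' *\<^sub>R w + s' *\<^sub>R v)"
    using ts(3) ts'(3) by (simp add: algebra_simps)
  hence "dir_deriv w (dir_deriv v f) (x + t *\<^sub>R v + s *\<^sub>R w) = dir_deriv v (dir_deriv w f) (x + t' *\<^sub>R w + s' *\<^sub>R v)"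
    using h by simp
  moreover have False if "\<bar>p - q\<bar> < \<bar>q - r\<bar> / 2" "\<bar>p - r\<bar> < \<bar>q - r\<bar> / 2" for p q r :: real
  proof -
    have "\<bar>q - r\<bar> \<le> \<bar>p - q\<bar> + \<bar>p - r\<bar>" by simp
    thus False using that by argo
  qed
  ultimately show False
    using d(3)[OF near[OF ts(1,2)]] d(4)[OF near'[OF ts'(1,2)]] unfolding \<epsilon>_def dist_real_def by metis
qed

text \<open>By polarisation, a symmetric bilinear form that vanishes on the diagonal vanishes
  altogether, so a nonzero entry of the Hessian forces a nonzero second derivative in a single
  direction. Normalising that direction prepares it for the segments of
  \<open>norm_integral_compact_convex_le\<close>.\<close>

lemma exists_dir_deriv2_nonzero:
  fixes f :: "real^'n::finite \<Rightarrow> real"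
  assumes "open S" "x \<in> S" "Ck_on 2 f S" "rank (hessian f x) \<ge> 1"
  shows "\<exists>v. norm v \<le> 1 \<and> dir_deriv v (dir_deriv v f) x \<noteq> 0"
proof -
  have diff: "f differentiable (at y)" "dir_deriv u f differentiable (at y)" if "y \<in> S" for y u
    using assms(3) that by (auto simp: numeral_2_eq_2)
  have lin: "linear (\<lambda>u. dir_deriv u g y)" if "g differentiable (at y)" for g :: "real^'n \<Rightarrow> real" and y
    using that linear_frechet_derivative by blast
  have "hessian f x \<noteq> 0" using assms(4) rank_eq_0[of "hessian f x"] by auto
  then obtain i j where ij: "hessian f x $ i $ j \<noteq> 0"
    by (metis vec_eq_iff zero_index)
  define H where "H u w = dir_deriv u (dir_deriv w f) x" for u w
  have Hij: "H (axis i 1) (axis j 1) \<noteq> 0"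
    using ij by (simp add: hessian_def partial_deriv_def[abs_def] H_def)
  have add1: "H (u + u') w = H u w + H u' w" and scale1: "H (c *\<^sub>R u) w = c * H u w" for u u' w c
    using lin[OF diff(2)[OF assms(2)]] by (simp_all add: H_def linear_add linear_cmul)
  have sym: "H u w = H w u" for u w
    unfolding H_def by (rule dir_deriv_commute[OF assms(1-3)])
  have add2: "H w (u + u') = H w u + H w u'" and scale2: "H w (c *\<^sub>R u) = c * H w u" for u u' w c
    using add1 scale1 sym by metis+
  have "\<exists>v. H v v \<noteq> 0"
  proof (rule ccontr)
    assume "\<not> ?thesis"
    hence z: "H v v = 0" for v by simp
    have "H (axis i 1 + axis j 1) (axis i 1 + axis j 1) = 2 * H (axis i 1) (axis j 1)"
      using z[of "axis i 1"] z[of "axis j 1"] sym[of "axis i 1" "axis j 1"] by (simp add: add1 add2)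
    thus False using z Hij by simp
  qed
  then obtain v where v: "H v v \<noteq> 0" by blast
  have "v \<noteq> 0" using v scale1[of 0 0 0] by auto
  hence "H ((1 / norm v) *\<^sub>R v) ((1 / norm v) *\<^sub>R v) \<noteq> 0" using v by (simp add: scale1 scale2)
  thus ?thesis using \<open>v \<noteq> 0\<close> unfolding H_def by (intro exI[of _ "(1 / norm v) *\<^sub>R v"]) auto
qed

subsection \<open>Decay on pieces of the annulus\<close>

text \<open>The Fourier transform of Lebesgue measure on \<open>D\<close> lifted to the graph. The
  area element is left out: on the annulus it lies between 1 and a constant, so it can be restored
  at the end.\<close>

definition kernel :: "(real^'n::finite \<Rightarrow> real) \<Rightarrow> (real^'n) set \<Rightarrow> (real^'n) \<times> real \<Rightarrow> complex" where
  "kernel \<Phi> D z = (LINT \<xi>:D|lborel. cis (- (z \<bullet> (\<xi>, \<Phi> \<xi>))))"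

lemma Ck_on_2D:
  assumes "Ck_on 2 f S" "x \<in> S"
  shows "f differentiable (at x)" "dir_deriv u f differentiable (at x)"
  using assms by (auto simp: numeral_2_eq_2)

lemma continuous_on_Ck_on_2:
  assumes "Ck_on 2 f S"
  shows "continuous_on S f" "continuous_on S (dir_deriv u f)" "continuous_on S (dir_deriv w (dir_deriv u f))"
  using assms Ck_on_2D[OF assms]
  by (auto simp: numeral_2_eq_2 intro!: continuous_at_imp_continuous_on differentiable_imp_continuous_within)

lemma phase_derivs:
  fixes \<Phi> :: "real^'n::finite \<Rightarrow> real"
  assumes "Ck_on 2 \<Phi> S" "\<xi> + s *\<^sub>R v \<in> S"
  shows "((\<lambda>s. - ((x, t) \<bullet> (\<xi> + s *\<^sub>R v, \<Phi> (\<xi> + s *\<^sub>R v)))) has_real_derivative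
      - (x \<bullet> v + t * dir_deriv v \<Phi> (\<xi> + s *\<^sub>R v))) (at s within T)"
    and "((\<lambda>s. - (x \<bullet> v + t * dir_deriv v \<Phi> (\<xi> + s *\<^sub>R v))) has_real_derivative
      - (t * dir_deriv v (dir_deriv v \<Phi>) (\<xi> + s *\<^sub>R v))) (at s within T)"
proof -
  note d = dir_deriv_on_line[OF Ck_on_2D(1)[OF assms], of T] dir_deriv_on_line[OF Ck_on_2D(2)[OF assms, of v], of T]
  have "((\<lambda>s. - (x \<bullet> \<xi> + s * (x \<bullet> v) + t * \<Phi> (\<xi> + s *\<^sub>R v))) has_real_derivative
      - (x \<bullet> v + t * dir_deriv v \<Phi> (\<xi> + s *\<^sub>R v))) (at s within T)"
    by (auto intro!: derivative_eq_intros d)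
  thus "((\<lambda>s. - ((x, t) \<bullet> (\<xi> + s *\<^sub>R v, \<Phi> (\<xi> + s *\<^sub>R v)))) has_real_derivative
      - (x \<bullet> v + t * dir_deriv v \<Phi> (\<xi> + s *\<^sub>R v))) (at s within T)"
    by (simp add: inner_add_right inner_scaleR_right)
  show "((\<lambda>s. - (x \<bullet> v + t * dir_deriv v \<Phi> (\<xi> + s *\<^sub>R v))) has_real_derivative
      - (t * dir_deriv v (dir_deriv v \<Phi>) (\<xi> + s *\<^sub>R v))) (at s within T)"
    by (auto intro!: derivative_eq_intros d)
qed

lemma continuous_on_phase:
  assumes "continuous_on S \<Phi>"
  shows "continuous_on S (\<lambda>\<xi>. - (z \<bullet> (\<xi>, \<Phi> \<xi>)))"
  by (intro continuous_intros assms)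

text \<open>Along \<open>v\<close> the second derivative of the phase is \<open>- t\<close> times
  that of \<open>\<Phi>\<close>, whatever \<open>x\<close> is. The bound is therefore uniform in
  \<open>x\<close>.\<close>

lemma norm_kernel_le_time:
  fixes \<Phi> :: "real^'n::finite \<Rightarrow> real"
  assumes \<Phi>: "Ck_on 2 \<Phi> S" and C: "compact C" "convex C" "C \<subseteq> cball c \<rho>" "C \<subseteq> S"
    and v: "norm v \<le> 1" and "0 < \<kappa>" "t \<noteq> 0"
    and sign: "(\<forall>\<xi>\<in>C. \<kappa> \<le> dir_deriv v (dir_deriv v \<Phi>) \<xi>) \<or> (\<forall>\<xi>\<in>C. dir_deriv v (dir_deriv v \<Phi>) \<xi> \<le> - \<kappa>)"
  shows "norm (kernel \<Phi> C (x, t)) \<le> 9 / sqrt (\<kappa> * \<bar>t\<bar>) * measure lborel (cball c (\<rho> + 1))"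
  unfolding kernel_def
proof (rule norm_integral_compact_convex_le[OF C(1-3) v])
  show "continuous_on C (\<lambda>\<xi>. - ((x, t) \<bullet> (\<xi>, \<Phi> \<xi>)))"
    using continuous_on_phase continuous_on_subset[OF continuous_on_Ck_on_2(1)[OF \<Phi>] C(4)] .
  fix \<xi> and a b :: real assume ab: "a \<le> b" and in_C: "\<And>s. s \<in> {a..b} \<Longrightarrow> \<xi> + s *\<^sub>R v \<in> C"
  \<comment> \<open>For positive \<open>t\<close> the two alternatives of \<open>sign\<close> are
    exchanged, for negative \<open>t\<close> they are kept.\<close>
  have "(\<forall>\<xi>\<in>C. \<kappa> * \<bar>t\<bar> \<le> - (t * dir_deriv v (dir_deriv v \<Phi>) \<xi>)) \<or>
        (\<forall>\<xi>\<in>C. - (t * dir_deriv v (dir_deriv v \<Phi>) \<xi>) \<le> - (\<kappa> * \<bar>t\<bar>))"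
  proof (cases "t > 0")
    case True
    have *: "y \<ge> \<kappa> \<Longrightarrow> - (t * y) \<le> - (\<kappa> * \<bar>t\<bar>)" "y \<le> - \<kappa> \<Longrightarrow> \<kappa> * \<bar>t\<bar> \<le> - (t * y)" for y
      using True mult_left_mono[of \<kappa> y t] mult_left_mono[of y "- \<kappa>" t] by (simp_all add: algebra_simps)
    thus ?thesis using sign by meson
  next
    case False
    hence "t < 0" using assms(8) by simp
    hence *: "y \<ge> \<kappa> \<Longrightarrow> \<kappa> * \<bar>t\<bar> \<le> - (t * y)" "y \<le> - \<kappa> \<Longrightarrow> - (t * y) \<le> - (\<kappa> * \<bar>t\<bar>)" for y
      using mult_left_mono[of \<kappa> y "- t"] mult_left_mono[of y "- \<kappa>" "- t"] by (simp_all add: algebra_simps)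
    thus ?thesis using sign by meson
  qed
  hence "(\<forall>s\<in>{a..b}. \<kappa> * \<bar>t\<bar> \<le> - (t * dir_deriv v (dir_deriv v \<Phi>) (\<xi> + s *\<^sub>R v))) \<or>
         (\<forall>s\<in>{a..b}. - (t * dir_deriv v (dir_deriv v \<Phi>) (\<xi> + s *\<^sub>R v)) \<le> - (\<kappa> * \<bar>t\<bar>))"
    using in_C by blast
  moreover have "0 < \<kappa> * \<bar>t\<bar>" using assms(7,8) by simp
  moreover have "\<xi> + s *\<^sub>R v \<in> S" if "s \<in> {a..b}" for s using in_C[OF that] C(4) by blast
  ultimately show "norm (integral {a..b} (\<lambda>s. cis (- ((x, t) \<bullet> (\<xi> + s *\<^sub>R v, \<Phi> (\<xi> + s *\<^sub>R v)))))) \<le> 9 / sqrt (\<kappa> * \<bar>t\<bar>)"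
    by (intro van_der_Corput_second[OF ab _ phase_derivs(1)[OF \<Phi>] phase_derivs(2)[OF \<Phi>]]) auto
qed (use assms in auto)

text \<open>When \<open>x \<bullet> v\<close> outweighs \<open>t\<close> times the derivatives of
  \<open>\<Phi>\<close>, the phase has no stationary point along \<open>v\<close>: with
  \<open>\<delta> = \<bar>x \<bullet> v\<bar> / 2\<close>, its derivative is at least
  \<open>\<delta>\<close> and its second derivative at most \<open>\<delta>\<close> in modulus. On
  segments of parameter length at most 1 the first-order bound is \<open>3 / \<delta>\<close>, which
  explains the 6.\<close>

lemma norm_kernel_le_space:
  fixes \<Phi> :: "real^'n::finite \<Rightarrow> real"
  assumes \<Phi>: "Ck_on 2 \<Phi> S" and C: "compact C" "convex C" "C \<subseteq> cball c \<rho>" "C \<subseteq> S"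
    and v: "norm v \<le> 1" and "x \<bullet> v \<noteq> 0" "2 * M * \<bar>t\<bar> \<le> \<bar>x \<bullet> v\<bar>"
    and M: "\<And>\<xi>. \<xi> \<in> C \<Longrightarrow> \<bar>dir_deriv v \<Phi> \<xi>\<bar> \<le> M" "\<And>\<xi>. \<xi> \<in> C \<Longrightarrow> \<bar>dir_deriv v (dir_deriv v \<Phi>) \<xi>\<bar> \<le> M"
  shows "norm (kernel \<Phi> C (x, t)) \<le> 6 / \<bar>x \<bullet> v\<bar> * measure lborel (cball c (\<rho> + 1))"
  unfolding kernel_def
proof (rule norm_integral_compact_convex_le[OF C(1-3) v])
  show "continuous_on C (\<lambda>\<xi>. - ((x, t) \<bullet> (\<xi>, \<Phi> \<xi>)))"
    using continuous_on_phase continuous_on_subset[OF continuous_on_Ck_on_2(1)[OF \<Phi>] C(4)] .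
  fix \<xi> and a b :: real assume ab: "0 \<le> a" "a \<le> b" "b \<le> 1" and in_C: "\<And>s. s \<in> {a..b} \<Longrightarrow> \<xi> + s *\<^sub>R v \<in> C"
  define \<delta> where "\<delta> = \<bar>x \<bullet> v\<bar> / 2"
  have \<delta>: "0 < \<delta>" using assms(7) by (simp add: \<delta>_def)
  have tM: "\<bar>t * y\<bar> \<le> \<delta>" if "\<bar>y\<bar> \<le> M" for y
    using mult_left_mono[OF that, of "\<bar>t\<bar>"] assms(8) by (simp add: \<delta>_def abs_mult algebra_simps)
  have "norm (integral {a..b} (\<lambda>s. cis (- ((x, t) \<bullet> (\<xi> + s *\<^sub>R v, \<Phi> (\<xi> + s *\<^sub>R v)))))) \<le> 2 / \<delta> + \<delta> * (b - a) / \<delta>\<^sup>2"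
  proof (rule van_der_Corput_first[OF ab(2) \<delta> _ phase_derivs(1)[OF \<Phi>] phase_derivs(2)[OF \<Phi>]])
    fix s assume "s \<in> {a..b}"
    note s = in_C[OF this]
    show "\<delta> \<le> \<bar>- (x \<bullet> v + t * dir_deriv v \<Phi> (\<xi> + s *\<^sub>R v))\<bar>"
      using tM[OF M(1)[OF s]] unfolding \<delta>_def by linarith
    show "\<bar>- (t * dir_deriv v (dir_deriv v \<Phi>) (\<xi> + s *\<^sub>R v))\<bar> \<le> \<delta>"
      using tM[OF M(2)[OF s]] by simp
    show "\<xi> + s *\<^sub>R v \<in> S" "\<xi> + s *\<^sub>R v \<in> S" using s C(4) by blast+
  qed (use \<delta> in auto)
  also have "\<dots> \<le> 2 / \<delta> + \<delta> * 1 / \<delta>\<^sup>2"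
    using ab \<delta> by (intro add_left_mono divide_right_mono mult_left_mono) auto
  also have "\<dots> = 6 / \<bar>x \<bullet> v\<bar>"
    using \<delta> by (simp add: power2_eq_square) (simp add: \<delta>_def)
  finally show "norm (integral {a..b} (\<lambda>s. cis (- ((x, t) \<bullet> (\<xi> + s *\<^sub>R v, \<Phi> (\<xi> + s *\<^sub>R v)))))) \<le> 6 / \<bar>x \<bullet> v\<bar>" .
qed auto

lemma norm_kernel_le_measure:
  assumes "D \<in> sets borel" "emeasure lborel D < \<infinity>"
  shows "norm (kernel \<Phi> D z) \<le> measure lborel D"
proof -
  have "norm (kernel \<Phi> D z) \<le> (LINT \<xi>|lborel. indicator D \<xi>)"
    unfolding kernel_def set_lebesgue_integral_def
    using assms by (intro order_trans[OF integral_norm_bound]) (auto intro!: Bochner_Integration.integral_cong simp: indicator_def)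
  thus ?thesis by simp
qed

text \<open>The product form avoids a division by zero at the origin, and its value there shows that
  \<open>K\<close> is nonnegative.\<close>

definition decaying_piece :: "(real^'n::finite \<Rightarrow> real) \<Rightarrow> (real^'n) set \<Rightarrow> bool" where
  "decaying_piece \<Phi> D \<longleftrightarrow> D \<in> sets borel \<and> D \<subseteq> annulus \<and>
     (\<exists>K. \<forall>z. norm (kernel \<Phi> D z) * sqrt (norm z) \<le> K)"


text \<open>Three regimes. For \<open>z\<close> in the unit ball the measure of \<open>C\<close> is
  bound enough. If \<open>norm x \<le> L * \<bar>t\<bar>\<close>, the second derivative along
  \<open>v\<close> gives decay like an inverse square root of \<open>t\<close>. If \<open>x\<close>
  dominates, the phase is nonstationary along a coordinate axis on which \<open>x\<close> is
  largest, a direction unrelated to \<open>v\<close>, and the decay is even of order 1.\<close>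

lemma kernel_decay_compact_convex:
  fixes \<Phi> :: "real^'n::finite \<Rightarrow> real"
  assumes \<Phi>: "Ck_on 2 \<Phi> S" and C: "compact C" "convex C" "C \<subseteq> S"
    and v: "norm v \<le> 1" and \<kappa>: "0 < \<kappa>"
    and sign: "(\<forall>\<xi>\<in>C. \<kappa> \<le> dir_deriv v (dir_deriv v \<Phi>) \<xi>) \<or> (\<forall>\<xi>\<in>C. dir_deriv v (dir_deriv v \<Phi>) \<xi> \<le> - \<kappa>)"
  shows "\<exists>K. \<forall>z. norm (kernel \<Phi> C z) * sqrt (norm z) \<le> K"
proof -
  obtain \<rho> where \<rho>: "C \<subseteq> cball 0 \<rho>"
    using compact_imp_bounded[OF C(1)] unfolding bounded_iff subset_iff mem_cball_0 by blast
  define V where "V = measure lborel (cball (0 :: real^'n) (\<rho> + 1))"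
  have V: "0 \<le> V" by (simp add: V_def)
  define n where "n = real CARD('n)"
  have n: "1 \<le> n" by (simp add: n_def Suc_leI)
  have "\<exists>m\<ge>0. \<forall>\<xi>\<in>C. \<bar>g \<xi>\<bar> \<le> m" if "continuous_on S g" for g :: "real^'n \<Rightarrow> real"
  proof -
    have "bounded (g ` C)"
      using continuous_on_subset[OF that C(3)] C(1) by (intro compact_imp_bounded compact_continuous_image)
    then obtain m where "m > 0" "\<forall>x\<in>g ` C. norm x \<le> m" using bounded_pos by blast
    thus ?thesis by (intro exI[of _ m]) auto
  qed
  hence "\<forall>i. \<exists>m\<ge>0. \<forall>\<xi>\<in>C. \<bar>dir_deriv (axis i 1) \<Phi> \<xi>\<bar> \<le> m" 
    "\<forall>i. \<exists>m\<ge>0. \<forall>\<xi>\<in>C. \<bar>dir_deriv (axis i 1) (dir_deriv (axis i 1) \<Phi>) \<xi>\<bar> \<le> m"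
    using continuous_on_Ck_on_2[OF \<Phi>] by blast+
  then obtain m1 m2 where m: "\<And>i. 0 \<le> m1 i" "\<And>i. 0 \<le> m2 i"
    "\<And>i \<xi>. \<xi> \<in> C \<Longrightarrow> \<bar>dir_deriv (axis i 1) \<Phi> \<xi>\<bar> \<le> m1 i"
    "\<And>i \<xi>. \<xi> \<in> C \<Longrightarrow> \<bar>dir_deriv (axis i 1) (dir_deriv (axis i 1) \<Phi>) \<xi>\<bar> \<le> m2 i"
    by metis
  define M where "M = (\<Sum>i\<in>UNIV. m1 i + m2 i)"
  have mM: "m1 i + m2 i \<le> M" for i unfolding M_def by (rule member_le_sum) (use m in auto)
  have M0: "0 \<le> M" unfolding M_def by (intro sum_nonneg add_nonneg_nonneg m)
  have M: "\<bar>dir_deriv (axis i 1) \<Phi> \<xi>\<bar> \<le> M" "\<bar>dir_deriv (axis i 1) (dir_deriv (axis i 1) \<Phi>) \<xi>\<bar> \<le> M" if "\<xi> \<in> C" for i \<xi>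
    using m(1)[of i] m(2)[of i] m(3)[OF that, of i] m(4)[OF that, of i] mM[of i] by linarith+
  \<comment> \<open>Chosen so that \<open>L * \<bar>t\<bar> < norm x\<close> forces
    \<open>2 * M * \<bar>t\<bar> \<le> \<bar>x $ i\<bar>\<close> for a coordinate with
    \<open>norm x \<le> n * \<bar>x $ i\<bar>\<close>, as the nonstationary bound demands.\<close>
  define L where "L = 2 * M * n + 1"
  have L: "1 \<le> L" using M0 n by (simp add: L_def)
  define K where "K = measure lborel C + 9 * V * sqrt ((L + 1) / \<kappa>) + 12 * n * V"
  have K: "measure lborel C \<le> K" "9 * V * sqrt ((L + 1) / \<kappa>) \<le> K" "12 * n * V \<le> K"
    using V n L \<kappa> by (auto simp: K_def)
  have "norm (kernel \<Phi> C z) * sqrt (norm z) \<le> K" for z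
  proof -
    obtain x t where z: "z = (x, t)" by (cases z)
    have N: "norm z \<le> norm x + \<bar>t\<bar>" unfolding z by (metis norm_Pair_le real_norm_def)
    consider "norm z \<le> 1" | "1 < norm z" "norm x \<le> L * \<bar>t\<bar>" | "1 < norm z" "L * \<bar>t\<bar> < norm x" by linarith
    thus ?thesis
    proof cases
      case 1
      have "norm (kernel \<Phi> C z) * sqrt (norm z) \<le> measure lborel C * 1"
        using 1 borel_closed[OF compact_imp_closed[OF C(1)]] emeasure_compact_finite[OF C(1)]
        by (intro mult_mono norm_kernel_le_measure) auto
      thus ?thesis using K(1) by simp
    next
      case 2
      hence t: "t \<noteq> 0" using N by auto
      have "norm z \<le> (L + 1) * \<bar>t\<bar>" using N 2 by (simp add: algebra_simps)
      hence "norm (kernel \<Phi> C z) * sqrt (norm z) \<le> (9 / sqrt (\<kappa> * \<bar>t\<bar>) * V) * sqrt ((L + 1) * \<bar>t\<bar>)"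
        using V \<kappa> unfolding V_def z
        by (intro mult_mono norm_kernel_le_time[OF \<Phi> C(1,2) \<rho> C(3) v \<kappa> t sign]) auto
      also have "\<dots> = 9 * V * sqrt ((L + 1) / \<kappa>)"
        using t \<kappa> L by (simp add: real_sqrt_mult real_sqrt_divide)
      finally show ?thesis using K(2) by simp
    next
      case 3
      obtain i where i: "norm x \<le> n * \<bar>x $ i\<bar>"
      proof -
        have "norm x \<le> (\<Sum>i\<in>UNIV. \<bar>x $ i\<bar>)" by (rule norm_le_l1_cart)
        also have "\<dots> \<le> (\<Sum>i\<in>(UNIV::'n set). Max (range (\<lambda>i. \<bar>x $ i\<bar>)))" by (intro sum_mono Max_ge) auto
        also have "\<dots> = n * Max (range (\<lambda>i. \<bar>x $ i\<bar>))" by (simp add: n_def)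
        finally have le: "norm x \<le> n * Max (range (\<lambda>i. \<bar>x $ i\<bar>))" .
        have "Max (range (\<lambda>i. \<bar>x $ i\<bar>)) \<in> range (\<lambda>i. \<bar>x $ i\<bar>)" by (rule Max_in) auto
        then obtain i where "Max (range (\<lambda>i. \<bar>x $ i\<bar>)) = \<bar>x $ i\<bar>" by (rule rangeE)
        thus ?thesis using le that[of i] by (simp only:)
      qed
      have xi: "x \<bullet> axis i 1 = x $ i" by (simp add: inner_axis)
      have "0 \<le> L * \<bar>t\<bar>" using L by simp
      hence "0 < norm x" using 3 by linarith
      hence xi0: "x $ i \<noteq> 0" using i by auto
      have "n * (2 * M * \<bar>t\<bar>) \<le> L * \<bar>t\<bar>" by (simp add: L_def algebra_simps)
      also have "\<dots> \<le> n * \<bar>x $ i\<bar>" using 3 i by linarith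
      finally have "2 * M * \<bar>t\<bar> \<le> \<bar>x $ i\<bar>" using n by simp
      hence k: "norm (kernel \<Phi> C (x, t)) \<le> 6 / \<bar>x $ i\<bar> * V"
        using norm_kernel_le_space[OF \<Phi> C(1,2) \<rho> C(3), of "axis i 1" x M t] M xi0 unfolding V_def xi by simp
      have "\<bar>t\<bar> \<le> L * \<bar>t\<bar>" using L mult_right_mono[of 1 L "\<bar>t\<bar>"] by simp
      hence "norm z \<le> 2 * n * \<bar>x $ i\<bar>" using N 3 i by linarith
      moreover have "sqrt (norm z) \<le> norm z" using 3 mult_left_mono[of 1 "norm z" "norm z"] by (intro real_le_lsqrt) (auto simp: power2_eq_square)
      ultimately have "norm (kernel \<Phi> C z) * sqrt (norm z) \<le> (6 / \<bar>x $ i\<bar> * V) * (2 * n * \<bar>x $ i\<bar>)"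
        using V k unfolding z by (intro mult_mono) auto
      also have "\<dots> = 12 * n * V" using xi0 by simp
      finally show ?thesis using K(3) by simp
    qed
  qed
  thus ?thesis by blast
qed

lemma set_integrable_cis_phase:
  assumes "compact C" "continuous_on C \<Phi>"
  shows "set_integrable lborel C (\<lambda>\<xi>. cis (- (z \<bullet> (\<xi>, \<Phi> \<xi>))))"
  unfolding set_integrable_def using assms
  by (intro borel_integrable_compact continuous_on_cis continuous_on_phase)

text \<open>A shell is not convex, but its intersection with a ball is the difference of two compact
  convex sets, so its kernel is a difference of two decaying kernels. Removing the closed ball of
  radius 1/2 loses the inner sphere, a null set that the cover carries along separately.\<close>

lemma exists_decaying_piece:
  fixes \<Phi> :: "real^'n::finite \<Rightarrow> real"
  assumes \<Phi>: "Ck_on 2 \<Phi> (- {0})" and "\<xi>0 \<noteq> 0" "rank (hessian \<Phi> \<xi>0) \<ge> 1"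
  shows "\<exists>\<rho>>0. decaying_piece \<Phi> ((cball 0 2 - cball 0 (1/2)) \<inter> cball \<xi>0 \<rho>)"
proof -
  have op: "open (- {0 :: real^'n})" and mem: "\<xi>0 \<in> - {0}" using assms(2) by auto
  obtain v where v: "norm v \<le> 1" "dir_deriv v (dir_deriv v \<Phi>) \<xi>0 \<noteq> 0"
    using exists_dir_deriv2_nonzero[OF op mem \<Phi> assms(3)] by blast
  define g where "g = dir_deriv v (dir_deriv v \<Phi>)"
  define \<kappa> where "\<kappa> = \<bar>g \<xi>0\<bar> / 2"
  have \<kappa>: "0 < \<kappa>" using v(2) by (simp add: \<kappa>_def g_def)
  have "isCont g \<xi>0"
    unfolding g_def using continuous_on_Ck_on_2(3)[OF \<Phi>] op mem by (simp add: continuous_on_eq_continuous_at)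
  then obtain d where d: "d > 0" "\<And>\<xi>. dist \<xi> \<xi>0 < d \<Longrightarrow> dist (g \<xi>) (g \<xi>0) < \<kappa>"
    using \<kappa> by (metis continuous_at_eps_delta)
  \<comment> \<open>Half of \<open>d\<close> keeps the second derivative within
    \<open>\<kappa>\<close> of its value at the centre, hence of one sign; half of
    \<open>norm \<xi>0\<close> keeps the ball away from the origin.\<close>
  define \<rho> where "\<rho> = min (d / 2) (norm \<xi>0 / 2)"
  have \<rho>: "\<rho> > 0" "\<rho> < d" "\<rho> < norm \<xi>0" using d(1) assms(2) by (auto simp: \<rho>_def min_def)
  define B where "B = cball \<xi>0 \<rho>"
  have B0: "B \<subseteq> - {0}" using \<rho>(3) by (auto simp: B_def)
  have sign: "(\<forall>\<xi>\<in>B. \<kappa> \<le> g \<xi>) \<or> (\<forall>\<xi>\<in>B. g \<xi> \<le> - \<kappa>)"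
  proof -
    have *: "\<bar>g \<xi> - g \<xi>0\<bar> < \<kappa>" if "\<xi> \<in> B" for \<xi>
      using d(2)[of \<xi>] that \<rho>(2) by (simp add: B_def dist_commute dist_real_def)
    show ?thesis
    proof (cases "g \<xi>0 > 0")
      case True
      have "\<kappa> \<le> g \<xi>" if "\<xi> \<in> B" for \<xi>
        using *[OF that] True unfolding \<kappa>_def by linarith
      thus ?thesis by blast
    next
      case False
      have "g \<xi> \<le> - \<kappa>" if "\<xi> \<in> B" for \<xi>
        using *[OF that] False unfolding \<kappa>_def by linarith
      thus ?thesis by blast
    qed
  qed
  have piece: "\<exists>K. \<forall>z. norm (kernel \<Phi> (cball 0 r \<inter> B) z) * sqrt (norm z) \<le> K" for r
    using sign B0 unfolding g_def
    by (intro kernel_decay_compact_convex[OF \<Phi> _ _ _ v(1) \<kappa>]) (auto simp: B_def intro!: convex_Int compact_Int)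
  obtain K1 where K1: "\<And>z. norm (kernel \<Phi> (cball 0 2 \<inter> B) z) * sqrt (norm z) \<le> K1" using piece by blast
  obtain K2 where K2: "\<And>z. norm (kernel \<Phi> (cball 0 (1/2) \<inter> B) z) * sqrt (norm z) \<le> K2" using piece by blast
  define D where "D = (cball 0 2 - cball 0 (1/2)) \<inter> B"
  have int: "set_integrable lborel (cball 0 r \<inter> B) (\<lambda>\<xi>. cis (- (z \<bullet> (\<xi>, \<Phi> \<xi>))))" for r z
    using B0 by (intro set_integrable_cis_phase continuous_on_subset[OF continuous_on_Ck_on_2(1)[OF \<Phi>]])
      (auto simp: B_def compact_Int)
  have "kernel \<Phi> D z = kernel \<Phi> (cball 0 2 \<inter> B) z - kernel \<Phi> (cball 0 (1/2) \<inter> B) z" for z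
  proof -
    have ind: "indicat_real D \<xi> = indicator (cball 0 2 \<inter> B) \<xi> - indicator (cball 0 (1/2) \<inter> B) \<xi>" for \<xi>
      by (auto simp: D_def indicator_def)
    show ?thesis
      unfolding kernel_def set_lebesgue_integral_def ind scaleR_left_diff_distrib
      by (intro Bochner_Integration.integral_diff int[unfolded set_integrable_def])
  qed
  hence "norm (kernel \<Phi> D z) * sqrt (norm z) \<le> K1 + K2" for z
  proof -
    have "norm (kernel \<Phi> D z) \<le> norm (kernel \<Phi> (cball 0 2 \<inter> B) z) + norm (kernel \<Phi> (cball 0 (1/2) \<inter> B) z)"
      unfolding \<open>kernel \<Phi> D z = _\<close> by (rule norm_triangle_ineq4)
    from mult_right_mono[OF this, of "sqrt (norm z)"] show ?thesis
      using K1[of z] K2[of z] by (simp add: distrib_right)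
  qed
  moreover have "D \<subseteq> annulus" by (auto simp: D_def annulus_def)
  moreover have "D \<in> sets borel" by (simp add: D_def B_def)
  ultimately have "decaying_piece \<Phi> D" unfolding decaying_piece_def by blast
  thus ?thesis using \<rho>(1) unfolding D_def B_def by blast
qed

lemma compact_annulus: "compact (annulus :: (real^'n::finite) set)"
proof -
  have "annulus = cball 0 2 - ball (0 :: real^'n) (1/2)" by (auto simp: annulus_def)
  thus ?thesis by (metis compact_cball compact_diff open_ball)
qed

text \<open>Compactness of the annulus selects finitely many balls. The pieces may overlap, which
  does no harm to upper bounds for integrals of nonnegative functions.\<close>

lemma annulus_covered_by_decaying_pieces:
  fixes \<Phi> :: "real^'n::finite \<Rightarrow> real"
  assumes \<Phi>: "Ck_on 2 \<Phi> (- {0})" and rank: "\<And>\<xi>. \<xi> \<noteq> 0 \<Longrightarrow> rank (hessian \<Phi> \<xi>) \<ge> 1"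
  shows "\<exists>\<D>. finite \<D> \<and> (\<forall>D\<in>\<D>. decaying_piece \<Phi> D) \<and> annulus \<subseteq> \<Union>\<D> \<union> sphere 0 (1/2)"
proof -
  define P where "P \<xi> \<rho> = ((cball 0 2 - cball 0 (1/2)) \<inter> cball \<xi> \<rho>)" for \<xi> :: "real^'n" and \<rho> :: real
  have "\<forall>\<xi>\<in>annulus. \<exists>\<rho>>0. decaying_piece \<Phi> (P \<xi> \<rho>)"
  proof
    fix \<xi> :: "real^'n" assume "\<xi> \<in> annulus"
    hence "\<xi> \<noteq> 0" by (auto simp: annulus_def)
    thus "\<exists>\<rho>>0. decaying_piece \<Phi> (P \<xi> \<rho>)" unfolding P_def by (intro exists_decaying_piece[OF \<Phi>] rank)
  qed
  then obtain \<rho> where \<rho>: "\<And>\<xi>. \<xi> \<in> annulus \<Longrightarrow> 0 < \<rho> \<xi>" "\<And>\<xi>. \<xi> \<in> annulus \<Longrightarrow> decaying_piece \<Phi> (P \<xi> (\<rho> \<xi>))"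
    by metis
  obtain I where I: "I \<subseteq> annulus" "finite I" "annulus \<subseteq> (\<Union>\<xi>\<in>I. ball \<xi> (\<rho> \<xi>))"
    using compactE_image[OF compact_annulus, of annulus "\<lambda>\<xi>. ball \<xi> (\<rho> \<xi>)"] \<rho>(1)
    by (metis (no_types, lifting) UN_iff centre_in_ball open_ball subsetI)
  have "annulus \<subseteq> \<Union>((\<lambda>\<xi>. P \<xi> (\<rho> \<xi>)) ` I) \<union> sphere 0 (1/2)"
  proof
    fix \<eta> :: "real^'n" assume \<eta>: "\<eta> \<in> annulus"
    then obtain \<xi> where \<xi>: "\<xi> \<in> I" "\<eta> \<in> ball \<xi> (\<rho> \<xi>)" using I(3) by blast
    show "\<eta> \<in> \<Union>((\<lambda>\<xi>. P \<xi> (\<rho> \<xi>)) ` I) \<union> sphere 0 (1/2)"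
    proof (cases "norm \<eta> = 1/2")
      case False
      hence "\<eta> \<in> P \<xi> (\<rho> \<xi>)" using \<eta> \<xi> by (auto simp: P_def annulus_def)
      thus ?thesis using \<xi>(1) by blast
    qed auto
  qed
  thus ?thesis using I \<rho>(2) by (intro exI[of _ "(\<lambda>\<xi>. P \<xi> (\<rho> \<xi>)) ` I"]) auto
qed

section \<open>Mixed norms\<close>

lemma ennpowr_ennreal: "0 \<le> a \<Longrightarrow> ennpowr (ennreal a) p = ennreal (a powr p)"
  by (simp add: ennpowr_def)

lemma ennpowr_top [simp]: "ennpowr top p = top"
  by (simp add: ennpowr_def)

lemma ennpowr_0 [simp]: "ennpowr 0 p = 0"
  by (simp add: ennpowr_def)

lemma ennpowr_eq_top_iff [simp]: "ennpowr a p = top \<longleftrightarrow> a = top"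
  by (simp add: ennpowr_def)

lemma ennpowr_less_top_iff [simp]: "ennpowr a p < top \<longleftrightarrow> a < top"
  by (simp add: less_top[symmetric])

lemma ennpowr_eq_0_iff [simp]: "ennpowr a p = 0 \<longleftrightarrow> a = 0"
  by (cases a) (auto simp: ennpowr_ennreal)

lemma ennpowr_1 [simp]: "ennpowr a 1 = a"
  by (cases a) (auto simp: ennpowr_ennreal)

lemma ennpowr_ennpowr: "ennpowr (ennpowr a p) p' = ennpowr a (p * p')"
  by (cases a) (auto simp: ennpowr_ennreal powr_powr)

lemma ennpowr_mono:
  assumes "a \<le> b" "0 \<le> p"
  shows "ennpowr a p \<le> ennpowr b p"
proof (cases b)
  case (real y)
  then obtain x where "a = ennreal x" "0 \<le> x"
    using assms(1) by (cases a) (auto simp: top_unique)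
  thus ?thesis using real assms by (auto simp: ennpowr_ennreal intro!: ennreal_leI powr_mono2)
qed simp

lemma ennpowr_mult: "ennpowr (a * b) p = ennpowr a p * ennpowr b p"
proof (cases "a = 0 \<or> b = 0")
  case False
  show ?thesis
  proof (cases "a = top \<or> b = top")
    case True
    thus ?thesis using False by (auto simp: ennreal_mult_top ennreal_top_mult)
  next
    case False
    then obtain x y where "a = ennreal x" "0 \<le> x" "b = ennreal y" "0 \<le> y"
      by (cases a; cases b) auto
    thus ?thesis by (simp add: ennpowr_ennreal powr_mult flip: ennreal_mult)
  qed
qed auto

lemma ennpowr_2: "ennpowr a 2 = a\<^sup>2"
  by (cases a) (auto simp: ennpowr_ennreal ennreal_power top_power_ennreal)

lemma borel_measurable_ennpowr [measurable]:
  assumes [measurable]: "f \<in> borel_measurable M"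
  shows "(\<lambda>x. ennpowr (f x) p) \<in> borel_measurable M"
  unfolding ennpowr_def by measurable

definition time_integral :: "real \<Rightarrow> ((real^'n::finite) \<times> real \<Rightarrow> complex) \<Rightarrow> real^'n \<Rightarrow> ennreal" where
  "time_integral r f x = (\<integral>\<^sup>+t. ennreal (norm (f (x, t)) powr r) \<partial>lborel)"

definition mixed_integral :: "real \<Rightarrow> real \<Rightarrow> ((real^'n::finite) \<times> real \<Rightarrow> complex) \<Rightarrow> ennreal" where
  "mixed_integral q r f = (\<integral>\<^sup>+x. ennpowr (time_integral r f x) (q / r) \<partial>lborel)"

lemma mixed_norm_eq: "mixed_norm q r f = ennpowr (mixed_integral q r f) (1 / q)"
  by (simp add: mixed_norm_def mixed_integral_def time_integral_def)

lemma mixed_norm_le_iff: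
  assumes "0 < q" "0 \<le> A"
  shows "mixed_norm q r f \<le> ennreal A \<longleftrightarrow> mixed_integral q r f \<le> ennreal (A powr q)"
proof
  assume "mixed_norm q r f \<le> ennreal A"
  from ennpowr_mono[OF this, of q] show "mixed_integral q r f \<le> ennreal (A powr q)"
    using assms by (simp add: mixed_norm_eq ennpowr_ennpowr ennpowr_ennreal)
next
  assume "mixed_integral q r f \<le> ennreal (A powr q)"
  from ennpowr_mono[OF this, of "1/q"] show "mixed_norm q r f \<le> ennreal A"
    using assms by (simp add: mixed_norm_eq ennpowr_ennreal powr_powr)
qed

lemma borel_measurable_time_integral [measurable]:
  assumes [measurable]: "f \<in> borel_measurable borel"
  shows "time_integral r f \<in> borel_measurable borel"
  unfolding time_integral_def by measurable

lemma time_integral_mono: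
  assumes "\<And>t. norm (f (x, t)) \<le> norm (g (x, t))" "0 \<le> r"
  shows "time_integral r f x \<le> time_integral r g x"
  unfolding time_integral_def using assms by (intro nn_integral_mono ennreal_leI powr_mono2) auto

lemma mixed_integral_mono:
  assumes "\<And>z. norm (f z) \<le> norm (g z)" "0 < r" "0 < q"
  shows "mixed_integral q r f \<le> mixed_integral q r g"
  unfolding mixed_integral_def using assms
  by (intro nn_integral_mono ennpowr_mono time_integral_mono) auto

lemma mixed_norm_mono:
  assumes "\<And>z. norm (f z) \<le> norm (g z)" "0 < r" "0 < q"
  shows "mixed_norm q r f \<le> mixed_norm q r g"
  unfolding mixed_norm_eq using assms by (intro ennpowr_mono mixed_integral_mono) auto

lemma mixed_norm_cong: "(\<And>z. norm (f z) = norm (g z)) \<Longrightarrow> mixed_norm q r f = mixed_norm q r g"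
  by (simp add: mixed_norm_def)

lemma mixed_norm_translate:
  fixes f :: "(real^'n::finite) \<times> real \<Rightarrow> complex"
  assumes [measurable]: "f \<in> borel_measurable borel"
  shows "mixed_norm q r (\<lambda>z. f (z + y)) = mixed_norm q r f"
proof -
  obtain a b where y: "y = (a, b)" by (cases y)
  have "time_integral r (\<lambda>z. f (z + y)) x = time_integral r f (x + a)" for x
    unfolding time_integral_def y
    using nn_integral_lborel_translate[of "\<lambda>t. ennreal (norm (f (x + a, t)) powr r)" b] by simp
  thus ?thesis
    unfolding mixed_norm_eq mixed_integral_def
    using nn_integral_lborel_translate[of "\<lambda>x. ennpowr (time_integral r f x) (q / r)" a] by simp
qed

lemma mixed_integral_cmult:
  assumes [measurable]: "f \<in> borel_measurable borel" and "0 < r" "0 < q"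
  shows "mixed_integral q r (\<lambda>z. c * f z) = ennreal (norm c powr q) * mixed_integral q r f"
proof -
  have "time_integral r (\<lambda>z. c * f z) x = ennreal (norm c powr r) * time_integral r f x" for x
    unfolding time_integral_def
    by (subst nn_integral_cmult[symmetric]) (auto simp: norm_mult powr_mult ennreal_mult)
  thus ?thesis
    unfolding mixed_integral_def using assms
    by (subst nn_integral_cmult[symmetric]) (auto simp: ennpowr_mult ennpowr_ennreal powr_powr)
qed

lemma mixed_norm_cmult:
  assumes "f \<in> borel_measurable borel" "0 < r" "0 < q"
  shows "mixed_norm q r (\<lambda>z. c * f z) = ennreal (norm c) * mixed_norm q r f"
  using assms by (simp add: mixed_norm_eq mixed_integral_cmult ennpowr_mult ennpowr_ennreal powr_powr)

lemma powr_add_le: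
  fixes a b p :: real
  assumes "0 \<le> a" "0 \<le> b" "0 \<le> p"
  shows "(a + b) powr p \<le> 2 powr p * (a powr p + b powr p)"
proof -
  have "(a + b) powr p \<le> (2 * max a b) powr p" using assms by (intro powr_mono2) auto
  also have "\<dots> = 2 powr p * max a b powr p" using assms by (simp add: powr_mult)
  also have "\<dots> \<le> 2 powr p * (a powr p + b powr p)"
    by (intro mult_left_mono) (auto simp: max_def)
  finally show ?thesis .
qed

lemma ennpowr_add_le:
  assumes "0 \<le> p"
  shows "ennpowr (a + b) p \<le> ennreal (2 powr p) * (ennpowr a p + ennpowr b p)"
proof (cases "a = top \<or> b = top")
  case True
  thus ?thesis by (auto simp: ennreal_mult_top)
next
  case False
  then obtain x y where "a = ennreal x" "0 \<le> x" "b = ennreal y" "0 \<le> y"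
    by (cases a; cases b) auto
  thus ?thesis using powr_add_le[OF _ _ assms, of x y]
    by (simp add: ennpowr_ennreal flip: ennreal_plus ennreal_mult)
qed

text \<open>Minkowski's inequality would give the constant 1, but any constant will do.\<close>

lemma mixed_norm_add_le:
  assumes [measurable]: "f \<in> borel_measurable borel" "g \<in> borel_measurable borel" and "1 \<le> r" "1 \<le> q"
  shows "mixed_norm q r (\<lambda>z. f z + g z) \<le> 8 * (mixed_norm q r f + mixed_norm q r g)"
proof -
  have time: "time_integral r (\<lambda>z. f z + g z) x \<le> ennreal (2 powr r) * (time_integral r f x + time_integral r g x)" for x
  proof -
    have "time_integral r (\<lambda>z. f z + g z) x \<le> (\<integral>\<^sup>+t. ennreal (2 powr r) * (ennreal (norm (f (x, t)) powr r) + ennreal (norm (g (x, t)) powr r)) \<partial>lborel)"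
      unfolding time_integral_def
    proof (rule nn_integral_mono)
      fix t
      have "norm (f (x, t) + g (x, t)) powr r \<le> (norm (f (x, t)) + norm (g (x, t))) powr r"
        using assms by (intro powr_mono2 norm_triangle_ineq) auto
      also have "\<dots> \<le> 2 powr r * (norm (f (x, t)) powr r + norm (g (x, t)) powr r)"
        using assms by (intro powr_add_le) auto
      finally show "ennreal (norm (f (x, t) + g (x, t)) powr r) \<le> ennreal (2 powr r) * (ennreal (norm (f (x, t)) powr r) + ennreal (norm (g (x, t)) powr r))"
        by (simp flip: ennreal_plus ennreal_mult)
    qed
    also have "\<dots> = ennreal (2 powr r) * (time_integral r f x + time_integral r g x)"
      unfolding time_integral_def by (simp add: nn_integral_cmult nn_integral_add)
    finally show ?thesis .
  qed
  have "mixed_integral q r (\<lambda>z. f z + g z) \<le> (\<integral>\<^sup>+x. ennreal (4 powr q) * (ennpowr (time_integral r f x) (q / r) + ennpowr (time_integral r g x) (q / r)) \<partial>lborel)"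
    unfolding mixed_integral_def
  proof (rule nn_integral_mono)
    fix x
    have "ennpowr (time_integral r (\<lambda>z. f z + g z) x) (q / r) \<le> ennpowr (ennreal (2 powr r) * (time_integral r f x + time_integral r g x)) (q / r)"
      using assms by (intro ennpowr_mono time) auto
    also have "\<dots> = ennreal (2 powr q) * ennpowr (time_integral r f x + time_integral r g x) (q / r)"
      using assms by (simp add: ennpowr_mult ennpowr_ennreal powr_powr)
    also have "\<dots> \<le> ennreal (2 powr q) * (ennreal (2 powr (q / r)) * (ennpowr (time_integral r f x) (q / r) + ennpowr (time_integral r g x) (q / r)))"
      using assms by (intro mult_left_mono ennpowr_add_le) auto
    also have "\<dots> \<le> ennreal (2 powr q) * (ennreal (2 powr q) * (ennpowr (time_integral r f x) (q / r) + ennpowr (time_integral r g x) (q / r)))"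
      using assms by (intro mult_left_mono mult_right_mono ennreal_leI powr_mono) (auto simp: field_simps)
    also have "\<dots> = ennreal (4 powr q) * (ennpowr (time_integral r f x) (q / r) + ennpowr (time_integral r g x) (q / r))"
      by (simp add: mult.assoc[symmetric] flip: ennreal_mult powr_mult)
    finally show "ennpowr (time_integral r (\<lambda>z. f z + g z) x) (q / r) \<le> \<dots>" .
  qed
  also have "\<dots> = ennreal (4 powr q) * (mixed_integral q r f + mixed_integral q r g)"
    unfolding mixed_integral_def by (simp add: nn_integral_cmult nn_integral_add)
  finally have "mixed_norm q r (\<lambda>z. f z + g z) \<le> ennpowr (ennreal (4 powr q) * (mixed_integral q r f + mixed_integral q r g)) (1 / q)"
    unfolding mixed_norm_eq using assms by (intro ennpowr_mono) auto
  also have "\<dots> = 4 * ennpowr (mixed_integral q r f + mixed_integral q r g) (1 / q)"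
    using assms by (simp add: ennpowr_mult ennpowr_ennreal powr_powr)
  also have "\<dots> \<le> 4 * (ennreal (2 powr (1 / q)) * (mixed_norm q r f + mixed_norm q r g))"
    unfolding mixed_norm_eq using assms by (intro mult_left_mono ennpowr_add_le) auto
  also have "\<dots> \<le> 4 * (ennreal (2 powr 1) * (mixed_norm q r f + mixed_norm q r g))"
    using assms by (intro mult_left_mono mult_right_mono ennreal_leI powr_mono) auto
  also have "\<dots> = 8 * (mixed_norm q r f + mixed_norm q r g)"
    by (simp add: mult.assoc[symmetric])
  finally show ?thesis .
qed

subsection \<open>Square-summability over translates\<close>

text \<open>A substitute for Hoelder's inequality with a free parameter: either \<open>a\<close> is
  below the threshold \<open>b * \<sigma>\<close>, or, the exponent \<open>p - 1\<close> being
  nonpositive, \<open>a powr (p - 1)\<close> is at most its value at the threshold. Choosing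
  \<open>\<sigma>\<close> after integration recovers the right power.\<close>

lemma powr_split_le:
  fixes a b p \<sigma> :: real
  assumes "0 \<le> a" "a \<le> b" "0 < p" "p \<le> 1" "0 < \<sigma>"
  shows "a powr p \<le> b powr (p - 1) * a * \<sigma> powr (p - 1) + b powr p * \<sigma> powr p"
proof (cases "a \<le> b * \<sigma>")
  case True
  hence "a powr p \<le> (b * \<sigma>) powr p" using assms by (intro powr_mono2) auto
  thus ?thesis using assms by (simp add: powr_mult add_increasing)
next
  case False
  have "0 \<le> b * \<sigma>" using assms by simp
  hence a: "0 < a" "0 < b" using False assms by linarith+
  have "a powr p = a * a powr (p - 1)" using a by (simp add: powr_diff)
  also have "\<dots> \<le> a * (b * \<sigma>) powr (p - 1)"
    using a assms False by (intro mult_left_mono powr_mono2') auto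
  finally show ?thesis using assms a by (simp add: powr_mult mult_ac add_increasing2)
qed

lemma powr_ge_1_split_le:
  fixes a b p :: real
  assumes "0 \<le> a" "a \<le> b" "1 \<le> p"
  shows "a powr p \<le> b powr (p - 1) * a"
proof (cases "a = 0")
  case False
  hence a: "0 < a" using assms by simp
  have "a powr p = a powr (p - 1) * a" using a by (simp add: powr_diff)
  also have "\<dots> \<le> b powr (p - 1) * a" using assms by (intro mult_right_mono powr_mono2) auto
  finally show ?thesis .
qed simp

lemma ennpowr_minus_1_mult:
  assumes "p \<noteq> 0"
  shows "ennpowr a (p - 1) * a = ennpowr a p"
proof (cases a)
  case (real x)
  thus ?thesis by (cases "x = 0") (auto simp: ennpowr_ennreal powr_diff simp flip: ennreal_mult)
qed (simp add: ennreal_mult_top)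

text \<open>The weight \<open>J\<^bsup>q/r-1\<^esup>\<close>, with \<open>J\<close> the time integral of \<open>f\<close>, linearises the mixed norm of
  the truncations of \<open>f\<close>; this replaces Minkowski's inequality.  Both \<open>q \<le> 2\<close> and \<open>r \<le> 2\<close>
  are needed.\<close>

lemma mixed_norm_sq_le_weighted:
  fixes f g :: "(real^'n::finite) \<times> real \<Rightarrow> complex"
  assumes [measurable]: "f \<in> borel_measurable borel" "g \<in> borel_measurable borel"
    and q: "1 \<le> q" "q \<le> 2" and r: "1 \<le> r" "r \<le> 2"
    and le: "\<And>z. norm (g z) \<le> norm (f z)"
    and S: "mixed_integral q r f = ennreal s" "0 < s"
  shows "(mixed_norm q r g)\<^sup>2 \<le> ennreal (4 * s powr (2 / q - 1)) *
    (\<integral>\<^sup>+x. ennpowr (time_integral r f x) (q / r - 1) * time_integral r g x \<partial>lborel)"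
proof -
  define p where "p = q / r"
  have p: "0 < p" using q r by (simp add: p_def)
  define J where "J = time_integral r f"
  define I where "I = time_integral r g"
  have [measurable]: "J \<in> borel_measurable borel" "I \<in> borel_measurable borel" by (auto simp: J_def I_def)
  have IJ: "I x \<le> J x" for x unfolding I_def J_def using le r by (intro time_integral_mono) auto
  define w where "w x = ennpowr (J x) (p - 1)" for x
  have [measurable]: "w \<in> borel_measurable borel" by (simp add: w_def[abs_def])
  have wJ: "w x * J x = ennpowr (J x) p" for x
    using p by (simp add: w_def ennpowr_minus_1_mult)
  have SJ: "(\<integral>\<^sup>+x. ennpowr (J x) p \<partial>lborel) = ennreal s" using S by (simp add: mixed_integral_def J_def p_def)
  have "(\<integral>\<^sup>+x. w x * I x \<partial>lborel) \<le> ennreal s"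
    unfolding SJ[symmetric] wJ[symmetric] by (intro nn_integral_mono mult_left_mono IJ) auto
  then obtain G where G: "(\<integral>\<^sup>+x. w x * I x \<partial>lborel) = ennreal G" "0 \<le> G" "G \<le> s"
    using S(2) by (cases "\<integral>\<^sup>+x. w x * I x \<partial>lborel") (auto simp: top_unique)
  have "(\<integral>\<^sup>+x. ennpowr (I x) p \<partial>lborel) \<le> ennreal s"
    unfolding SJ[symmetric] using p by (intro nn_integral_mono ennpowr_mono IJ) auto
  then obtain k where k: "(\<integral>\<^sup>+x. ennpowr (I x) p \<partial>lborel) = ennreal k" "0 \<le> k"
    by (cases "\<integral>\<^sup>+x. ennpowr (I x) p \<partial>lborel") (auto simp: top_unique)
  have kG: "k \<le> 2 * s * (G / s) powr min 1 p"
  proof (cases "G = 0")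
    case True
    \<comment> \<open>The balancing parameter would be 0 here. The weight is zero only where
      \<open>J\<close> is, and there \<open>I\<close> vanishes too because it is at most
      \<open>J\<close>.\<close>
    have "AE x in lborel. w x * I x = 0"
      using G True by (subst nn_integral_0_iff_AE[symmetric]) auto
    hence "AE x in lborel. ennpowr (I x) p = 0"
    proof eventually_elim
      case (elim x)
      thus ?case using IJ[of x] by (auto simp: w_def)
    qed
    hence "(\<integral>\<^sup>+x. ennpowr (I x) p \<partial>lborel) = 0" by (subst nn_integral_0_iff_AE) auto
    thus ?thesis using k True by simp
  next
    case False
    \<comment> \<open>This value makes both terms of \<open>powr_split_le\<close> integrate to the
      same quantity \<open>\<sigma> powr p * s\<close>, whence the factor 2.\<close>
    define \<sigma> where "\<sigma> = G / s"
    have \<sigma>: "0 < \<sigma>" using False G S(2) by (simp add: \<sigma>_def)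
    show ?thesis
    proof (cases "p \<le> 1")
      case True
      have "ennpowr (I x) p \<le> ennreal (\<sigma> powr (p - 1)) * (w x * I x) + ennreal (\<sigma> powr p) * ennpowr (J x) p" for x
      proof (cases "J x")
        case (real b)
        then obtain a where a: "I x = ennreal a" "0 \<le> a" "a \<le> b"
          using IJ[of x] by (cases "I x") (auto simp: top_unique)
        show ?thesis using real powr_split_le[OF a(2,3) p True \<sigma>]
          by (simp add: w_def a ennpowr_ennreal mult_ac flip: ennreal_mult ennreal_plus)
      next
        case top
        thus ?thesis using \<sigma> by (simp add: ennreal_mult_top)
      qed
      hence "ennreal k \<le> (\<integral>\<^sup>+x. ennreal (\<sigma> powr (p - 1)) * (w x * I x) + ennreal (\<sigma> powr p) * ennpowr (J x) p \<partial>lborel)"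
        unfolding k(1)[symmetric] by (intro nn_integral_mono)
      also have "\<dots> = ennreal (\<sigma> powr (p - 1) * G + \<sigma> powr p * s)"
        using G S(2) by (simp add: nn_integral_add nn_integral_cmult G(1) SJ flip: ennreal_mult ennreal_plus)
      finally have "k \<le> \<sigma> powr (p - 1) * G + \<sigma> powr p * s"
        using G S(2) by (subst (asm) ennreal_le_iff) auto
      also have "\<sigma> powr (p - 1) * G = \<sigma> powr p * s"
        using \<sigma> S(2) by (simp add: powr_diff) (simp add: \<sigma>_def)
      finally show ?thesis using True by (simp add: \<sigma>_def)
    next
      case False
      have "ennpowr (I x) p \<le> w x * I x" for x
      proof (cases "J x")
        case (real b)
        then obtain a where a: "I x = ennreal a" "0 \<le> a" "a \<le> b"
          using IJ[of x] by (cases "I x") (auto simp: top_unique)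
        show ?thesis using real powr_ge_1_split_le[OF a(2,3), of p] False
          by (simp add: w_def a ennpowr_ennreal flip: ennreal_mult)
      next
        case top
        thus ?thesis by (cases "I x = 0") (auto simp: w_def ennreal_top_mult)
      qed
      hence "ennreal k \<le> ennreal G"
        unfolding k(1)[symmetric] G(1)[symmetric] by (intro nn_integral_mono)
      thus ?thesis using False S(2) G by simp
    qed
  qed
  have "k powr (2 / q) \<le> (2 * s * (G / s) powr min 1 p) powr (2 / q)"
    using kG k q by (intro powr_mono2) auto
  also have "\<dots> = 2 powr (2 / q) * s powr (2 / q) * (G / s) powr (min 1 p * (2 / q))"
    using S(2) by (simp add: powr_mult powr_powr)
  \<comment> \<open>The exponent of \<open>G / s\<close> is the smaller of \<open>2 / q\<close> and
    \<open>2 / r\<close>, hence at least 1. As \<open>G \<le> s\<close>, lowering it to 1 only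
    increases the value and makes the bound linear in \<open>G\<close>.\<close>
  also have "\<dots> \<le> 2 powr 2 * s powr (2 / q) * (G / s) powr 1"
  proof -
    have "2 / q \<ge> 1" "2 / r \<ge> 1" using q r by (auto simp: field_simps)
    moreover have "p * (2 / q) = 2 / r" using q by (simp add: p_def)
    ultimately have "1 \<le> min 1 p * (2 / q)" by (auto simp: min_def)
    hence 1: "(G / s) powr (min 1 p * (2 / q)) \<le> (G / s) powr 1"
      using G S(2) by (intro powr_mono') auto
    have "2 / q \<le> 2" using q by (simp add: divide_le_eq)
    hence "(2 :: real) powr (2 / q) \<le> 2 powr 2" by (intro powr_mono) auto
    with 1 show ?thesis by (intro mult_mono) auto
  qed
  also have "\<dots> = 4 * s powr (2 / q - 1) * G"
    using S(2) G by (simp add: powr_diff)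
  finally have "ennreal (k powr (2 / q)) \<le> ennreal (4 * s powr (2 / q - 1)) * ennreal G"
    using G by (simp flip: ennreal_mult)
  moreover have "(mixed_norm q r g)\<^sup>2 = ennreal (k powr (2 / q))"
    unfolding mixed_norm_eq mixed_integral_def I_def[symmetric] p_def[symmetric] k(1)
    using k by (simp add: ennpowr_ennreal powr_powr flip: ennpowr_2)
  ultimately show ?thesis unfolding G(1)[symmetric] w_def p_def J_def I_def by simp
qed

text \<open>The bound for the squared norm is linear in the time integral of the truncation, so
  Tonelli applies: each point is retained for a set of \<open>y\<close> with the measure of
  \<open>U\<close>, and the weight recombines with the full time integral to the integrand of
  \<open>mixed_integral\<close>. The factor \<open>emeasure lborel U\<close> is divided out later,
  which removes all dependence on the size of the cylinder.\<close>

lemma nn_integral_mixed_norm_translates_le: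
  fixes f :: "(real^'n::finite) \<times> real \<Rightarrow> complex"
  assumes f[measurable]: "f \<in> borel_measurable borel" and U[measurable]: "U \<in> sets borel"
    and q: "1 \<le> q" "q \<le> 2" and r: "1 \<le> r" "r \<le> 2"
    and A: "0 \<le> A" "mixed_norm q r f \<le> ennreal A"
  shows "(\<integral>\<^sup>+y. (mixed_norm q r (\<lambda>z. indicator U (z - y) * f z))\<^sup>2 \<partial>lborel) \<le> 4 * emeasure lborel U * ennreal (A\<^sup>2)"
proof -
  define F where "F y z = indicator U (z - y) * f z" for y z
  have F_meas[measurable]: "F y \<in> borel_measurable borel" for y
    unfolding F_def[abs_def] by measurable
  have F_le: "norm (F y z) \<le> norm (f z)" for y z
    by (auto simp: F_def indicator_def)
  have "mixed_integral q r f \<le> ennreal (A powr q)"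
    using A q by (subst mixed_norm_le_iff[symmetric]) auto
  then obtain s where s: "mixed_integral q r f = ennreal s" "0 \<le> s" "s \<le> A powr q"
    by (cases "mixed_integral q r f") (auto simp: top_unique)
  show ?thesis
  proof (cases "s = 0")
    case True
    have "mixed_norm q r (F y) \<le> mixed_norm q r f" for y
      using q r F_le by (intro mixed_norm_mono) auto
    moreover have "mixed_norm q r f = 0" using s True by (simp add: mixed_norm_eq)
    ultimately have "mixed_norm q r (F y) = 0" for y by simp
    thus ?thesis unfolding F_def by simp
  next
    case False
    hence s0: "0 < s" using s by simp
    define w where "w x = ennpowr (time_integral r f x) (q / r - 1)" for x
    have [measurable]: "w \<in> borel_measurable borel" by (simp add: w_def[abs_def])
    have mass: "(\<integral>\<^sup>+y. indicator U ((x, t) - y) \<partial>lborel) = emeasure lborel U" for x :: "real^'n" and t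
      using nn_integral_lborel_diff[of "indicator U" "(x, t)"] by simp
    have F_time: "time_integral r (F y) x = (\<integral>\<^sup>+t. indicator U ((x, t) - y) * ennreal (norm (f (x, t)) powr r) \<partial>lborel)" for y x
      unfolding time_integral_def F_def by (intro nn_integral_cong) (auto simp: indicator_def)
    have [measurable]: "(\<lambda>z. time_integral r (F (fst z)) (snd z)) \<in> borel_measurable (borel \<Otimes>\<^sub>M borel)"
      "(\<lambda>z. time_integral r (F (snd z)) (fst z)) \<in> borel_measurable (borel \<Otimes>\<^sub>M borel)"
      unfolding F_time by measurable
    have "(\<integral>\<^sup>+y. (mixed_norm q r (F y))\<^sup>2 \<partial>lborel) \<le>
        (\<integral>\<^sup>+y. ennreal (4 * s powr (2 / q - 1)) * (\<integral>\<^sup>+x. w x * time_integral r (F y) x \<partial>lborel) \<partial>lborel)"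
      unfolding w_def by (intro nn_integral_mono mixed_norm_sq_le_weighted[OF f F_meas q r F_le s(1) s0])
    also have "\<dots> = ennreal (4 * s powr (2 / q - 1)) * (\<integral>\<^sup>+y. \<integral>\<^sup>+x. w x * time_integral r (F y) x \<partial>lborel \<partial>lborel)"
      by (intro nn_integral_cmult) measurable
    also have "(\<integral>\<^sup>+y. \<integral>\<^sup>+x. w x * time_integral r (F y) x \<partial>lborel \<partial>lborel) = (\<integral>\<^sup>+x. \<integral>\<^sup>+y. w x * time_integral r (F y) x \<partial>lborel \<partial>lborel)"
      by (intro lborel_pair.Fubini') measurable
    also have "\<dots> = (\<integral>\<^sup>+x. w x * (emeasure lborel U * time_integral r f x) \<partial>lborel)"
    proof (intro nn_integral_cong)
      fix x
      have "(\<integral>\<^sup>+y. w x * time_integral r (F y) x \<partial>lborel) = w x * (\<integral>\<^sup>+y. time_integral r (F y) x \<partial>lborel)"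
        unfolding F_time by (intro nn_integral_cmult) measurable
      also have "(\<integral>\<^sup>+y. time_integral r (F y) x \<partial>lborel) = (\<integral>\<^sup>+t. \<integral>\<^sup>+y. indicator U ((x, t) - y) * ennreal (norm (f (x, t)) powr r) \<partial>lborel \<partial>lborel)"
        unfolding F_time by (intro lborel_pair.Fubini') measurable
      also have "\<dots> = (\<integral>\<^sup>+t. emeasure lborel U * ennreal (norm (f (x, t)) powr r) \<partial>lborel)"
        by (intro nn_integral_cong) (simp add: nn_integral_multc mass)
      also have "\<dots> = emeasure lborel U * time_integral r f x"
        unfolding time_integral_def by (intro nn_integral_cmult) measurable
      finally show "(\<integral>\<^sup>+y. w x * time_integral r (F y) x \<partial>lborel) = w x * (emeasure lborel U * time_integral r f x)" .
    qed
    also have "\<dots> = (\<integral>\<^sup>+x. emeasure lborel U * ennpowr (time_integral r f x) (q / r) \<partial>lborel)"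
      using q r ennpowr_minus_1_mult[of "q / r"]
      by (intro nn_integral_cong) (simp add: w_def mult.left_commute)
    also have "\<dots> = emeasure lborel U * ennreal s"
      unfolding s(1)[symmetric] mixed_integral_def by (intro nn_integral_cmult) measurable
    also have "ennreal (4 * s powr (2 / q - 1)) * (emeasure lborel U * ennreal s) = 4 * emeasure lborel U * ennreal (s powr (2 / q))"
    proof -
      have "s powr (2 / q) = s powr (2 / q - 1) * s" using s0 by (simp add: powr_diff)
      thus ?thesis using s0 by (simp add: ennreal_mult mult_ac)
    qed
    also have "\<dots> \<le> 4 * emeasure lborel U * ennreal ((A powr q) powr (2 / q))"
      using s s0 q by (intro mult_left_mono ennreal_leI powr_mono2) auto
    also have "(A powr q) powr (2 / q) = A\<^sup>2"
      using A q by (simp add: powr_powr)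
    finally show ?thesis by (simp add: F_def)
  qed
qed

section \<open>Localisation\<close>

lemma fourier_transform_cis: "fourier_transform f \<zeta> = (LINT z|lborel. cis (- (z \<bullet> \<zeta>)) * f z)"
  by (simp add: fourier_transform_def cis_conv_exp)

abbreviation fourier_energy :: "(real^'n::finite \<Rightarrow> real) \<Rightarrow> (real^'n) set \<Rightarrow> ((real^'n) \<times> real \<Rightarrow> complex) \<Rightarrow> real" where
  "fourier_energy \<Phi> D f \<equiv> (LINT \<xi>:D|lborel. (norm (fourier_transform f (\<xi>, \<Phi> \<xi>)))\<^sup>2)"

lemma integrable_cis_mult:
  fixes f :: "'a::euclidean_space \<Rightarrow> complex"
  assumes "integrable lborel f"
  shows "integrable lborel (\<lambda>z. cis (- (z \<bullet> \<zeta>)) * f z)"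
proof (rule Bochner_Integration.integrable_bound[OF assms])
  have [measurable]: "f \<in> borel_measurable lborel" using assms by simp
  have "(\<lambda>z :: 'a. cis (- (z \<bullet> \<zeta>))) \<in> borel_measurable borel"
    by (intro borel_measurable_continuous_onI continuous_on_cis continuous_intros)
  thus "(\<lambda>z. cis (- (z \<bullet> \<zeta>)) * f z) \<in> borel_measurable lborel" by measurable
qed (simp add: norm_mult)

lemma integrable_tensor:
  fixes f g :: "_ \<Rightarrow> 'c::{real_normed_field,banach,second_countable_topology}"
  assumes f: "integrable lborel f" and g: "integrable lborel g"
  shows "integrable (lborel \<Otimes>\<^sub>M lborel) (\<lambda>p. f (fst p) * g (snd p))"
    and "(LINT p|(lborel \<Otimes>\<^sub>M lborel). f (fst p) * g (snd p)) = (LINT x|lborel. f x) * (LINT y|lborel. g y)"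
proof -
  have [measurable]: "f \<in> borel_measurable lborel" "g \<in> borel_measurable lborel" using f g by auto
  show *: "integrable (lborel \<Otimes>\<^sub>M lborel) (\<lambda>p. f (fst p) * g (snd p))"
  proof (rule lborel_pair.Fubini_integrable)
    have "(\<lambda>x. LINT y|lborel. norm (f (fst (x, y)) * g (snd (x, y)))) = (\<lambda>x. norm (f x) * (LINT y|lborel. norm (g y)))"
      by (simp add: norm_mult)
    thus "integrable lborel (\<lambda>x. LINT y|lborel. norm (f (fst (x, y)) * g (snd (x, y))))"
      using f by simp
    show "AE x in lborel. integrable lborel (\<lambda>y. f (fst (x, y)) * g (snd (x, y)))"
      using g by simp
  qed measurable
  show "(LINT p|(lborel \<Otimes>\<^sub>M lborel). f (fst p) * g (snd p)) = (LINT x|lborel. f x) * (LINT y|lborel. g y)"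
    using lborel_pair.integral_fst'[OF *] by simp
qed

lemma borel_measurable_cnj [measurable (raw)]:
  "f \<in> borel_measurable M \<Longrightarrow> (\<lambda>x. cnj (f x)) \<in> borel_measurable M"
  by (rule borel_measurable_continuous_on[OF continuous_on_cnj[OF continuous_on_id]])

lemma borel_measurable_fst_snd [measurable (raw)]:
  fixes h :: "'a \<Rightarrow> 'b::second_countable_topology \<times> 'c::second_countable_topology"
  assumes "h \<in> borel_measurable M"
  shows "(\<lambda>x. fst (h x)) \<in> borel_measurable M" "(\<lambda>x. snd (h x)) \<in> borel_measurable M"
  using assms by (auto intro: borel_measurable_continuous_on[OF continuous_on_fst[OF continuous_on_id]]
      borel_measurable_continuous_on[OF continuous_on_snd[OF continuous_on_id]])

lemma borel_measurable_kernel [measurable]: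
  fixes \<Phi> :: "real^'n::finite \<Rightarrow> real"
  assumes [measurable]: "\<Phi> \<in> borel_measurable borel" "D \<in> sets borel"
  shows "kernel \<Phi> D \<in> borel_measurable borel"
  unfolding kernel_def[abs_def] set_lebesgue_integral_def by measurable

text \<open>The squared modulus is the transform times its conjugate, an integral over pairs of
  points. Unimodular phases, the finite measure of \<open>D\<close> and integrability of
  \<open>g\<close> allow integrating in \<open>\<xi>\<close> first, which leaves the kernel at the
  difference of the two points.\<close>

lemma
  fixes g :: "(real^'n::finite) \<times> real \<Rightarrow> complex"
  assumes g: "integrable lborel g" and D[measurable]: "D \<in> sets borel" "emeasure lborel D < \<infinity>"
    and \<Phi>[measurable]: "\<Phi> \<in> borel_measurable borel"
  shows set_integrable_fourier_sq: "set_integrable lborel D (\<lambda>\<xi>. (norm (fourier_transform g (\<xi>, \<Phi> \<xi>)))\<^sup>2)"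
    and fourier_sq_integral_eq: "complex_of_real (fourier_energy \<Phi> D g)
      = (LINT p|lborel. g (fst p) * cnj (g (snd p)) * kernel \<Phi> D (fst p - snd p))"
proof -
  have [measurable]: "g \<in> borel_measurable borel" using g by simp
  define e where "e \<xi> z = cis (- (z \<bullet> (\<xi>, \<Phi> \<xi>)))" for \<xi> z
  have [measurable]: "(\<lambda>x. e (f x) (h x)) \<in> borel_measurable M"
    if [measurable]: "f \<in> borel_measurable M" "h \<in> borel_measurable M" for f h M
    unfolding e_def by measurable
  define T where "T \<xi> p = complex_of_real (indicator D \<xi>) * (g (fst p) * cnj (g (snd p)) * e \<xi> (fst p - snd p))" for \<xi> p
  have gg: "integrable lborel (\<lambda>p. g (fst p) * cnj (g (snd p)))"
    using integrable_tensor(1)[OF g, of "\<lambda>z. cnj (g z)"] g by (simp add: lborel_prod)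
  have indD: "integrable lborel (\<lambda>\<xi>. complex_of_real (indicator D \<xi>))"
    using D by (intro integrable_of_real integrable_real_indicator) auto
  have T: "integrable (lborel \<Otimes>\<^sub>M lborel) (\<lambda>x. T (fst x) (snd x))"
  proof (rule Bochner_Integration.integrable_bound[OF integrable_tensor(1)[OF indD gg]])
    show "(\<lambda>x. T (fst x) (snd x)) \<in> borel_measurable (lborel \<Otimes>\<^sub>M lborel)"
      unfolding T_def by measurable
  qed (simp add: T_def e_def norm_mult)
  have sq: "complex_of_real (indicator D \<xi> * (norm (fourier_transform g (\<xi>, \<Phi> \<xi>)))\<^sup>2) = (LINT p|lborel. T \<xi> p)" for \<xi>
  proof -
    define a where "a z = e \<xi> z * g z" for z
    have a: "integrable lborel a" unfolding a_def[abs_def] e_def by (rule integrable_cis_mult[OF g])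
    have "complex_of_real ((norm (fourier_transform g (\<xi>, \<Phi> \<xi>)))\<^sup>2) = (LINT z|lborel. a z) * (LINT z|lborel. cnj (a z))"
    proof -
      have "fourier_transform g (\<xi>, \<Phi> \<xi>) = (LINT z|lborel. a z)"
        by (simp add: fourier_transform_cis a_def e_def)
      thus ?thesis by (simp only: complex_norm_square) simp
    qed
    also have "\<dots> = (LINT p|lborel. a (fst p) * cnj (a (snd p)))"
      using integrable_tensor(2)[OF a, of "\<lambda>z. cnj (a z)"] a by (simp add: lborel_prod)
    also have "\<dots> = (LINT p|lborel. g (fst p) * cnj (g (snd p)) * e \<xi> (fst p - snd p))"
      by (intro Bochner_Integration.integral_cong) (auto simp: a_def e_def inner_diff_left cis_cnj cis_mult algebra_simps)
    finally show ?thesis by (simp add: T_def)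
  qed
  have int_T: "integrable lborel (\<lambda>\<xi>. LINT p|lborel. T \<xi> p)"
    using lborel_pair.integrable_fst'[OF T] by simp
  hence "integrable lborel (\<lambda>\<xi>. complex_of_real (indicator D \<xi> * (norm (fourier_transform g (\<xi>, \<Phi> \<xi>)))\<^sup>2))"
    by (simp only: sq)
  thus "set_integrable lborel D (\<lambda>\<xi>. (norm (fourier_transform g (\<xi>, \<Phi> \<xi>)))\<^sup>2)"
    unfolding set_integrable_def by (simp only: complex_of_real_integrable_eq real_scaleR_def)
  have "complex_of_real (fourier_energy \<Phi> D g) = (LINT \<xi>|lborel. LINT p|lborel. T \<xi> p)"
    unfolding set_lebesgue_integral_def sq[symmetric] real_scaleR_def by (rule integral_complex_of_real[symmetric])
  also have "\<dots> = (LINT p|lborel. LINT \<xi>|lborel. T \<xi> p)"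
    using lborel_pair.Fubini_integral[of T] T by (simp add: split_beta')
  also have "\<dots> = (LINT p|lborel. g (fst p) * cnj (g (snd p)) * kernel \<Phi> D (fst p - snd p))"
  proof (intro Bochner_Integration.integral_cong refl)
    fix p
    have "(LINT \<xi>|lborel. T \<xi> p) = (LINT \<xi>|lborel. (g (fst p) * cnj (g (snd p))) * (indicator D \<xi> *\<^sub>R e \<xi> (fst p - snd p)))"
      by (intro Bochner_Integration.integral_cong) (auto simp: T_def scaleR_conv_of_real)
    also have "\<dots> = g (fst p) * cnj (g (snd p)) * kernel \<Phi> D (fst p - snd p)"
      unfolding kernel_def set_lebesgue_integral_def e_def by (rule integral_mult_right_zero)
    finally show "(LINT \<xi>|lborel. T \<xi> p) = g (fst p) * cnj (g (snd p)) * kernel \<Phi> D (fst p - snd p)" .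
  qed
  finally show "complex_of_real (fourier_energy \<Phi> D g)
      = (LINT p|lborel. g (fst p) * cnj (g (snd p)) * kernel \<Phi> D (fst p - snd p))" .
qed

text \<open>Averaging over \<open>y\<close> multiplies the kernel by the measure of the set of
  \<open>y\<close> whose translate of \<open>U\<close> contains both points. This weight falls short
  of the measure of \<open>U\<close> by exactly the bracket in assumption \<open>B\<close>, so the
  comparison loses only the kernel times the missing overlap, integrated against the moduli of
  \<open>f\<close> at both points.\<close>

lemma
  fixes f :: "(real^'n::finite) \<times> real \<Rightarrow> complex"
  assumes f: "integrable lborel f" and D[measurable]: "D \<in> sets borel" "emeasure lborel D < \<infinity>"
    and \<Phi>[measurable]: "\<Phi> \<in> borel_measurable borel"
    and U[measurable]: "U \<in> sets borel" "emeasure lborel U < \<infinity>"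
    and B: "\<And>z w. norm (kernel \<Phi> D (z - w)) * (measure lborel U - (LINT y|lborel. indicator U (z - y) * indicator U (w - y))) \<le> B"
  defines "E \<equiv> \<lambda>y. LINT \<xi>:D|lborel. (norm (fourier_transform (\<lambda>z. indicator U z * f (z + y)) (\<xi>, \<Phi> \<xi>)))\<^sup>2"
  shows integrable_local_average: "integrable lborel E"
    and fourier_sq_integral_le_local_average: 
      "measure lborel U * (fourier_energy \<Phi> D f)
        \<le> (LINT y|lborel. E y) + B * (LINT z|lborel. norm (f z))\<^sup>2"
proof -
  have [measurable]: "f \<in> borel_measurable borel" using f by simp
  define N where "N p = f (fst p) * cnj (f (snd p)) * kernel \<Phi> D (fst p - snd p)" for p
  have [measurable]: "N \<in> borel_measurable borel" unfolding N_def[abs_def] by measurable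
  have ff: "integrable lborel (\<lambda>p. norm (f (fst p)) * norm (f (snd p)))"
      "(LINT p|lborel. norm (f (fst p)) * norm (f (snd p))) = (LINT z|lborel. norm (f z))\<^sup>2"
    using integrable_tensor[of "\<lambda>z. norm (f z)" "\<lambda>z. norm (f z)"] f by (simp_all add: lborel_prod power2_eq_square)
  have N_le: "norm (N p) \<le> measure lborel D * (norm (f (fst p)) * norm (f (snd p)))" for p
    using mult_left_mono[OF norm_kernel_le_measure[OF D, of \<Phi> "fst p - snd p"], of "norm (f (fst p)) * norm (f (snd p))"]
    by (simp add: N_def norm_mult mult.commute)
  have N: "integrable lborel N"
    by (rule Bochner_Integration.integrable_bound[OF integrable_mult_right[OF ff(1), of "measure lborel D"]])
      (use N_le in auto)
  define I where "I y p = indicat_real U (fst p - y) * indicator U (snd p - y)" for y p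
  have [measurable]: "(\<lambda>x. I (h x) (k x)) \<in> borel_measurable M"
    if [measurable]: "h \<in> borel_measurable M" "k \<in> borel_measurable M" for h k M
    unfolding I_def by measurable
  define m where "m p = (LINT y|lborel. I y p)" for p
  note ind = integrable_indicator_diff[OF U] and ind_mass = integral_indicator_diff[OF U]
  have m0: "0 \<le> m p" for p unfolding m_def I_def by (intro Bochner_Integration.integral_nonneg) auto
  have mU: "m p \<le> measure lborel U" for p
    unfolding m_def I_def ind_mass[of "fst p", symmetric]
    by (intro integral_mono_AE' ind) (auto simp: indicator_def)
  have [measurable]: "m \<in> borel_measurable borel"
    unfolding m_def[abs_def] by measurable
  have IN: "integrable (lborel \<Otimes>\<^sub>M lborel) (\<lambda>x. complex_of_real (I (snd x) (fst x)) * N (fst x))"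
  proof (rule lborel_pair.Fubini_integrable)
    have "(\<lambda>p. LINT y|lborel. norm (complex_of_real (I (snd (p, y)) (fst (p, y))) * N (fst (p, y)))) = (\<lambda>p. m p * norm (N p))"
      by (auto simp: norm_mult m_def I_def abs_mult)
    moreover have "integrable lborel (\<lambda>p. m p * norm (N p))"
      by (rule Bochner_Integration.integrable_bound[OF integrable_mult_right[OF N, of "of_real (measure lborel U)"]])
        (auto simp: norm_mult m0 mU intro!: mult_right_mono)
    ultimately show "integrable lborel (\<lambda>p. LINT y|lborel. norm (complex_of_real (I (snd (p, y)) (fst (p, y))) * N (fst (p, y))))"
      by simp
    have "integrable lborel (\<lambda>y. I y p)" for p
      by (rule Bochner_Integration.integrable_bound[OF ind[of "fst p"]]) (auto simp: I_def indicator_def)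
    thus "AE p in lborel. integrable lborel (\<lambda>y. complex_of_real (I (snd (p, y)) (fst (p, y))) * N (fst (p, y)))"
      by simp
  qed measurable
  have E: "complex_of_real (E y) = (LINT p|lborel. complex_of_real (I y p) * N p)" for y
  proof -
    define g where "g z = indicator U z * f (z + y)" for z
    have [measurable]: "g \<in> borel_measurable borel"
      unfolding g_def[abs_def] by measurable
    have "integrable lborel (\<lambda>z. f (z + y))" using f by (rule integrable_lborel_translate)
    hence g: "integrable lborel g"
      by (rule Bochner_Integration.integrable_bound) (auto simp: g_def norm_mult indicator_def)
    have "complex_of_real (E y) = (LINT p|lborel. g (fst p) * cnj (g (snd p)) * kernel \<Phi> D (fst p - snd p))"
      unfolding E_def g_def[symmetric] by (rule fourier_sq_integral_eq[OF g D \<Phi>])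
    \<comment> \<open>Shifting both variables by \<open>y\<close> moves the translation from
      \<open>f\<close> to the indicators; the kernel sees only the difference of the
      variables.\<close>
    also have "\<dots> = (LINT p|lborel. (\<lambda>p. complex_of_real (I y p) * N p) (p + (y, y)))"
      by (intro Bochner_Integration.integral_cong) (auto simp: g_def N_def I_def indicator_def)
    also have "\<dots> = (LINT p|lborel. complex_of_real (I y p) * N p)"
      by (rule lborel_integral_translate) measurable
    finally show ?thesis .
  qed
  have "integrable lborel (\<lambda>y. LINT p|lborel. complex_of_real (I y p) * N p)"
    using lborel_pair.integrable_snd[of "\<lambda>p y. complex_of_real (I y p) * N p"] IN by (simp add: split_beta')
  hence "integrable lborel (\<lambda>y. complex_of_real (E y))" by (simp only: E)
  thus "integrable lborel E" by (simp only: complex_of_real_integrable_eq)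
  have "complex_of_real (LINT y|lborel. E y) = (LINT y|lborel. LINT p|lborel. complex_of_real (I y p) * N p)"
    unfolding E[symmetric] by (rule integral_complex_of_real[symmetric])
  also have "\<dots> = (LINT p|lborel. LINT y|lborel. complex_of_real (I y p) * N p)"
    using lborel_pair.Fubini_integral[of "\<lambda>p y. complex_of_real (I y p) * N p"] IN by (simp add: split_beta')
  also have "\<dots> = (LINT p|lborel. complex_of_real (m p) * N p)"
    by (simp add: m_def)
  finally have LE: "complex_of_real (LINT y|lborel. E y) = (LINT p|lborel. complex_of_real (m p) * N p)" .
  have mN: "integrable lborel (\<lambda>p. complex_of_real (m p) * N p)"
    by (rule Bochner_Integration.integrable_bound[OF integrable_mult_right[OF N, of "of_real (measure lborel U)"]])
      (auto simp: norm_mult m0 mU intro!: mult_right_mono)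
  define Q where "Q = (fourier_energy \<Phi> D f)"
  have "complex_of_real (measure lborel U * Q - (LINT y|lborel. E y)) = of_real (measure lborel U) * (LINT p|lborel. N p) - (LINT p|lborel. complex_of_real (m p) * N p)"
    unfolding of_real_diff of_real_mult LE Q_def fourier_sq_integral_eq[OF f D \<Phi>] N_def by simp
  also have "\<dots> = (LINT p|lborel. complex_of_real (measure lborel U - m p) * N p)"
    using N mN by (simp add: left_diff_distrib)
  finally have "measure lborel U * Q - (LINT y|lborel. E y) \<le> norm (LINT p|lborel. complex_of_real (measure lborel U - m p) * N p)"
    by (metis abs_ge_self norm_of_real)
  also have "\<dots> \<le> (LINT p|lborel. B * (norm (f (fst p)) * norm (f (snd p))))"
  proof (rule Bochner_Integration.integral_norm_bound_integral)
    show "integrable lborel (\<lambda>p. complex_of_real (measure lborel U - m p) * N p)"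
      using N mN by (simp add: left_diff_distrib)
    show "integrable lborel (\<lambda>p. B * (norm (f (fst p)) * norm (f (snd p))))"
      using ff(1) by simp
    fix p
    have "norm (complex_of_real (measure lborel U - m p) * N p) =
        (norm (kernel \<Phi> D (fst p - snd p)) * (measure lborel U - m p)) * (norm (f (fst p)) * norm (f (snd p)))"
      using mU[of p] by (simp add: N_def norm_mult del: of_real_diff)
    also have "\<dots> \<le> B * (norm (f (fst p)) * norm (f (snd p)))"
      using B[of "fst p" "snd p"] by (intro mult_right_mono) (auto simp: m_def I_def)
    finally show "norm (complex_of_real (measure lborel U - m p) * N p) \<le> B * (norm (f (fst p)) * norm (f (snd p)))" .
  qed
  also have "\<dots> = B * (LINT z|lborel. norm (f z))\<^sup>2" by (simp add: ff(2))
  finally show "measure lborel U * (fourier_energy \<Phi> D f)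
        \<le> (LINT y|lborel. E y) + B * (LINT z|lborel. norm (f z))\<^sup>2"
    by (simp add: Q_def)
qed

section \<open>Overlap of translated cylinders\<close>

lemma emeasure_cylinder:
  assumes "0 \<le> a" "l \<le> u"
  shows "emeasure lborel (ball (0 :: real^'n::finite) a \<times> {l<..<u}) = ennreal (unit_ball_vol (real CARD('n)) * a ^ CARD('n) * (u - l))"
proof -
  have "emeasure lborel (ball (0 :: real^'n) a \<times> {l<..<u}) = emeasure lborel (ball (0 :: real^'n) a) * emeasure lborel {l<..<u}"
    unfolding lborel_prod[symmetric] by (intro lborel.emeasure_pair_measure_Times) auto
  thus ?thesis using assms by (simp add: emeasure_ball flip: ennreal_mult)
qed

text \<open>If \<open>z - y\<close> lies in the cylinder shrunk by the distance of \<open>z\<close>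
  and \<open>w\<close>, then \<open>w - y\<close> still lies in \<open>U\<close>, so the overlap is
  at least the volume of the shrunk cylinder. The time interval loses \<open>\<delta>\<close> at
  each end; letting the radius lose \<open>2 * \<delta>\<close> as well makes the volume ratio a
  pure power, and Bernoulli's inequality makes the loss linear. For distant points the left side is
  not positive.\<close>

lemma overlap_ge:
  fixes z w :: "(real^'n::finite) \<times> real"
  assumes "0 < R"
  defines "U \<equiv> ball (0 :: real^'n) R \<times> {0<..<R}"
  shows "measure lborel U * (1 - 2 * (real CARD('n) + 1) * norm (z - w) / R) \<le> (LINT y|lborel. indicator U (z - y) * indicator U (w - y))"
proof (cases "2 * norm (z - w) \<le> R")
  case False
  have "1 * R \<le> (real CARD('n) + 1) * (2 * norm (z - w))" using False assms by (intro mult_mono) auto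
  hence "1 - 2 * (real CARD('n) + 1) * norm (z - w) / R \<le> 0" using assms by (simp add: field_simps)
  hence "measure lborel U * (1 - 2 * (real CARD('n) + 1) * norm (z - w) / R) \<le> 0"
    by (intro mult_nonneg_nonpos) auto
  also have "0 \<le> (LINT y|lborel. indicator U (z - y) * indicator U (w - y) :: real)"
    by (intro Bochner_Integration.integral_nonneg) auto
  finally show ?thesis .
next
  case True
  define n where "n = CARD('n)"
  define \<delta> where "\<delta> = norm (z - w)"
  have \<delta>: "0 \<le> \<delta>" "2 * \<delta> \<le> R" using True by (auto simp: \<delta>_def)
  define W where "W = ball (0 :: real^'n) (R - \<delta>) \<times> {\<delta><..<R - \<delta>}"
  define v where "v = unit_ball_vol (real n)"
  have v: "0 \<le> v" by (simp add: v_def)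
  have U_meas[measurable]: "U \<in> sets borel" "emeasure lborel U < \<infinity>"
    using assms by (auto simp: emeasure_cylinder borel_prod[symmetric])
  have mU: "measure lborel U = v * R ^ n * R"
    using assms emeasure_cylinder[of R 0 R, where 'n='n] by (simp add: measure_def v_def n_def)
  have mW: "measure lborel W = v * (R - \<delta>) ^ n * (R - 2 * \<delta>)"
    using \<delta> emeasure_cylinder[of "R - \<delta>" \<delta> "R - \<delta>", where 'n='n] by (simp add: measure_def v_def n_def W_def)
  have W_meas: "W \<in> sets borel" "emeasure lborel W < \<infinity>"
    using \<delta> unfolding W_def by (auto simp: emeasure_cylinder borel_prod[symmetric])
  have "v * R ^ n * R * (1 - 2 * (real n + 1) * \<delta> / R) \<le> v * R ^ n * R * (1 - 2 * \<delta> / R) ^ (n + 1)"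
  proof (intro mult_left_mono)
    have "1 + real (n + 1) * (- (2 * \<delta> / R)) \<le> (1 + - (2 * \<delta> / R)) ^ (n + 1)"
      using \<delta> assms(1) by (intro Bernoulli_inequality) (simp add: field_simps)
    thus "1 - 2 * (real n + 1) * \<delta> / R \<le> (1 - 2 * \<delta> / R) ^ (n + 1)" by (simp add: algebra_simps)
  qed (use v assms(1) in auto)
  also have "\<dots> = v * (R - 2 * \<delta>) ^ n * (R - 2 * \<delta>)"
  proof -
    have "R ^ (n + 1) * (1 - 2 * \<delta> / R) ^ (n + 1) = (R - 2 * \<delta>) ^ (n + 1)"
      unfolding power_mult_distrib[symmetric] using assms(1) by (simp add: right_diff_distrib del: power_Suc)
    thus ?thesis by (simp add: mult_ac)
  qed
  also have "\<dots> \<le> measure lborel W"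
    unfolding mW using v \<delta> by (intro mult_right_mono mult_left_mono power_mono) auto
  also have "\<dots> = (LINT y|lborel. indicator W (z - y))"
    by (rule integral_indicator_diff[OF W_meas, symmetric])
  also have "\<dots> \<le> (LINT y|lborel. indicator U (z - y) * indicator U (w - y))"
  proof (rule integral_mono_AE')
    have "integrable lborel (\<lambda>y. indicat_real U (z - y))" by (rule integrable_indicator_diff[OF U_meas])
    thus "integrable lborel (\<lambda>y. indicat_real U (z - y) * indicator U (w - y))"
      by (rule Bochner_Integration.integrable_bound) (auto simp: indicator_def)
    have "z - y \<in> U \<and> w - y \<in> U" if "z - y \<in> W" for y
    proof -
      obtain u t where ut: "z - y = (u, t)" by (cases "z - y")
      obtain a b where ab: "z - w = (a, b)" by (cases "z - w")
      have "w - y = (z - y) - (z - w)" by simp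
      hence wy: "w - y = (u - a, t - b)" by (simp add: ut ab)
      have "norm a \<le> \<delta>" "\<bar>b\<bar> \<le> \<delta>"
        using norm_fst_le[of a b] norm_snd_le[of b a] ab by (simp_all add: \<delta>_def)
      moreover have "norm u < R - \<delta>" "\<delta> < t" "t < R - \<delta>" using that ut by (auto simp: W_def)
      moreover have "norm (u - a) \<le> norm u + norm a" by (rule norm_triangle_ineq4)
      ultimately show ?thesis using \<delta> by (auto simp: ut wy U_def)
    qed
    thus "AE y in lborel. indicator W (z - y) \<le> (indicator U (z - y) * indicator U (w - y) :: real)"
      by (auto simp: indicator_def)
  qed auto
  finally show ?thesis by (simp add: mU n_def \<delta>_def)
qed

section \<open>The surface measure\<close>

lemma borel_annulus: "(annulus :: (real^'n::finite) set) \<in> sets borel"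
  by (intro borel_closed compact_imp_closed compact_annulus)

lemma emeasure_subset_annulus_finite: "D \<subseteq> annulus \<Longrightarrow> emeasure lborel D < \<infinity>"
  using emeasure_mono[of D annulus lborel] emeasure_compact_finite[OF compact_annulus] borel_annulus
  by (metis order_le_less_trans sets_lborel)

lemma L2_norm_sq: "(L2_norm M g)\<^sup>2 = (\<integral>\<^sup>+z. ennreal ((norm (g z))\<^sup>2) \<partial>M)"
  by (simp add: L2_norm_def ennpowr_ennpowr flip: ennpowr_2)

lemma L2_norm_cong_AE:
  assumes "AE z in M. norm (g z) = norm (h z)"
  shows "L2_norm M g = L2_norm M h"
  unfolding L2_norm_def using assms by (intro arg_cong2[where f = ennpowr] nn_integral_cong_AE) auto

lemma borel_measurable_fourier_transform [measurable]:
  fixes f :: "'a::euclidean_space \<Rightarrow> complex"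
  assumes [measurable]: "f \<in> borel_measurable borel"
  shows "fourier_transform f \<in> borel_measurable borel"
  unfolding fourier_transform_cis[abs_def] by measurable

definition area_element :: "(real^'n::finite \<Rightarrow> real) \<Rightarrow> real^'n \<Rightarrow> real" where
  "area_element \<Phi> \<xi> = indicator annulus \<xi> * sqrt (1 + (norm (gradient \<Phi> \<xi>))\<^sup>2)"

lemma area_element_ge: "\<xi> \<in> annulus \<Longrightarrow> 1 \<le> area_element \<Phi> \<xi>"
  by (simp add: area_element_def)

lemma area_element_eq_0: "\<xi> \<notin> annulus \<Longrightarrow> area_element \<Phi> \<xi> = 0"
  by (simp add: area_element_def)

lemma surface_measure_eq:
  "surface_measure \<Phi> = distr (density lborel (\<lambda>\<xi>. ennreal (area_element \<Phi> \<xi>))) borel (\<lambda>\<xi>. (\<xi>, \<Phi> \<xi>))"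
  by (simp add: surface_measure_def area_element_def)

lemma sets_surface_measure [measurable_cong]: "sets (surface_measure \<Phi>) = sets borel"
  by (simp add: surface_measure_eq)

context
  fixes \<Phi> :: "real^'n::finite \<Rightarrow> real"
  assumes smooth: "Ck_on 2 \<Phi> (- {0})"
begin

lemma borel_measurable_surface_fun: "\<Phi> \<in> borel_measurable borel"
  using continuous_on_Ck_on_2(1)[OF smooth] by (intro borel_measurable_continuous_countable_exceptions[of "{0}"]) auto

lemma continuous_on_gradient: "continuous_on (- {0}) (gradient \<Phi>)"
  unfolding gradient_def partial_deriv_def
  by (intro continuous_on_vec_lambda continuous_on_Ck_on_2(2)[OF smooth])

lemma borel_measurable_area_element: "area_element \<Phi> \<in> borel_measurable borel"
proof -
  have [measurable]: "gradient \<Phi> \<in> borel_measurable borel"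
    using continuous_on_gradient by (intro borel_measurable_continuous_countable_exceptions[of "{0}"]) auto
  have [measurable]: "(annulus :: (real^'n) set) \<in> sets borel"
    by (rule borel_annulus)
  show ?thesis unfolding area_element_def[abs_def] by measurable
qed

lemma area_element_bounded: "\<exists>A\<ge>0. \<forall>\<xi>. area_element \<Phi> \<xi> \<le> A"
proof -
  have sub: "annulus \<subseteq> - {0 :: real^'n}" by (auto simp: annulus_def)
  have "bounded ((\<lambda>\<xi>. sqrt (1 + (norm (gradient \<Phi> \<xi>))\<^sup>2)) ` annulus)"
    by (intro compact_imp_bounded compact_continuous_image continuous_intros
        continuous_on_subset[OF continuous_on_gradient sub] compact_annulus)
  then obtain A where "A > 0" "\<forall>\<xi>\<in>annulus. \<bar>sqrt (1 + (norm (gradient \<Phi> \<xi>))\<^sup>2)\<bar> \<le> A"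
    unfolding bounded_pos by auto
  hence "area_element \<Phi> \<xi> \<le> A" for \<xi> by (cases "\<xi> \<in> annulus") (auto simp: area_element_def)
  thus ?thesis using \<open>A > 0\<close> by (intro exI[of _ A]) auto
qed

lemma nn_integral_surface_measure:
  assumes [measurable]: "h \<in> borel_measurable borel"
  shows "(\<integral>\<^sup>+\<zeta>. h \<zeta> \<partial>surface_measure \<Phi>) = (\<integral>\<^sup>+\<xi>. ennreal (area_element \<Phi> \<xi>) * h (\<xi>, \<Phi> \<xi>) \<partial>lborel)"
proof -
  note [measurable] = borel_measurable_surface_fun borel_measurable_area_element
  show ?thesis
    unfolding surface_measure_eq by (simp add: nn_integral_distr nn_integral_density)
qed

lemma AE_surface: "AE \<zeta> in surface_measure \<Phi>. \<zeta> \<in> surface \<Phi>"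
proof -
  note [measurable] = borel_measurable_surface_fun borel_measurable_area_element
  have sub: "annulus \<subseteq> - {0 :: real^'n}" by (auto simp: annulus_def)
  have "compact (surface \<Phi>)"
    unfolding surface_def
    by (intro compact_continuous_image compact_annulus continuous_intros continuous_on_subset[OF continuous_on_Ck_on_2(1)[OF smooth] sub])
  hence "closed (surface \<Phi>)" by (rule compact_imp_closed)
  hence "{\<zeta> \<in> space borel. \<zeta> \<in> surface \<Phi>} \<in> sets borel" by simp
  moreover have "AE \<xi> in density lborel (\<lambda>\<xi>. ennreal (area_element \<Phi> \<xi>)). (\<xi>, \<Phi> \<xi>) \<in> surface \<Phi>"
  proof (subst AE_density)
    have "\<xi> \<in> annulus" if "0 < area_element \<Phi> \<xi>" for \<xi>
      using that area_element_eq_0[of \<xi> \<Phi>] by (cases "\<xi> \<in> annulus") auto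
    thus "AE \<xi> in lborel. 0 < ennreal (area_element \<Phi> \<xi>) \<longrightarrow> (\<xi>, \<Phi> \<xi>) \<in> surface \<Phi>"
      by (auto simp: surface_def)
  qed simp
  ultimately show ?thesis
    unfolding surface_measure_eq by (subst AE_distr_iff) auto
qed

lemma restriction_op_AE: "AE \<zeta> in surface_measure \<Phi>. restriction_op \<Phi> f \<zeta> = fourier_transform f \<zeta>"
  using AE_surface by eventually_elim (simp add: restriction_op_def)

lemma L2_norm_restriction_op: "L2_norm (surface_measure \<Phi>) (restriction_op \<Phi> f) = L2_norm (surface_measure \<Phi>) (fourier_transform f)"
proof (rule L2_norm_cong_AE)
  show "AE \<zeta> in surface_measure \<Phi>. norm (restriction_op \<Phi> f \<zeta>) = norm (fourier_transform f \<zeta>)"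
    using restriction_op_AE[of f] by eventually_elim simp
qed

lemma L2_norm_restriction_sq:
  fixes f :: "(real^'n) \<times> real \<Rightarrow> complex"
  assumes [measurable]: "f \<in> borel_measurable borel"
  shows "(L2_norm (surface_measure \<Phi>) (restriction_op \<Phi> f))\<^sup>2
    = (\<integral>\<^sup>+\<xi>. ennreal (area_element \<Phi> \<xi>) * ennreal ((norm (fourier_transform f (\<xi>, \<Phi> \<xi>)))\<^sup>2) \<partial>lborel)"
  unfolding L2_norm_restriction_op L2_norm_sq by (rule nn_integral_surface_measure) measurable

text \<open>The area element is at least 1 on the annulus, so passing to the surface measure can
  only increase the integral.\<close>

lemma piece_le_L2_norm_restriction:
  fixes f :: "(real^'n) \<times> real \<Rightarrow> complex"
  assumes f: "integrable lborel f" and D: "D \<in> sets borel" "D \<subseteq> annulus"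
  shows "ennreal (fourier_energy \<Phi> D f) \<le> (L2_norm (surface_measure \<Phi>) (restriction_op \<Phi> f))\<^sup>2"
proof -
  have fin: "emeasure lborel D < \<infinity>"
    using D(2) by (rule emeasure_subset_annulus_finite)
  have "ennreal (fourier_energy \<Phi> D f) =
      (\<integral>\<^sup>+\<xi>. ennreal (indicator D \<xi> * (norm (fourier_transform f (\<xi>, \<Phi> \<xi>)))\<^sup>2) \<partial>lborel)"
    using set_integrable_fourier_sq[OF f D(1) fin borel_measurable_surface_fun]
    unfolding set_lebesgue_integral_def set_integrable_def by (subst nn_integral_eq_integral) auto
  also have "\<dots> \<le> (L2_norm (surface_measure \<Phi>) (restriction_op \<Phi> f))\<^sup>2"
  proof (subst L2_norm_restriction_sq)
    show "(\<integral>\<^sup>+\<xi>. ennreal (indicator D \<xi> * (norm (fourier_transform f (\<xi>, \<Phi> \<xi>)))\<^sup>2) \<partial>lborel)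
      \<le> (\<integral>\<^sup>+\<xi>. ennreal (area_element \<Phi> \<xi>) * ennreal ((norm (fourier_transform f (\<xi>, \<Phi> \<xi>)))\<^sup>2) \<partial>lborel)"
    proof (rule nn_integral_mono)
      fix \<xi>
      have "indicator D \<xi> \<le> area_element \<Phi> \<xi>"
        using D(2) area_element_ge[of \<xi> \<Phi>] area_element_eq_0[of \<xi> \<Phi>] by (cases "\<xi> \<in> annulus") (auto simp: indicator_def)
      hence "indicator D \<xi> * (norm (fourier_transform f (\<xi>, \<Phi> \<xi>)))\<^sup>2 \<le> area_element \<Phi> \<xi> * (norm (fourier_transform f (\<xi>, \<Phi> \<xi>)))\<^sup>2"
        by (intro mult_right_mono) auto
      thus "ennreal (indicator D \<xi> * (norm (fourier_transform f (\<xi>, \<Phi> \<xi>)))\<^sup>2)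
        \<le> ennreal (area_element \<Phi> \<xi>) * ennreal ((norm (fourier_transform f (\<xi>, \<Phi> \<xi>)))\<^sup>2)"
        by (subst ennreal_mult''[symmetric]) (auto intro: ennreal_leI)
    qed
  qed (use f in auto)
  finally show ?thesis .
qed

text \<open>On translates of the cylinder the hypothesis applies, and by their overlap the average over
  all translates differs from the global quantity only by the far part of the kernel.\<close>

lemma fourier_sq_integral_split:
  fixes f :: "(real^'n) \<times> real \<Rightarrow> complex"
  assumes f: "integrable lborel f" and D: "D \<in> sets borel" "D \<subseteq> annulus"
    and K: "\<And>z. norm (kernel \<Phi> D z) * sqrt (norm z) \<le> K"
    and q: "1 \<le> q" "q \<le> 2" and r: "1 \<le> r" "r \<le> 2"
    and A: "0 \<le> A" "mixed_norm q r f \<le> ennreal A"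
    and R: "0 < R" and M: "0 \<le> M"
    and hyp: "\<And>g. g \<in> mixed_Lp q r \<Longrightarrow>
      L2_norm (surface_measure \<Phi>) (restriction_op \<Phi> (cutoff R g)) \<le> ennreal M * mixed_norm q r g"
  shows "(fourier_energy \<Phi> D f)
    \<le> 4 * M\<^sup>2 * A\<^sup>2 + 2 * (real CARD('n) + 1) * K / sqrt R * (LINT z|lborel. norm (f z))\<^sup>2"
proof -
  note \<Phi>_meas = borel_measurable_surface_fun
  have f_meas[measurable]: "f \<in> borel_measurable borel" using f by simp
  have finD: "emeasure lborel D < \<infinity>"
    using D(2) by (rule emeasure_subset_annulus_finite)
  define n where "n = real CARD('n)"
  define U where "U = ball (0 :: real^'n) R \<times> {0<..<R}"
  have U[measurable]: "U \<in> sets borel" and finU: "emeasure lborel U < \<infinity>"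
    using R by (auto simp: U_def emeasure_cylinder borel_prod[symmetric])
  have "0 < unit_ball_vol (real CARD('n)) * R ^ CARD('n) * R"
    using R by simp
  hence mU: "0 < measure lborel U" "emeasure lborel U = ennreal (measure lborel U)"
    using R emeasure_cylinder[of R 0 R, where 'n='n] by (simp_all add: U_def measure_def)
  have K0: "0 \<le> K" using K[of 0] by simp
  have n0: "0 \<le> n" by (simp add: n_def)
  \<comment> \<open>Up to distance \<open>R\<close> the missing overlap is at most a multiple of
    \<open>h / R\<close> and the kernel decays like \<open>K / sqrt h\<close>; the product is at
    most a multiple of \<open>1 / sqrt R\<close>. Beyond distance \<open>R\<close> the kernel is
    small by itself.\<close>
  have far: "norm (kernel \<Phi> D (z - w)) * (measure lborel U - (LINT y|lborel. indicator U (z - y) * indicator U (w - y)))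
      \<le> 2 * (n + 1) * K / sqrt R * measure lborel U" for z w
  proof -
    define h where "h = norm (z - w)"
    have h0: "0 \<le> h" by (simp add: h_def)
    define k where "k = norm (kernel \<Phi> D (z - w))"
    have k: "0 \<le> k" "k * sqrt h \<le> K" using K[of "z - w"] by (auto simp: k_def h_def)
    define m where "m = (LINT y|lborel. indicat_real U (z - y) * indicator U (w - y))"
    have m: "0 \<le> m" unfolding m_def by (intro Bochner_Integration.integral_nonneg) auto
    have ov: "measure lborel U * (1 - 2 * (n + 1) * h / R) \<le> m"
      using overlap_ge[OF R, of z w] by (simp add: U_def n_def h_def m_def)
    show ?thesis unfolding k_def[symmetric] m_def[symmetric]
    proof (cases "h \<le> R")
      case True
      have "measure lborel U - m \<le> 2 * (n + 1) * h / R * measure lborel U"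
        using ov by (simp add: algebra_simps)
      hence "k * (measure lborel U - m) \<le> k * (2 * (n + 1) * h / R * measure lborel U)"
        using k(1) by (intro mult_left_mono) auto
      also have "\<dots> = 2 * (n + 1) * (k * sqrt h) * (sqrt h / R) * measure lborel U"
      proof -
        have "h = sqrt h * sqrt h" using h0 by simp
        thus ?thesis by (metis (no_types, opaque_lifting) mult.assoc mult.commute times_divide_eq_left times_divide_eq_right)
      qed
      also have "\<dots> \<le> 2 * (n + 1) * K * (sqrt R / R) * measure lborel U"
        using k True R n0 mU K0 h0 by (intro mult_mono divide_right_mono) auto
      also have "sqrt R / R = 1 / sqrt R" using R by (simp add: field_simps)
      finally show "k * (measure lborel U - m) \<le> 2 * (n + 1) * K / sqrt R * measure lborel U" by simp
    next
      case False
      hence "k * sqrt R \<le> k * sqrt h" using k(1) by (intro mult_left_mono) auto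
      hence "k * sqrt R \<le> K" using k(2) by simp
      hence "k \<le> 1 * (K / sqrt R)" using R by (simp add: field_simps)
      also have "\<dots> \<le> 2 * (n + 1) * (K / sqrt R)" using n0 K0 R by (intro mult_right_mono) auto
      finally have "k \<le> 2 * (n + 1) * K / sqrt R" by simp
      hence "k * measure lborel U \<le> 2 * (n + 1) * K / sqrt R * measure lborel U"
        using mU by (intro mult_right_mono) auto
      moreover have "k * (measure lborel U - m) \<le> k * measure lborel U"
        using k(1) m by (intro mult_left_mono) auto
      ultimately show "k * (measure lborel U - m) \<le> 2 * (n + 1) * K / sqrt R * measure lborel U" by linarith
    qed
  qed
  define g where "g y z = indicator U z * f (z + y)" for y z
  define E where "E y = (fourier_energy \<Phi> D (g y))" for y
  note avg = integrable_local_average[OF f D(1) finD \<Phi>_meas U finU far] fourier_sq_integral_le_local_average[OF f D(1) finD \<Phi>_meas U finU far]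
  have E_int: "integrable lborel E"
    using avg(1) by (simp add: E_def[abs_def] g_def[abs_def])
  have le: "measure lborel U * (fourier_energy \<Phi> D f)
        \<le> (LINT y|lborel. E y) + 2 * (n + 1) * K / sqrt R * measure lborel U * (LINT z|lborel. norm (f z))\<^sup>2"
    using avg(2) by (simp add: E_def[abs_def] g_def[abs_def])
  have E0: "0 \<le> E y" for y
    unfolding E_def set_lebesgue_integral_def by (intro Bochner_Integration.integral_nonneg) auto
  define u where "u y z = indicator U (z - y) * f z" for y z
  have [measurable]: "u y \<in> borel_measurable borel" "g y \<in> borel_measurable borel" for y
    unfolding u_def[abs_def] g_def[abs_def] by measurable
  have gu: "mixed_norm q r (g y) = mixed_norm q r (u y)" for y
    using mixed_norm_translate[of "u y" q r y] by (simp add: u_def g_def[abs_def])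
  have E_le: "ennreal (E y) \<le> ennreal (M\<^sup>2) * (mixed_norm q r (u y))\<^sup>2" for y
  proof -
    have "integrable lborel (\<lambda>z. f (z + y))" using f by (rule integrable_lborel_translate)
    hence g: "integrable lborel (g y)"
      by (rule Bochner_Integration.integrable_bound) (auto simp: g_def norm_mult indicator_def)
    have "mixed_norm q r (g y) \<le> mixed_norm q r f"
      unfolding gu using q r by (intro mixed_norm_mono) (auto simp: u_def indicator_def)
    hence "mixed_norm q r (g y) < \<infinity>" using A by (metis ennreal_less_top infinity_ennreal_def order_le_less_trans order_trans)
    hence "g y \<in> mixed_Lp q r" by (simp add: mixed_Lp_def)
    from hyp[OF this] have "L2_norm (surface_measure \<Phi>) (restriction_op \<Phi> (cutoff R (g y))) \<le> ennreal M * mixed_norm q r (g y)" .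
    \<comment> \<open>Each recentred piece is already supported in the cylinder, so
      \<open>hyp\<close> bounds the piece itself.\<close>
    moreover have "cutoff R (g y) = g y"
      by (auto simp: cutoff_def g_def U_def fun_eq_iff indicator_def)
    ultimately have "(L2_norm (surface_measure \<Phi>) (restriction_op \<Phi> (g y)))\<^sup>2 \<le> (ennreal M * mixed_norm q r (u y))\<^sup>2"
      by (intro power_mono) (simp_all add: gu)
    with piece_le_L2_norm_restriction[OF g D] have "ennreal (E y) \<le> (ennreal M * mixed_norm q r (u y))\<^sup>2"
      unfolding E_def by (rule order_trans)
    thus ?thesis using M by (simp add: power_mult_distrib ennreal_power)
  qed
  have "ennreal (LINT y|lborel. E y) = (\<integral>\<^sup>+y. ennreal (E y) \<partial>lborel)"
    using E_int E0 by (intro nn_integral_eq_integral[symmetric]) auto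
  also have "\<dots> \<le> (\<integral>\<^sup>+y. ennreal (M\<^sup>2) * (mixed_norm q r (u y))\<^sup>2 \<partial>lborel)"
    by (intro nn_integral_mono E_le)
  also have "\<dots> \<le> ennreal (M\<^sup>2) * (4 * emeasure lborel U * ennreal (A\<^sup>2))"
  proof -
    have eq: "mixed_norm q r (u y) = mixed_norm q r (g y)" for y by (simp add: gu)
    have meas: "(\<lambda>y. (mixed_norm q r (u y))\<^sup>2) \<in> borel_measurable borel"
      unfolding mixed_norm_eq mixed_integral_def time_integral_def u_def by measurable
    have "(\<integral>\<^sup>+y. ennreal (M\<^sup>2) * (mixed_norm q r (u y))\<^sup>2 \<partial>lborel) = ennreal (M\<^sup>2) * (\<integral>\<^sup>+y. (mixed_norm q r (u y))\<^sup>2 \<partial>lborel)"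
      using meas by (intro nn_integral_cmult) simp
    thus ?thesis using nn_integral_mixed_norm_translates_le[OF f_meas U q r A]
      unfolding u_def by (simp add: mult_left_mono)
  qed
  also have "\<dots> = ennreal (measure lborel U * (4 * M\<^sup>2 * A\<^sup>2))"
    using mU by (simp add: ennreal_mult mult_ac)
  finally have "(LINT y|lborel. E y) \<le> measure lborel U * (4 * M\<^sup>2 * A\<^sup>2)"
    using mU by (subst (asm) ennreal_le_iff) auto
  with le have "measure lborel U * (fourier_energy \<Phi> D f)
      \<le> measure lborel U * (4 * M\<^sup>2 * A\<^sup>2 + 2 * (n + 1) * K / sqrt R * (LINT z|lborel. norm (f z))\<^sup>2)"
    by (simp add: algebra_simps)
  thus ?thesis using mU unfolding n_def by (subst (asm) mult_le_cancel_left_pos) auto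
qed

end

section \<open>Smoothing at unit scale\<close>

text \<open>Integrated with a suitable \<open>l\<close>, this stands in for the inequalities of Hoelder and Jensen, at the cost
  of a constant.\<close>

lemma le_add_powr:
  fixes a l r :: real
  assumes "0 \<le> a" "0 < l" "1 \<le> r"
  shows "a \<le> l + l powr (1 - r) * a powr r"
proof (cases "a \<le> l")
  case False
  hence a: "0 < a" using assms by simp
  have "a = a powr (1 - r) * a powr r" using a by (simp flip: powr_add)
  also have "\<dots> \<le> l powr (1 - r) * a powr r"
    using a False assms by (intro mult_right_mono powr_mono2') auto
  finally show ?thesis using assms by simp
qed (simp add: add_increasing2)

text \<open>The last assumption is what \<open>le_add_powr\<close> yields after averaging when its
  threshold makes the linear term \<open>g / 2\<close>. Absorbing that term on the left leaves
  Jensen's inequality for a mean of total weight \<open>l\<close>, up to a factor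
  \<open>2 powr r\<close>.\<close>

lemma powr_half_le_of_le:
  fixes g l V r :: real
  assumes "0 < g" "0 < l" "0 \<le> V" "g \<le> g / 2 + (g / (2 * l)) powr (1 - r) * V"
  shows "(g / 2) powr r \<le> l powr (r - 1) * V"
proof -
  define a where "a = g / (2 * l)"
  have a: "0 < a" "g / 2 = a * l" using assms(1,2) by (simp_all add: a_def)
  have "a powr (r - 1) * (g / 2) \<le> a powr (r - 1) * (a powr (1 - r) * V)"
    using assms(4) unfolding a_def by (intro mult_left_mono) simp_all
  also have "\<dots> = V" using a by (simp add: mult.assoc[symmetric] flip: powr_add)
  finally have "l powr (r - 1) * (a powr (r - 1) * (g / 2)) \<le> l powr (r - 1) * V"
    by (intro mult_left_mono) auto
  moreover have "l powr (r - 1) * (a powr (r - 1) * (g / 2)) = (g / 2) powr r"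
  proof -
    have "a powr r = a powr (r - 1) * a" "l powr r = l powr (r - 1) * l"
      using a assms by (simp_all add: powr_diff)
    thus ?thesis unfolding a(2) using a assms by (simp add: powr_mult mult_ac)
  qed
  ultimately show ?thesis by simp
qed

section \<open>Convolution with a bounded product density\<close>

context
  fixes b :: "real^'n::finite \<Rightarrow> real" and d :: "real \<Rightarrow> real" and binf dinf :: real
  assumes b_meas [measurable]: "b \<in> borel_measurable borel" and d_meas [measurable]: "d \<in> borel_measurable borel"
    and b_nonneg: "\<And>y. 0 \<le> b y" and d_nonneg: "\<And>s. 0 \<le> d s"
    and b_le: "\<And>y. b y \<le> binf" and d_le: "\<And>s. d s \<le> dinf"
    and b_mass: "(\<integral>\<^sup>+y. ennreal (b y) \<partial>lborel) = 1" and d_mass: "(\<integral>\<^sup>+s. ennreal (d s) \<partial>lborel) = 1"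
begin

lemma binf_nonneg: "0 \<le> binf" and dinf_nonneg: "0 \<le> dinf"
  using b_nonneg b_le d_nonneg d_le order_trans by blast+

text \<open>The density is a product because the mixed norm treats the variables separately: the
  average in time is estimated on each slice before the average in space.\<close>

definition smoothing :: "((real^'n) \<times> real \<Rightarrow> complex) \<Rightarrow> (real^'n) \<times> real \<Rightarrow> complex" where
  "smoothing f z = (LINT w|lborel. complex_of_real (b (fst w) * d (snd w)) * f (z - w))"

lemma integrable_profile: "integrable lborel (\<lambda>w. b (fst w) * d (snd w))"
proof -
  have "integrable lborel b" "integrable lborel d"
    using b_mass d_mass b_nonneg d_nonneg by (auto intro!: integrableI_nonneg)
  from integrable_tensor(1)[OF this] show ?thesis by (simp add: lborel_prod)
qed

lemma
  assumes f: "integrable lborel f"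
  shows integrable_smoothing: "integrable lborel (smoothing f)"
    and fourier_transform_smoothing: "fourier_transform (smoothing f) \<zeta>
      = (LINT w|lborel. complex_of_real (b (fst w) * d (snd w)) * cis (- (w \<bullet> \<zeta>))) * fourier_transform f \<zeta>"
proof -
  have [measurable]: "f \<in> borel_measurable borel" using f by simp
  define p where "p w = complex_of_real (b (fst w) * d (snd w))" for w
  have [measurable]: "p \<in> borel_measurable borel" unfolding p_def[abs_def] by measurable
  have p: "integrable lborel p" unfolding p_def[abs_def] by (intro integrable_of_real integrable_profile)
  have norm_diff: "integrable lborel (\<lambda>z. f (z - w))" "(LINT z|lborel. norm (f (z - w))) = (LINT z|lborel. norm (f z))" for w
  proof -
    show "integrable lborel (\<lambda>z. f (z - w))" using integrable_lborel_translate[OF f, of "- w"] by simp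
    show "(LINT z|lborel. norm (f (z - w))) = (LINT z|lborel. norm (f z))"
      using lborel_integral_translate[of "\<lambda>z. norm (f z)" "- w"] by simp
  qed
  have int: "integrable (lborel \<Otimes>\<^sub>M lborel) (\<lambda>x. c (snd x) * (p (fst x) * f (snd x - fst x)))"
    if c[measurable]: "c \<in> borel_measurable borel" and c1: "\<And>z. norm (c z) = 1" for c
  proof (rule lborel_pair.Fubini_integrable)
    show "integrable lborel (\<lambda>w. LINT z|lborel. norm (c (snd (w, z)) * (p (fst (w, z)) * f (snd (w, z) - fst (w, z)))))"
      using p by (simp add: norm_mult c1 norm_diff)
    have "integrable lborel (\<lambda>z. c z * (p w * f (z - w)))" for w
      by (rule Bochner_Integration.integrable_bound[OF integrable_mult_right[OF norm_diff(1), of "p w" w]])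
        (auto simp: norm_mult c1)
    thus "AE w in lborel. integrable lborel (\<lambda>z. c (snd (w, z)) * (p (fst (w, z)) * f (snd (w, z) - fst (w, z))))"
      by simp
  qed measurable
  have smoothing_eq: "smoothing f z = (LINT w|lborel. p w * f (z - w))" for z
    by (simp add: smoothing_def p_def)
  have "integrable lborel (\<lambda>z. LINT w|lborel. p w * f (z - w))"
    using lborel_pair.integrable_snd[of "\<lambda>w z. p w * f (z - w)"] int[of "\<lambda>z. 1"] by (simp add: split_beta')
  thus "integrable lborel (smoothing f)" by (simp add: smoothing_eq[abs_def])
  define c where "c z = cis (- (z \<bullet> \<zeta>))" for z :: "(real^'n) \<times> real"
  have [measurable]: "c \<in> borel_measurable borel" unfolding c_def[abs_def] by measurable
  have "fourier_transform (smoothing f) \<zeta> = (LINT z|lborel. LINT w|lborel. c z * (p w * f (z - w)))"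
    by (simp add: fourier_transform_cis smoothing_eq c_def)
  also have "\<dots> = (LINT w|lborel. LINT z|lborel. c z * (p w * f (z - w)))"
    using lborel_pair.Fubini_integral[of "\<lambda>w z. c z * (p w * f (z - w))"] int[of c]
    by (simp add: split_beta' c_def)
  also have "\<dots> = (LINT w|lborel. p w * c w * fourier_transform f \<zeta>)"
  proof (intro Bochner_Integration.integral_cong refl)
    fix w
    have "(LINT z|lborel. c z * (p w * f (z - w))) = (LINT z|lborel. p w * c w * (c (z - w) * f (z - w)))"
      by (intro Bochner_Integration.integral_cong) (auto simp: c_def cis_mult inner_diff_left algebra_simps)
    also have "\<dots> = p w * c w * (LINT z|lborel. c (z - w) * f (z - w))" by (rule integral_mult_right_zero)
    also have "(LINT z|lborel. c (z - w) * f (z - w)) = (LINT z|lborel. c z * f z)"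
      using lborel_integral_translate[of "\<lambda>z. c z * f z" "- w"] by simp
    finally show "(LINT z|lborel. c z * (p w * f (z - w))) = p w * c w * fourier_transform f \<zeta>"
      by (simp add: fourier_transform_cis c_def)
  qed
  also have "\<dots> = (LINT w|lborel. p w * c w) * fourier_transform f \<zeta>" by simp
  finally show "fourier_transform (smoothing f) \<zeta>
      = (LINT w|lborel. complex_of_real (b (fst w) * d (snd w)) * cis (- (w \<bullet> \<zeta>))) * fourier_transform f \<zeta>"
    by (simp add: p_def c_def)
qed

text \<open>The transform of a probability density is not small where the phase is: its real part
  averages cosines of angles at most 1, each at least 1/2 since 1 < \<pi> / 3. Smoothing multiplies
  the transform at \<open>\<zeta>\<close> by a number of modulus at least 1/2, and undoing it costs
  the factor 2.\<close>

lemma fourier_transform_le_smoothing: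
  assumes f: "integrable lborel f"
    and small: "\<And>w. b (fst w) * d (snd w) \<noteq> 0 \<Longrightarrow> \<bar>w \<bullet> \<zeta>\<bar> \<le> 1"
  shows "norm (fourier_transform f \<zeta>) \<le> 2 * norm (fourier_transform (smoothing f) \<zeta>)"
proof -
  define p where "p w = b (fst w) * d (snd w)" for w
  have p: "integrable lborel p" unfolding p_def[abs_def] by (rule integrable_profile)
  have p0: "0 \<le> p w" for w by (simp add: p_def b_nonneg d_nonneg)
  have mass: "(LINT w|lborel. p w) = 1"
  proof -
    have "integrable lborel b" "integrable lborel d"
      using b_mass d_mass b_nonneg d_nonneg by (auto intro!: integrableI_nonneg)
    moreover have "(LINT y|lborel. b y) = 1" "(LINT s|lborel. d s) = 1"
      using b_mass d_mass b_nonneg d_nonneg by (subst integral_eq_nn_integral; simp)+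
    ultimately show ?thesis
      using integrable_tensor(2)[of b d] by (simp add: p_def lborel_prod)
  qed
  have int: "integrable lborel (\<lambda>w. cis (- (w \<bullet> \<zeta>)) * complex_of_real (p w))"
    using p by (intro integrable_cis_mult) simp
  note int_Re = integrable_Re[OF int]
  have cos: "1 / 2 \<le> cos x" if "\<bar>x\<bar> \<le> 1" for x :: real
  proof -
    have "cos (pi / 3) \<le> cos \<bar>x\<bar>" using that pi_gt3 by (intro cos_monotone_0_pi_le) auto
    thus ?thesis by (simp add: cos_60)
  qed
  have "1 / 2 = (LINT w|lborel. 1 / 2 * p w)" by (simp add: mass)
  also have "\<dots> \<le> (LINT w|lborel. Re (cis (- (w \<bullet> \<zeta>)) * complex_of_real (p w)))"
  proof (rule integral_mono)
    show "1 / 2 * p w \<le> Re (cis (- (w \<bullet> \<zeta>)) * complex_of_real (p w))" for w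
    proof (cases "p w = 0")
      case False
      hence "1 / 2 \<le> cos (w \<bullet> \<zeta>)" using small[of w] cos by (simp add: p_def)
      from mult_right_mono[OF this p0[of w]] show ?thesis by simp
    qed simp
  qed (use p int_Re in auto)
  also have "\<dots> = Re (LINT w|lborel. cis (- (w \<bullet> \<zeta>)) * complex_of_real (p w))"
    using int by (rule integral_Re)
  also have "\<dots> \<le> norm (LINT w|lborel. cis (- (w \<bullet> \<zeta>)) * complex_of_real (p w))" by (rule complex_Re_le_cmod)
  finally have "1 / 2 \<le> norm (LINT w|lborel. complex_of_real (p w) * cis (- (w \<bullet> \<zeta>)))" by (simp add: mult.commute)
  from mult_right_mono[OF this, of "norm (fourier_transform f \<zeta>)"]
  show ?thesis unfolding fourier_transform_smoothing[OF f] p_def norm_mult by simp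
qed


section \<open>A spatial majorant of the smoothed function\<close>

definition height :: "real \<Rightarrow> ((real^'n) \<times> real \<Rightarrow> complex) \<Rightarrow> real^'n \<Rightarrow> real" where
  "height r f x = enn2real (time_integral r f x) powr (1 / r)"

text \<open>The convolution of \<open>b\<close> with the slice norms of \<open>f\<close>. It
  controls the smoothed function both pointwise and in the time norm on each slice.\<close>

definition majorant :: "real \<Rightarrow> ((real^'n) \<times> real \<Rightarrow> complex) \<Rightarrow> real^'n \<Rightarrow> ennreal" where
  "majorant r f x = (\<integral>\<^sup>+y. ennreal (b y) * ennreal (height r f (x - y)) \<partial>lborel)"

context
  fixes f :: "(real^'n) \<times> real \<Rightarrow> complex" and q r :: real
  assumes f_meas [measurable]: "f \<in> borel_measurable borel"
    and q: "1 \<le> q" and r: "1 \<le> r"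
    and finite_time: "\<And>x. time_integral r f x < \<infinity>"
    and null_time: "\<And>x t. time_integral r f x = 0 \<Longrightarrow> f (x, t) = 0"
    and mixed: "mixed_integral q r f \<le> 1"
begin

lemma height_nonneg: "0 \<le> height r f x"
  by (simp add: height_def)

lemma borel_measurable_height [measurable]: "height r f \<in> borel_measurable borel"
  unfolding height_def[abs_def] by measurable

lemma borel_measurable_majorant [measurable]: "majorant r f \<in> borel_measurable borel"
  unfolding majorant_def[abs_def] by measurable

lemma height_powr: "ennreal (height r f x powr r) = time_integral r f x"
  using r finite_time[of x] by (simp add: height_def powr_powr)

lemma height_powr': "ennreal (height r f x powr q) = ennpowr (time_integral r f x) (q / r)"
  using finite_time[of x] by (cases "time_integral r f x") (auto simp: height_def powr_powr ennpowr_ennreal)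

text \<open>The threshold is proportional to the slice norm, so both terms scale alike; by
  \<open>height_weight\<close> the second integrates in \<open>t\<close> to a multiple of the
  height. On slices of height 0 the weight takes the value \<open>0 powr (1 - r) = 0\<close>, and
  \<open>null_time\<close> makes the left side vanish.\<close>

lemma norm_le_height:
  assumes "0 < \<sigma>"
  shows "norm (f (x, t)) \<le> \<sigma> * height r f x + \<sigma> powr (1 - r) * (height r f x powr (1 - r) * norm (f (x, t)) powr r)"
proof (cases "height r f x = 0")
  case True
  hence "time_integral r f x = 0" using height_powr[of x] by simp
  thus ?thesis using null_time True by simp
next
  case False
  hence "0 < height r f x" using height_nonneg[of x] by simp
  thus ?thesis using le_add_powr[of "norm (f (x, t))" "\<sigma> * height r f x" r] assms r
    by (simp add: powr_mult mult.assoc)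
qed

lemma height_weight: "ennreal (height r f x powr (1 - r)) * time_integral r f x = ennreal (height r f x)"
proof (cases "height r f x = 0")
  case False
  hence "0 < height r f x" using height_nonneg[of x] by simp
  thus ?thesis unfolding height_powr[symmetric] by (simp flip: ennreal_mult powr_add)
qed simp

lemma nn_integral_height: "(\<integral>\<^sup>+x. ennreal (height r f x powr q) \<partial>lborel) \<le> 1"
  using mixed unfolding height_powr' mixed_integral_def .

text \<open>A height is at most 1 plus its \<open>q\<close>-th power. The total mass of
  \<open>b\<close> takes care of the 1, the upper bound \<open>binf\<close> of the power. This is
  the passage from integrability to boundedness for which smoothing was introduced.\<close>

lemma majorant_le: "majorant r f x \<le> ennreal (1 + binf)"
proof -
  have "majorant r f x \<le> (\<integral>\<^sup>+y. ennreal (b y) + ennreal binf * ennreal (height r f (x - y) powr q) \<partial>lborel)"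
    unfolding majorant_def
  proof (rule nn_integral_mono)
    fix y
    have "height r f (x - y) \<le> 1 + height r f (x - y) powr q"
      using le_add_powr[of "height r f (x - y)" 1 q] q height_nonneg by simp
    hence "b y * height r f (x - y) \<le> b y * (1 + height r f (x - y) powr q)"
      using b_nonneg by (intro mult_left_mono) auto
    also have "\<dots> \<le> b y + binf * height r f (x - y) powr q"
      using b_le by (simp add: distrib_left mult_right_mono)
    finally show "ennreal (b y) * ennreal (height r f (x - y)) \<le> ennreal (b y) + ennreal binf * ennreal (height r f (x - y) powr q)"
      using b_nonneg height_nonneg binf_nonneg by (simp flip: ennreal_mult ennreal_plus)
  qed
  also have "\<dots> = 1 + ennreal binf * (\<integral>\<^sup>+y. ennreal (height r f (x - y) powr q) \<partial>lborel)"
    by (simp add: nn_integral_add nn_integral_cmult b_mass)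
  also have "(\<integral>\<^sup>+y. ennreal (height r f (x - y) powr q) \<partial>lborel) = (\<integral>\<^sup>+y. ennreal (height r f y powr q) \<partial>lborel)"
    by (rule nn_integral_lborel_diff) measurable
  also have "1 + ennreal binf * (\<integral>\<^sup>+y. ennreal (height r f y powr q) \<partial>lborel) \<le> 1 + ennreal binf * 1"
    by (intro add_left_mono mult_left_mono nn_integral_height) auto
  also have "\<dots> = ennreal (1 + binf)" using binf_nonneg by simp
  finally show ?thesis .
qed

definition bound :: "real^'n \<Rightarrow> real" where
  "bound x = enn2real (majorant r f x)"

lemma ennreal_bound: "ennreal (bound x) = majorant r f x"
  unfolding bound_def using majorant_le[of x] by (intro ennreal_enn2real) (auto simp: less_top[symmetric] top_unique)

lemma bound_nonneg: "0 \<le> bound x"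
  by (simp add: bound_def)

lemma bound_le: "bound x \<le> 1 + binf"
  using majorant_le[of x] binf_nonneg unfolding ennreal_bound[symmetric] by (subst (asm) ennreal_le_iff) auto

lemma borel_measurable_bound [measurable]: "bound \<in> borel_measurable borel"
  unfolding bound_def[abs_def] by measurable

text \<open>Jensen's inequality at each point, with half the mean as threshold, reduces the claim to
  the mean of the \<open>q\<close>-th powers, whose integral follows from Tonelli and translation
  invariance. The factor \<open>2 powr q\<close> is the price of the halving.\<close>

lemma nn_integral_bound: "(\<integral>\<^sup>+x. ennreal (bound x powr q) \<partial>lborel) \<le> ennreal (2 powr q)"
proof -
  define V where "V x = (\<integral>\<^sup>+y. ennreal (b y) * ennreal (height r f (x - y) powr q) \<partial>lborel)" for x
  have [measurable]: "V \<in> borel_measurable borel" unfolding V_def[abs_def] by measurable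
  have "ennreal (bound x powr q) \<le> ennreal (2 powr q) * V x" for x
  proof (cases "bound x = 0 \<or> V x = top")
    case True
    thus ?thesis by (auto simp: ennreal_mult_top)
  next
    case False
    hence bp: "0 < bound x" using bound_nonneg[of x] by simp
    obtain v where v: "V x = ennreal v" "0 \<le> v" using False by (cases "V x") auto
    define l where "l = bound x / 2"
    have l: "0 < l" using bp by (simp add: l_def)
    have "majorant r f x \<le> (\<integral>\<^sup>+y. ennreal l * ennreal (b y) + ennreal (l powr (1 - q)) * (ennreal (b y) * ennreal (height r f (x - y) powr q)) \<partial>lborel)"
      unfolding majorant_def
    proof (rule nn_integral_mono)
      fix y
      have "b y * height r f (x - y) \<le> b y * (l + l powr (1 - q) * height r f (x - y) powr q)"
        using b_nonneg by (intro mult_left_mono le_add_powr l q height_nonneg)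
      thus "ennreal (b y) * ennreal (height r f (x - y)) \<le> ennreal l * ennreal (b y) + ennreal (l powr (1 - q)) * (ennreal (b y) * ennreal (height r f (x - y) powr q))"
        using b_nonneg height_nonneg l by (simp add: algebra_simps flip: ennreal_mult ennreal_plus)
    qed
    also have "\<dots> = ennreal l * 1 + ennreal (l powr (1 - q)) * V x"
      unfolding V_def b_mass[symmetric] by (simp add: nn_integral_add nn_integral_cmult)
    finally have "bound x \<le> l + l powr (1 - q) * v"
      using l v unfolding ennreal_bound[symmetric] by (simp flip: ennreal_mult ennreal_plus)
    hence "(bound x / 2) powr q \<le> 1 powr (q - 1) * v"
      using bp v by (intro powr_half_le_of_le) (simp_all add: l_def)
    hence "bound x powr q \<le> 2 powr q * v" using bp by (simp add: powr_divide field_simps)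
    thus ?thesis using v by (simp flip: ennreal_mult)
  qed
  hence "(\<integral>\<^sup>+x. ennreal (bound x powr q) \<partial>lborel) \<le> (\<integral>\<^sup>+x. ennreal (2 powr q) * V x \<partial>lborel)"
    by (intro nn_integral_mono)
  also have "\<dots> = ennreal (2 powr q) * (\<integral>\<^sup>+x. V x \<partial>lborel)" by (rule nn_integral_cmult) measurable
  also have "(\<integral>\<^sup>+x. V x \<partial>lborel) = (\<integral>\<^sup>+y. \<integral>\<^sup>+x. ennreal (b y) * ennreal (height r f (x - y) powr q) \<partial>lborel \<partial>lborel)"
    unfolding V_def by (intro lborel_pair.Fubini') measurable
  also have "\<dots> = (\<integral>\<^sup>+y. ennreal (b y) * (\<integral>\<^sup>+x. ennreal (height r f x powr q) \<partial>lborel) \<partial>lborel)"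
    using nn_integral_lborel_diff'[of "\<lambda>x. ennreal (height r f x powr q)"]
    by (intro nn_integral_cong) (simp add: nn_integral_cmult)
  also have "\<dots> = (\<integral>\<^sup>+x. ennreal (height r f x powr q) \<partial>lborel)"
    by (simp add: nn_integral_multc b_mass)
  also have "ennreal (2 powr q) * \<dots> \<le> ennreal (2 powr q) * 1"
    by (intro mult_left_mono nn_integral_height) auto
  finally show ?thesis by simp
qed

lemma norm_smoothing_le_nn_integral:
  "ennreal (norm (smoothing f (x, t))) \<le> (\<integral>\<^sup>+y. ennreal (b y) * (\<integral>\<^sup>+s. ennreal (d s) * ennreal (norm (f (x - y, t - s))) \<partial>lborel) \<partial>lborel)"
proof -
  \<comment> \<open>Where the integrand of the convolution is not integrable, the Bochner integral
    is 0, so the bound holds at every point.\<close>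
  have "ennreal (norm (smoothing f (x, t))) \<le> (\<integral>\<^sup>+w. ennreal (norm (complex_of_real (b (fst w) * d (snd w)) * f ((x, t) - w))) \<partial>lborel)"
    unfolding smoothing_def
    by (cases "integrable lborel (\<lambda>w. complex_of_real (b (fst w) * d (snd w)) * f ((x, t) - w))")
      (auto simp: integral_norm_bound_ennreal not_integrable_integral_eq)
  also have "\<dots> = (\<integral>\<^sup>+y. \<integral>\<^sup>+s. ennreal (norm (complex_of_real (b y * d s) * f (x - y, t - s))) \<partial>lborel \<partial>lborel)"
  proof -
    have [measurable]: "(\<lambda>w. (x, t) - w) \<in> borel \<rightarrow>\<^sub>M borel" by (intro borel_measurable_continuous_onI continuous_intros)
    show ?thesis by (subst nn_integral_lborel_pair) simp_all
  qed
  also have "\<dots> = (\<integral>\<^sup>+y. ennreal (b y) * (\<integral>\<^sup>+s. ennreal (d s) * ennreal (norm (f (x - y, t - s))) \<partial>lborel) \<partial>lborel)"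
    using b_nonneg d_nonneg
    by (intro nn_integral_cong) (simp add: norm_mult ennreal_mult mult.assoc nn_integral_cmult)
  finally show ?thesis .
qed

text \<open>\<open>norm_le_height\<close> with factor 1 bounds the average in time by
  \<open>1 + dinf\<close> times the height, and averaging the heights in space gives the
  majorant.\<close>

lemma norm_smoothing_le: "norm (smoothing f (x, t)) \<le> (1 + dinf) * bound x"
proof -
  have inner: "(\<integral>\<^sup>+s. ennreal (d s) * ennreal (norm (f (x', t - s))) \<partial>lborel) \<le> ennreal (1 + dinf) * ennreal (height r f x')" for x'
  proof -
    have "(\<integral>\<^sup>+s. ennreal (d s) * ennreal (norm (f (x', t - s))) \<partial>lborel) \<le>
      (\<integral>\<^sup>+s. ennreal (height r f x') * ennreal (d s) + ennreal dinf * (ennreal (height r f x' powr (1 - r)) * ennreal (norm (f (x', t - s)) powr r)) \<partial>lborel)"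
    proof (rule nn_integral_mono)
      fix s
      have "d s * norm (f (x', t - s)) \<le> d s * (1 * height r f x' + 1 powr (1 - r) * (height r f x' powr (1 - r) * norm (f (x', t - s)) powr r))"
        using d_nonneg by (intro mult_left_mono norm_le_height) auto
      also have "\<dots> \<le> height r f x' * d s + dinf * (height r f x' powr (1 - r) * norm (f (x', t - s)) powr r)"
        using mult_right_mono[OF d_le[of s], of "height r f x' powr (1 - r) * norm (f (x', t - s)) powr r"]
        by (simp add: distrib_left mult.commute[of "d s" "height r f x'"])
      finally show "ennreal (d s) * ennreal (norm (f (x', t - s))) \<le> ennreal (height r f x') * ennreal (d s) + ennreal dinf * (ennreal (height r f x' powr (1 - r)) * ennreal (norm (f (x', t - s)) powr r))"
        using d_nonneg dinf_nonneg height_nonneg by (simp flip: ennreal_mult ennreal_plus)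
    qed
    also have "\<dots> = ennreal (height r f x') * 1 + ennreal dinf * (ennreal (height r f x' powr (1 - r)) * (\<integral>\<^sup>+s. ennreal (norm (f (x', t - s)) powr r) \<partial>lborel))"
      by (simp add: nn_integral_add nn_integral_cmult d_mass)
    also have "(\<integral>\<^sup>+s. ennreal (norm (f (x', t - s)) powr r) \<partial>lborel) = time_integral r f x'"
      unfolding time_integral_def by (rule nn_integral_lborel_diff) measurable
    finally show ?thesis
      using dinf_nonneg height_nonneg[of x'] by (simp add: height_weight distrib_right flip: ennreal_mult ennreal_plus)
  qed
  have "ennreal (norm (smoothing f (x, t))) \<le> (\<integral>\<^sup>+y. ennreal (b y) * (ennreal (1 + dinf) * ennreal (height r f (x - y))) \<partial>lborel)"
    by (intro order_trans[OF norm_smoothing_le_nn_integral] nn_integral_mono mult_left_mono inner) auto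
  also have "\<dots> = ennreal (1 + dinf) * majorant r f x"
    unfolding majorant_def by (subst nn_integral_cmult[symmetric]) (auto simp: mult_ac)
  also have "\<dots> = ennreal ((1 + dinf) * bound x)"
    using dinf_nonneg bound_nonneg by (simp add: ennreal_bound[symmetric] ennreal_mult)
  finally show ?thesis using dinf_nonneg bound_nonneg by (subst (asm) ennreal_le_iff) auto
qed

text \<open>Minkowski's inequality for the average over \<open>x\<close>, by Jensen's inequality with weight \<open>height r f\<close>.\<close>

lemma time_integral_smoothing_le: "time_integral r (smoothing f) x \<le> ennreal (2 powr r * bound x powr r)"
proof -
  let ?w = "\<lambda>x' t s. ennreal (d s) * ennreal (height r f x' powr (1 - r) * norm (f (x', t - s)) powr r)"
  let ?W = "\<lambda>x' t. \<integral>\<^sup>+s. ?w x' t s \<partial>lborel"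
  define V where "V t = (\<integral>\<^sup>+y. ennreal (b y) * ?W (x - y) t \<partial>lborel)" for t
  have [measurable]: "V \<in> borel_measurable borel" unfolding V_def[abs_def] by measurable
  have "ennreal (norm (smoothing f (x, t)) powr r) \<le> ennreal (2 powr r * bound x powr (r - 1)) * V t" for t
  proof (cases "smoothing f (x, t) = 0")
    case False
    define g where "g = norm (smoothing f (x, t))"
    have g: "0 < g" using False by (simp add: g_def)
    have "0 < (1 + dinf) * bound x" using g norm_smoothing_le[of x t] unfolding g_def by linarith
    hence bp: "0 < bound x" using dinf_nonneg bound_nonneg[of x] by (simp add: zero_less_mult_iff)
    show ?thesis
    proof (cases "V t")
      case top
      thus ?thesis using bp by (simp add: ennreal_mult_top)
    next
      case (real v)
      \<comment> \<open>Makes the first term \<open>g / 2\<close> once the heights are averaged to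
        \<open>bound x\<close>, as \<open>powr_half_le_of_le\<close> requires.\<close>
      define \<sigma> where "\<sigma> = g / (2 * bound x)"
      have \<sigma>: "0 < \<sigma>" using g bp by (simp add: \<sigma>_def)
      have inner: "(\<integral>\<^sup>+s. ennreal (d s) * ennreal (norm (f (x', t - s))) \<partial>lborel) \<le>
        ennreal \<sigma> * ennreal (height r f x') + ennreal (\<sigma> powr (1 - r)) * ?W x' t" for x'
      proof -
        have "(\<integral>\<^sup>+s. ennreal (d s) * ennreal (norm (f (x', t - s))) \<partial>lborel) \<le>
          (\<integral>\<^sup>+s. ennreal \<sigma> * ennreal (height r f x') * ennreal (d s) + ennreal (\<sigma> powr (1 - r)) * (?w x' t s) \<partial>lborel)"
        proof (rule nn_integral_mono)
          fix s
          have "d s * norm (f (x', t - s)) \<le> d s * (\<sigma> * height r f x' + \<sigma> powr (1 - r) * (height r f x' powr (1 - r) * norm (f (x', t - s)) powr r))"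
            using d_nonneg \<sigma> by (intro mult_left_mono norm_le_height) auto
          thus "ennreal (d s) * ennreal (norm (f (x', t - s))) \<le> ennreal \<sigma> * ennreal (height r f x') * ennreal (d s) + ennreal (\<sigma> powr (1 - r)) * (?w x' t s)"
            using d_nonneg \<sigma> height_nonneg by (simp add: algebra_simps flip: ennreal_mult ennreal_plus)
        qed
        also have "\<dots> = ennreal \<sigma> * ennreal (height r f x') * 1 + ennreal (\<sigma> powr (1 - r)) * ?W x' t"
          unfolding d_mass[symmetric] by (simp add: nn_integral_add nn_integral_cmult)
        finally show ?thesis by simp
      qed
      have "ennreal g \<le> (\<integral>\<^sup>+y. ennreal (b y) * (ennreal \<sigma> * ennreal (height r f (x - y)) + ennreal (\<sigma> powr (1 - r)) * ?W (x - y) t) \<partial>lborel)"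
        unfolding g_def
        by (intro order_trans[OF norm_smoothing_le_nn_integral] nn_integral_mono mult_left_mono inner) auto
      also have "\<dots> = (\<integral>\<^sup>+y. ennreal \<sigma> * (ennreal (b y) * ennreal (height r f (x - y))) + ennreal (\<sigma> powr (1 - r)) * (ennreal (b y) * ?W (x - y) t) \<partial>lborel)"
        by (intro nn_integral_cong) (simp add: distrib_left mult_ac)
      also have "\<dots> = ennreal \<sigma> * majorant r f x + ennreal (\<sigma> powr (1 - r)) * V t"
        unfolding majorant_def V_def by (simp add: nn_integral_add nn_integral_cmult)
      also have "\<dots> = ennreal (\<sigma> * bound x + \<sigma> powr (1 - r) * v)"
        using \<sigma> bound_nonneg[of x] real by (simp add: ennreal_bound[symmetric] flip: ennreal_mult ennreal_plus)
      finally have "g \<le> \<sigma> * bound x + \<sigma> powr (1 - r) * v"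
        using \<sigma> bound_nonneg[of x] real by (subst (asm) ennreal_le_iff) auto
      moreover have "\<sigma> * bound x = g / 2" using bp by (simp add: \<sigma>_def)
      ultimately have "(g / 2) powr r \<le> bound x powr (r - 1) * v"
        using g bp real by (intro powr_half_le_of_le) (simp_all add: \<sigma>_def)
      hence "g powr r \<le> 2 powr r * bound x powr (r - 1) * v" using g by (simp add: powr_divide field_simps)
      thus ?thesis using real by (simp add: g_def flip: ennreal_mult)
    qed
  qed simp
  hence "time_integral r (smoothing f) x \<le> (\<integral>\<^sup>+t. ennreal (2 powr r * bound x powr (r - 1)) * V t \<partial>lborel)"
    unfolding time_integral_def by (intro nn_integral_mono)
  also have "\<dots> = ennreal (2 powr r * bound x powr (r - 1)) * (\<integral>\<^sup>+t. V t \<partial>lborel)"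
    by (rule nn_integral_cmult) measurable
  also have "(\<integral>\<^sup>+t. V t \<partial>lborel) = (\<integral>\<^sup>+y. \<integral>\<^sup>+t. ennreal (b y) * ?W (x - y) t \<partial>lborel \<partial>lborel)"
    unfolding V_def by (intro lborel_pair.Fubini') measurable
  also have "\<dots> = (\<integral>\<^sup>+y. ennreal (b y) * ennreal (height r f (x - y)) \<partial>lborel)"
  proof (rule nn_integral_cong)
    fix y
    define x' where "x' = x - y"
    have "(\<integral>\<^sup>+t. ennreal (b y) * ?W x' t \<partial>lborel)
      = ennreal (b y) * (\<integral>\<^sup>+t. \<integral>\<^sup>+s. ?w x' t s \<partial>lborel \<partial>lborel)"
      by (intro nn_integral_cmult) measurable
    also have "(\<integral>\<^sup>+t. \<integral>\<^sup>+s. ?w x' t s \<partial>lborel \<partial>lborel)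
      = (\<integral>\<^sup>+s. \<integral>\<^sup>+t. ?w x' t s \<partial>lborel \<partial>lborel)"
      by (intro lborel_pair.Fubini') measurable
    also have "\<dots> = (\<integral>\<^sup>+s. ennreal (d s) * ennreal (height r f x') \<partial>lborel)"
    proof (rule nn_integral_cong)
      fix s
      have "(\<integral>\<^sup>+t. ?w x' t s \<partial>lborel)
        = ennreal (d s) * (ennreal (height r f x' powr (1 - r)) * (\<integral>\<^sup>+t. ennreal (norm (f (x', t - s)) powr r) \<partial>lborel))"
        by (simp add: ennreal_mult nn_integral_cmult)
      also have "(\<integral>\<^sup>+t. ennreal (norm (f (x', t - s)) powr r) \<partial>lborel) = time_integral r f x'"
        unfolding time_integral_def by (rule nn_integral_lborel_diff') measurable
      finally show "(\<integral>\<^sup>+t. ?w x' t s \<partial>lborel) = ennreal (d s) * ennreal (height r f x')"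
        by (simp add: height_weight)
    qed
    also have "\<dots> = ennreal (height r f x')" by (simp add: nn_integral_multc d_mass)
    finally show "(\<integral>\<^sup>+t. ennreal (b y) * ?W (x - y) t \<partial>lborel) = ennreal (b y) * ennreal (height r f (x - y))"
      by (simp add: x'_def)
  qed
  also have "\<dots> = ennreal (bound x)" by (simp add: ennreal_bound majorant_def)
  also have "ennreal (2 powr r * bound x powr (r - 1)) * ennreal (bound x) = ennreal (2 powr r * bound x powr r)"
  proof (cases "bound x = 0")
    case False
    hence "0 < bound x" using bound_nonneg[of x] by simp
    thus ?thesis by (simp add: powr_diff flip: ennreal_mult)
  qed simp
  finally show ?thesis .
qed

end

end

section \<open>Decomposition into level sets\<close>

text \<open>Half-open dyadic ranges keep the levels disjoint, so a partial sum is \<open>u\<close>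
  restricted to the set where its modulus exceeds \<open>c / 2 ^ N\<close>. Zeros of
  \<open>u\<close> contribute nothing.\<close>

definition level :: "real \<Rightarrow> ('a \<Rightarrow> complex) \<Rightarrow> nat \<Rightarrow> 'a \<Rightarrow> complex" where
  "level c u k z = (if c / 2 ^ Suc k < norm (u z) \<and> norm (u z) \<le> c / 2 ^ k then u z else 0)"

lemma borel_measurable_level [measurable]:
  assumes [measurable]: "u \<in> borel_measurable M"
  shows "level c u k \<in> borel_measurable M"
  unfolding level_def[abs_def] by measurable

lemma norm_level_le: "norm (level c u k z) \<le> norm (u z)"
  by (simp add: level_def)

lemma sum_levels:
  assumes "norm (u z) \<le> c" "0 \<le> c"
  shows "(\<Sum>k<N. level c u k z) = (if c / 2 ^ N < norm (u z) then u z else 0)"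
proof (induction N)
  case (Suc N)
  have "c / 2 ^ Suc N \<le> c / 2 ^ N" using assms(2) by (intro divide_left_mono) auto
  thus ?case using Suc by (auto simp: level_def)
qed (use assms in auto)

text \<open>Cauchy-Schwarz with weights \<open>x ^ k\<close>: part of a geometric decay is traded
  for moving the square inside the sum.\<close>

lemma sum_sq_le_weighted:
  fixes c :: "nat \<Rightarrow> real"
  assumes x: "0 < x" "x < 1"
  shows "(\<Sum>k<N. c k)\<^sup>2 \<le> (\<Sum>k<N. (c k)\<^sup>2 / x ^ k) / (1 - x)"
proof -
  have "(\<Sum>k<N. c k)\<^sup>2 = (\<Sum>k<N. sqrt (x ^ k) * (c k / sqrt (x ^ k)))\<^sup>2" using x by simp
  also have "\<dots> \<le> (\<Sum>k<N. (sqrt (x ^ k))\<^sup>2) * (\<Sum>k<N. (c k / sqrt (x ^ k))\<^sup>2)"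
    by (rule Cauchy_Schwarz_ineq_sum)
  also have "\<dots> = (\<Sum>k<N. x ^ k) * (\<Sum>k<N. (c k)\<^sup>2 / x ^ k)" using x by (simp add: power_divide)
  also have "\<dots> \<le> (1 / (1 - x)) * (\<Sum>k<N. (c k)\<^sup>2 / x ^ k)"
  proof (intro mult_right_mono sum_nonneg)
    show "(\<Sum>k<N. x ^ k) \<le> 1 / (1 - x)"
      using x by (simp add: sum_gp_strict divide_right_mono)
  qed (use x in auto)
  finally show ?thesis by simp
qed

lemma norm_fourier_transform_le:
  assumes "integrable lborel f"
  shows "norm (fourier_transform f \<zeta>) \<le> (LINT z|lborel. norm (f z))"
  unfolding fourier_transform_cis
  by (rule order_trans[OF integral_norm_bound]) (simp add: norm_mult)

text \<open>The assumed decay has twice the rate of the weight, so a factor \<open>x ^ k\<close>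
  survives in \<open>sum_sq_le_weighted\<close>; one factor \<open>1 / (1 - x)\<close> comes from
  that inequality and one from the remaining series. The passage to \<open>u\<close> uses dominated
  convergence twice, for the transform at each frequency and then for the energy, where the L1 norm
  of \<open>u\<close> is a uniform bound.\<close>

lemma fourier_sq_integral_levels:
  fixes u :: "(real^'n::finite) \<times> real \<Rightarrow> complex"
  assumes u: "integrable lborel u" and D: "D \<in> sets borel" "emeasure lborel D < \<infinity>"
    and \<Phi>: "\<Phi> \<in> borel_measurable borel"
    and c: "0 \<le> c" "\<And>z. norm (u z) \<le> c" and x: "0 < x" "x < 1" and B: "0 \<le> B"
    and le: "\<And>k. (fourier_energy \<Phi> D (level c u k)) \<le> B * x ^ (2 * k)"
  shows "(fourier_energy \<Phi> D u) \<le> B / (1 - x)\<^sup>2"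
proof -
  have [measurable]: "u \<in> borel_measurable borel" using u by simp
  define v where "v N z = (\<Sum>k<N. level c u k z)" for N z
  have v_eq: "v N z = (if c / 2 ^ N < norm (u z) then u z else 0)" for N z
    unfolding v_def using c by (intro sum_levels) auto
  have level_int: "integrable lborel (level c u k)" for k
    using u by (rule Bochner_Integration.integrable_bound) (auto simp: norm_level_le)
  have v_int: "integrable lborel (v N)" for N
    unfolding v_def[abs_def] by (intro Bochner_Integration.integrable_sum level_int)
  define L where "L = (LINT z|lborel. norm (u z))"
  have sq_meas: "(\<lambda>\<xi>. indicator D \<xi> *\<^sub>R (norm (fourier_transform g (\<xi>, \<Phi> \<xi>)))\<^sup>2) \<in> borel_measurable lborel"
    if "integrable lborel g" for g
    using set_integrable_fourier_sq[OF that D \<Phi>] by (simp add: set_integrable_def)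
  have ft_v: "fourier_transform (v N) \<zeta> = (\<Sum>k<N. fourier_transform (level c u k) \<zeta>)" for N \<zeta>
  proof -
    have "fourier_transform (v N) \<zeta> = (LINT z|lborel. (\<Sum>k<N. cis (- (z \<bullet> \<zeta>)) * level c u k z))"
      by (simp add: fourier_transform_cis v_def sum_distrib_left)
    also have "\<dots> = (\<Sum>k<N. fourier_transform (level c u k) \<zeta>)"
      unfolding fourier_transform_cis by (intro Bochner_Integration.integral_sum integrable_cis_mult level_int)
    finally show ?thesis .
  qed
  have partial: "(fourier_energy \<Phi> D (v N)) \<le> B / (1 - x)\<^sup>2" for N
  proof -
    define q where "q k \<xi> = (norm (fourier_transform (level c u k) (\<xi>, \<Phi> \<xi>)))\<^sup>2" for k \<xi>
    have q_int: "integrable lborel (\<lambda>\<xi>. indicator D \<xi> *\<^sub>R q k \<xi>)" for k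
      using set_integrable_fourier_sq[OF level_int D \<Phi>, of k] by (simp add: set_integrable_def q_def)
    have "(fourier_energy \<Phi> D (v N)) \<le>
        (LINT \<xi>|lborel. (\<Sum>k<N. (indicator D \<xi> *\<^sub>R q k \<xi>) / x ^ k) / (1 - x))"
      unfolding set_lebesgue_integral_def
    proof (rule integral_mono)
      show "integrable lborel (\<lambda>\<xi>. indicator D \<xi> *\<^sub>R (norm (fourier_transform (v N) (\<xi>, \<Phi> \<xi>)))\<^sup>2)"
        using set_integrable_fourier_sq[OF v_int D \<Phi>, of N] by (simp add: set_integrable_def)
      show "integrable lborel (\<lambda>\<xi>. (\<Sum>k<N. (indicator D \<xi> *\<^sub>R q k \<xi>) / x ^ k) / (1 - x))"
        by (intro integrable_divide_zero Bochner_Integration.integrable_sum) (use q_int in simp)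
      fix \<xi>
      have "norm (fourier_transform (v N) (\<xi>, \<Phi> \<xi>)) \<le> (\<Sum>k<N. norm (fourier_transform (level c u k) (\<xi>, \<Phi> \<xi>)))"
        unfolding ft_v by (rule norm_sum)
      hence "(norm (fourier_transform (v N) (\<xi>, \<Phi> \<xi>)))\<^sup>2 \<le> (\<Sum>k<N. norm (fourier_transform (level c u k) (\<xi>, \<Phi> \<xi>)))\<^sup>2"
        by (intro power_mono) auto
      also have "\<dots> \<le> (\<Sum>k<N. q k \<xi> / x ^ k) / (1 - x)"
        unfolding q_def by (rule sum_sq_le_weighted[OF x])
      finally show "indicator D \<xi> *\<^sub>R (norm (fourier_transform (v N) (\<xi>, \<Phi> \<xi>)))\<^sup>2 \<le> (\<Sum>k<N. (indicator D \<xi> *\<^sub>R q k \<xi>) / x ^ k) / (1 - x)"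
        by (cases "\<xi> \<in> D") auto
    qed
    also have "\<dots> = (\<Sum>k<N. (LINT \<xi>:D|lborel. q k \<xi>) / x ^ k) / (1 - x)"
      using q_int unfolding set_lebesgue_integral_def by (simp add: Bochner_Integration.integral_sum)
    also have "\<dots> \<le> (\<Sum>k<N. B * x ^ (2 * k) / x ^ k) / (1 - x)"
      using le x unfolding q_def by (intro divide_right_mono sum_mono) auto
    also have "(\<Sum>k<N. B * x ^ (2 * k) / x ^ k) = B * (\<Sum>k<N. x ^ k)"
      using x by (simp add: sum_distrib_left mult_2 power_add)
    also have "B * (\<Sum>k<N. x ^ k) / (1 - x) \<le> B * (1 / (1 - x)) / (1 - x)"
    proof (intro divide_right_mono mult_left_mono B)
      show "(\<Sum>k<N. x ^ k) \<le> 1 / (1 - x)"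
        using x by (simp add: sum_gp_strict divide_right_mono)
    qed (use x in auto)
    finally show ?thesis by (simp add: power2_eq_square)
  qed
  have ft_lim: "(\<lambda>N. fourier_transform (v N) \<zeta>) \<longlonglongrightarrow> fourier_transform u \<zeta>" for \<zeta>
    unfolding fourier_transform_cis
  proof (rule integral_dominated_convergence[where w = "\<lambda>z. norm (u z)"])
    show "(\<lambda>z. cis (- (z \<bullet> \<zeta>)) * v N z) \<in> borel_measurable lborel" for N
      using integrable_cis_mult[OF v_int] by (rule borel_measurable_integrable)
    show "(\<lambda>z. cis (- (z \<bullet> \<zeta>)) * u z) \<in> borel_measurable lborel"
      using integrable_cis_mult[OF u] by (rule borel_measurable_integrable)
    show "AE z in lborel. (\<lambda>N. cis (- (z \<bullet> \<zeta>)) * v N z) \<longlonglongrightarrow> cis (- (z \<bullet> \<zeta>)) * u z"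
    proof (rule AE_I2)
      fix z
      have "(\<lambda>N. v N z) \<longlonglongrightarrow> u z"
      proof (cases "u z = 0")
        case False
        have "(\<lambda>N. c * (1 / 2) ^ N) \<longlonglongrightarrow> c * 0" by (intro tendsto_intros LIMSEQ_power_zero) auto
        hence "(\<lambda>N. c / 2 ^ N) \<longlonglongrightarrow> 0" by (simp add: power_divide)
        hence "eventually (\<lambda>N. c / 2 ^ N < norm (u z)) sequentially"
          using False by (intro order_tendstoD(2)[of _ 0]) auto
        hence "eventually (\<lambda>N. v N z = u z) sequentially" by eventually_elim (simp add: v_eq)
        thus ?thesis by (rule tendsto_eventually)
      qed (simp add: v_eq cong: if_cong)
      thus "(\<lambda>N. cis (- (z \<bullet> \<zeta>)) * v N z) \<longlonglongrightarrow> cis (- (z \<bullet> \<zeta>)) * u z" by (intro tendsto_intros)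
    qed
    show "AE z in lborel. norm (cis (- (z \<bullet> \<zeta>)) * v N z) \<le> norm (u z)" for N
      by (auto simp: norm_mult v_eq)
  qed (use u in auto)
  have "(\<lambda>N. LINT \<xi>:D|lborel. (norm (fourier_transform (v N) (\<xi>, \<Phi> \<xi>)))\<^sup>2) \<longlonglongrightarrow>
      (fourier_energy \<Phi> D u)"
    unfolding set_lebesgue_integral_def
  proof (rule integral_dominated_convergence[where w = "\<lambda>\<xi>. indicator D \<xi> * L\<^sup>2"])
    show "integrable lborel (\<lambda>\<xi>. indicator D \<xi> * L\<^sup>2)" using D by simp
    show "AE \<xi> in lborel. (\<lambda>N. indicator D \<xi> *\<^sub>R (norm (fourier_transform (v N) (\<xi>, \<Phi> \<xi>)))\<^sup>2) \<longlonglongrightarrow> indicator D \<xi> *\<^sub>R (norm (fourier_transform u (\<xi>, \<Phi> \<xi>)))\<^sup>2"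
      by (intro AE_I2 tendsto_intros ft_lim)
    show "AE \<xi> in lborel. norm (indicator D \<xi> *\<^sub>R (norm (fourier_transform (v N) (\<xi>, \<Phi> \<xi>)))\<^sup>2) \<le> indicator D \<xi> * L\<^sup>2" for N
    proof (rule AE_I2)
      fix \<xi>
      have "norm (fourier_transform (v N) (\<xi>, \<Phi> \<xi>)) \<le> (LINT z|lborel. norm (v N z))"
        by (rule norm_fourier_transform_le[OF v_int])
      also have "\<dots> \<le> L" unfolding L_def by (intro integral_mono integrable_norm v_int u) (simp add: v_eq)
      finally have "(norm (fourier_transform (v N) (\<xi>, \<Phi> \<xi>)))\<^sup>2 \<le> L\<^sup>2" by (intro power_mono) auto
      thus "norm (indicator D \<xi> *\<^sub>R (norm (fourier_transform (v N) (\<xi>, \<Phi> \<xi>)))\<^sup>2) \<le> indicator D \<xi> * L\<^sup>2"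
        by (auto simp: indicator_def)
    qed
  qed (use sq_meas[OF u] sq_meas[OF v_int] in auto)
  thus ?thesis using partial by (intro LIMSEQ_le_const2) auto
qed

text \<open>The exponent that can be spared for decay in the level number. The first bound keeps at
  least the power \<open>r\<close> of the modulus available in time, the second at least the power
  \<open>q\<close> of the majorant available in space.\<close>

definition gain :: "real \<Rightarrow> real \<Rightarrow> real \<Rightarrow> real \<Rightarrow> real" where
  "gain q r q0 r0 = min (r0 - r) ((q0 - q) * r0 / q0)"

lemma gain:
  assumes q: "1 \<le> q" "q < q0" and r: "1 \<le> r" "r < r0" "r0 \<le> 2"
  shows "0 < gain q r q0 r0" "gain q r q0 r0 \<le> r0 - r" "gain q r q0 r0 \<le> 1" "gain q r q0 r0 * q0 / r0 \<le> q0 - q"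
proof -
  show "0 < gain q r q0 r0" using q r by (simp add: gain_def)
  show "gain q r q0 r0 \<le> r0 - r" by (simp add: gain_def)
  thus "gain q r q0 r0 \<le> 1" using r by linarith
  have "gain q r q0 r0 \<le> (q0 - q) * r0 / q0" by (simp add: gain_def)
  hence "gain q r q0 r0 * q0 \<le> (q0 - q) * r0" using q by (simp add: field_simps)
  thus "gain q r q0 r0 * q0 / r0 \<le> q0 - q" using r by (simp add: divide_le_eq)
qed

section \<open>Norms of a single level\<close>

context
  fixes u :: "(real^'n::finite) \<times> real \<Rightarrow> complex" and h :: "real^'n \<Rightarrow> real" and C q r q0 r0 :: real
  assumes u_meas [measurable]: "u \<in> borel_measurable borel" and h_meas [measurable]: "h \<in> borel_measurable borel"
    and C: "1 \<le> C" and h: "\<And>x. 0 \<le> h x" "\<And>x. h x \<le> C"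
    and u_le: "\<And>x t. norm (u (x, t)) \<le> C * h x"
    and u_time: "\<And>x. time_integral r u x \<le> ennreal (C * h x powr r)"
    and h_int: "(\<integral>\<^sup>+x. ennreal (h x powr q) \<partial>lborel) \<le> ennreal C"
    and q: "1 \<le> q" "q < q0" "q0 \<le> 2" and r: "1 \<le> r" "r < r0" "r0 \<le> 2"
begin

lemma norm_le_C_sq: "norm (u z) \<le> C\<^sup>2"
proof -
  obtain x t where "z = (x, t)" by (cases z)
  moreover have "C * h x \<le> C * C" using C h by (intro mult_left_mono) auto
  ultimately show ?thesis using u_le[of x t] by (simp add: power2_eq_square)
qed

text \<open>On level \<open>k\<close> the modulus exceeds \<open>a\<close>, so it is at most
  \<open>a powr (1 - r)\<close> times its \<open>r\<close>-th power, a factor of at most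
  \<open>P\<close>. Since \<open>u\<close> is dominated by \<open>C * h\<close>, slices that meet
  the level have \<open>h\<close> above \<open>C / P\<close>, and passing from
  \<open>h powr r\<close> to \<open>h powr q\<close> costs at most \<open>C * P\<close>. The two
  factors \<open>P\<close> give the power of 4.\<close>

lemma integral_norm_level_le:
  assumes "integrable lborel u"
  shows "(LINT z|lborel. norm (level (C\<^sup>2) u k z)) \<le> C ^ 3 * 4 ^ Suc k"
proof -
  define a where "a = C\<^sup>2 / 2 ^ Suc k"
  define P where "P = (2 :: real) ^ Suc k"
  have P: "1 \<le> P" unfolding P_def by (rule one_le_power) simp
  have a: "0 < a" using C by (simp add: a_def)
  have a_eq: "a = C * (C / P)" by (simp add: a_def P_def power2_eq_square)
  have apow: "a powr (1 - r) \<le> P"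
  proof -
    have "1 / P \<le> C\<^sup>2 / P" using C P by (intro divide_right_mono) auto
    hence "a powr (1 - r) \<le> (1 / P) powr (1 - r)" using a P r by (intro powr_mono2') (auto simp: a_def P_def)
    also have "\<dots> = P powr (r - 1)" using P by (simp add: powr_divide powr_minus_divide[symmetric])
    also have "\<dots> \<le> P powr 1" using P r by (intro powr_mono) auto
    finally show ?thesis using P by simp
  qed
  have slice: "(\<integral>\<^sup>+t. ennreal (norm (level (C\<^sup>2) u k (x, t))) \<partial>lborel) \<le> ennreal (C\<^sup>2 * P\<^sup>2) * ennreal (h x powr q)" for x
  proof (cases "C / P < h x")
    case False
    have "C * h x \<le> a" using False C unfolding a_eq by (intro mult_left_mono) auto
    hence "\<not> a < norm (u (x, t))" for t using u_le[of x t] by (meson dual_order.trans not_le)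
    hence "level (C\<^sup>2) u k (x, t) = 0" for t by (simp add: level_def a_def)
    thus ?thesis by simp
  next
    case True
    have CP: "0 < C / P" using C P by simp
    have hx: "0 < h x" using True CP by linarith
    have "(\<integral>\<^sup>+t. ennreal (norm (level (C\<^sup>2) u k (x, t))) \<partial>lborel) \<le> (\<integral>\<^sup>+t. ennreal P * ennreal (norm (u (x, t)) powr r) \<partial>lborel)"
    proof (rule nn_integral_mono)
      fix t
      show "ennreal (norm (level (C\<^sup>2) u k (x, t))) \<le> ennreal P * ennreal (norm (u (x, t)) powr r)"
      proof (cases "level (C\<^sup>2) u k (x, t) = 0")
        case False
        hence *: "a < norm (u (x, t))" "level (C\<^sup>2) u k (x, t) = u (x, t)"
          by (auto simp: level_def a_def split: if_splits)
        have "norm (u (x, t)) = norm (u (x, t)) powr (1 - r) * norm (u (x, t)) powr r"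
          using a * by (simp flip: powr_add)
        also have "\<dots> \<le> a powr (1 - r) * norm (u (x, t)) powr r"
          using a * r by (intro mult_right_mono powr_mono2') auto
        also have "\<dots> \<le> P * norm (u (x, t)) powr r" using apow by (intro mult_right_mono) auto
        finally show ?thesis using * P by (simp flip: ennreal_mult)
      qed simp
    qed
    also have "\<dots> = ennreal P * time_integral r u x"
      unfolding time_integral_def by (intro nn_integral_cmult) measurable
    also have "\<dots> \<le> ennreal P * ennreal (C * h x powr r)" by (intro mult_left_mono u_time) auto
    also have "\<dots> \<le> ennreal (C\<^sup>2 * P\<^sup>2) * ennreal (h x powr q)"
    proof -
      \<comment> \<open>A nonnegative exponent is handled by the upper bound on \<open>h\<close>, a
        negative one by the lower bound that this slice provides.\<close>
      have "h x powr (r - q) \<le> C * P"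
      proof (cases "q \<le> r")
        case True
        have "h x powr (r - q) \<le> C powr (r - q)" using h True by (intro powr_mono2) auto
        also have "\<dots> \<le> C powr 1" using C q r True by (intro powr_mono) auto
        also have "\<dots> \<le> C * P" using C P by simp
        finally show ?thesis .
      next
        case False
        have "h x powr (r - q) \<le> (C / P) powr (r - q)" using True CP False by (intro powr_mono2') auto
        also have "\<dots> \<le> (1 / P) powr (r - q)" using C P False by (intro powr_mono2' divide_right_mono) auto
        also have "\<dots> = P powr (q - r)" using P by (simp add: powr_divide powr_minus_divide[symmetric])
        also have "\<dots> \<le> P powr 1" using P q r by (intro powr_mono) auto
        also have "\<dots> \<le> C * P" using C P by simp
        finally show ?thesis .
      qed
      hence "P * (C * (h x powr (r - q) * h x powr q)) \<le> P * (C * (C * P * h x powr q))"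
        using C P by (intro mult_left_mono mult_right_mono) auto
      hence "P * (C * h x powr r) \<le> C\<^sup>2 * P\<^sup>2 * h x powr q"
        using hx by (simp add: power2_eq_square mult_ac flip: powr_add)
      thus ?thesis using P C by (simp flip: ennreal_mult)
    qed
    finally show ?thesis .
  qed
  have level_int: "integrable lborel (level (C\<^sup>2) u k)"
    using assms by (rule Bochner_Integration.integrable_bound) (auto simp: norm_level_le)
  have "ennreal (LINT z|lborel. norm (level (C\<^sup>2) u k z)) = (\<integral>\<^sup>+z. ennreal (norm (level (C\<^sup>2) u k z)) \<partial>lborel)"
    using level_int by (intro nn_integral_eq_integral[symmetric]) auto
  also have "\<dots> = (\<integral>\<^sup>+x. \<integral>\<^sup>+t. ennreal (norm (level (C\<^sup>2) u k (x, t))) \<partial>lborel \<partial>lborel)"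
    by (intro nn_integral_lborel_pair) measurable
  also have "\<dots> \<le> (\<integral>\<^sup>+x. ennreal (C\<^sup>2 * P\<^sup>2) * ennreal (h x powr q) \<partial>lborel)"
    by (intro nn_integral_mono slice)
  also have "\<dots> = ennreal (C\<^sup>2 * P\<^sup>2) * (\<integral>\<^sup>+x. ennreal (h x powr q) \<partial>lborel)"
    by (intro nn_integral_cmult) measurable
  also have "\<dots> \<le> ennreal (C\<^sup>2 * P\<^sup>2) * ennreal C" by (intro mult_left_mono h_int) auto
  also have "\<dots> = ennreal (C ^ 3 * P\<^sup>2)"
    using C by (simp add: power2_eq_square power3_eq_cube mult_ac flip: ennreal_mult)
  finally have "(LINT z|lborel. norm (level (C\<^sup>2) u k z)) \<le> C ^ 3 * P\<^sup>2"
    using C by (subst (asm) ennreal_le_iff) auto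
  also have "P\<^sup>2 = 4 ^ Suc k" unfolding P_def by (simp add: power2_eq_square flip: power_mult_distrib)
  finally show ?thesis .
qed

text \<open>The power \<open>r0\<close> is split into \<open>\<gamma>\<close>,
  \<open>r0 - r - \<gamma>\<close> and \<open>r\<close>. The upper threshold of the level bounds the
  first part and produces the decay, the majorant \<open>C * h\<close> bounds the second, and the
  time integral of \<open>u\<close> absorbs the third. In space the resulting power of
  \<open>h\<close> is at least \<open>q\<close>, and the excess is paid with
  \<open>h x \<le> C\<close>.\<close>

lemma mixed_norm_level_le:
  "mixed_norm q0 r0 (level (C\<^sup>2) u k) \<le> ennreal (C ^ 8 * 2 powr (- (gain q r q0 r0 / r0) * k))"
proof -
  define \<gamma> where "\<gamma> = gain q r q0 r0"
  note \<gamma> = gain[OF q(1,2) r, folded \<gamma>_def]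
  define a where "a = C\<^sup>2 * 2 powr (- real k)"
  have a: "0 < a" using C by (simp add: a_def)
  have a_eq: "C\<^sup>2 / 2 ^ k = a" by (simp add: a_def powr_minus powr_realpow divide_inverse)
  \<comment> \<open>The 3 is an upper bound for the collected exponent
    \<open>1 + 2 * \<gamma> + (r0 - r - \<gamma>)\<close>, since \<open>\<gamma>\<close> and
    \<open>r0 - r\<close> are at most 1.\<close>
  define T where "T = C ^ 3 * 2 powr (- \<gamma> * k)"
  have T: "0 < T" using C by (simp add: T_def)
  have time: "time_integral r0 (level (C\<^sup>2) u k) x \<le> ennreal (T * h x powr (r0 - \<gamma>))" for x
  proof (cases "h x = 0")
    case True
    hence "u (x, t) = 0" for t using u_le[of x t] by simp
    hence "level (C\<^sup>2) u k (x, t) = 0" for t by (simp add: level_def)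
    thus ?thesis by (simp add: time_integral_def)
  next
    case False
    hence hx: "0 < h x" using h(1)[of x] by simp
    define w where "w = a powr \<gamma> * (C * h x) powr (r0 - r - \<gamma>)"
    have "time_integral r0 (level (C\<^sup>2) u k) x \<le> (\<integral>\<^sup>+t. ennreal w * ennreal (norm (u (x, t)) powr r) \<partial>lborel)"
      unfolding time_integral_def
    proof (rule nn_integral_mono)
      fix t
      show "ennreal (norm (level (C\<^sup>2) u k (x, t)) powr r0) \<le> ennreal w * ennreal (norm (u (x, t)) powr r)"
      proof (cases "level (C\<^sup>2) u k (x, t) = 0")
        case False
        define v where "v = norm (u (x, t))"
        have *: "v \<le> a" "level (C\<^sup>2) u k (x, t) = u (x, t)" "0 < v"
          using False unfolding v_def by (auto simp: level_def a_eq split: if_splits)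
        have "v powr r0 = v powr \<gamma> * v powr (r0 - r - \<gamma>) * v powr r"
          using * by (simp flip: powr_add)
        also have "\<dots> \<le> a powr \<gamma> * (C * h x) powr (r0 - r - \<gamma>) * v powr r"
          using * \<gamma> u_le[of x t] unfolding v_def[symmetric]
          by (intro mult_right_mono mult_mono powr_mono2) auto
        finally show ?thesis using * by (simp add: v_def w_def flip: ennreal_mult)
      qed simp
    qed
    also have "\<dots> = ennreal w * time_integral r u x"
      unfolding time_integral_def by (intro nn_integral_cmult) measurable
    also have "\<dots> \<le> ennreal w * ennreal (C * h x powr r)" by (intro mult_left_mono u_time) auto
    also have "\<dots> \<le> ennreal (T * h x powr (r0 - \<gamma>))"
    proof -
      have "w * (C * h x powr r) = (C powr 1 * (C powr 2) powr \<gamma> * C powr (r0 - r - \<gamma>)) * 2 powr (- \<gamma> * k) * h x powr (r0 - \<gamma>)"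
        using C hx by (simp add: w_def a_def powr_mult powr_powr mult_ac flip: powr_add)
      also have "C powr 1 * (C powr 2) powr \<gamma> * C powr (r0 - r - \<gamma>) = C powr (1 + 2 * \<gamma> + (r0 - r - \<gamma>))"
        by (simp only: powr_add powr_powr)
      also have "\<dots> \<le> C powr 3" using C \<gamma> r by (intro powr_mono) auto
      finally have "w * (C * h x powr r) \<le> T * h x powr (r0 - \<gamma>)"
        using C by (simp add: T_def mult_right_mono)
      moreover have "0 \<le> w" by (simp add: w_def)
      ultimately show ?thesis using C by (simp add: ennreal_leI flip: ennreal_mult)
    qed
    finally show ?thesis .
  qed
  define p where "p = q0 / r0"
  have p: "0 < p" "p \<le> 2"
  proof -
    show "0 < p" using q r by (simp add: p_def)
    have "q0 \<le> 2 * r0" using q r by linarith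
    thus "p \<le> 2" using r by (simp add: p_def divide_le_eq)
  qed
  have space: "ennpowr (time_integral r0 (level (C\<^sup>2) u k) x) p \<le> ennreal (C ^ 7 * 2 powr (- \<gamma> * k * p)) * ennreal (h x powr q)" for x
  proof -
    have "ennpowr (time_integral r0 (level (C\<^sup>2) u k) x) p \<le> ennpowr (ennreal (T * h x powr (r0 - \<gamma>))) p"
      using p by (intro ennpowr_mono time) auto
    also have "\<dots> = ennreal ((T * h x powr (r0 - \<gamma>)) powr p)"
      using T by (intro ennpowr_ennreal) auto
    also have "(T * h x powr (r0 - \<gamma>)) powr p \<le> C ^ 7 * 2 powr (- \<gamma> * k * p) * h x powr q"
    proof (cases "h x = 0")
      case False
      hence hx: "0 < h x" using h(1)[of x] by simp
      have "T powr p = (C ^ 3) powr p * 2 powr (- \<gamma> * k * p)"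
        using C by (simp add: T_def powr_mult powr_powr)
      also have "(C ^ 3) powr p \<le> (C ^ 3) powr 2" using C p by (intro powr_mono) (auto simp: one_le_power)
      also have "(C ^ 3) powr 2 = C ^ 6" using C by (simp flip: power_mult)
      finally have 1: "T powr p \<le> C ^ 6 * 2 powr (- \<gamma> * k * p)" by (simp add: mult_right_mono)
      \<comment> \<open>The bracket is nonnegative by the spatial constraint in \<open>gain\<close>,
        so this part of the power can be estimated by the upper bound on \<open>h\<close>.\<close>
      have e: "(r0 - \<gamma>) * p = q + (q0 - q - \<gamma> * q0 / r0)" using r by (simp add: p_def field_simps)
      have "(h x powr (r0 - \<gamma>)) powr p = h x powr q * h x powr (q0 - q - \<gamma> * q0 / r0)"
        unfolding powr_powr e by (rule powr_add)
      also have "\<dots> \<le> h x powr q * C powr (q0 - q - \<gamma> * q0 / r0)"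
        using h \<gamma> by (intro mult_left_mono powr_mono2) auto
      also have "\<dots> \<le> h x powr q * C powr 1"
      proof (intro mult_left_mono powr_mono)
        have "0 \<le> \<gamma> * q0 / r0" using \<gamma> q r by simp
        thus "q0 - q - \<gamma> * q0 / r0 \<le> 1" using q by linarith
      qed (use C in auto)
      finally have 2: "(h x powr (r0 - \<gamma>)) powr p \<le> h x powr q * C" using C by simp
      have "(T * h x powr (r0 - \<gamma>)) powr p = T powr p * (h x powr (r0 - \<gamma>)) powr p"
        using T by (simp add: powr_mult)
      also have "\<dots> \<le> (C ^ 6 * 2 powr (- \<gamma> * k * p)) * (h x powr q * C)"
        using C by (intro mult_mono 1 2) auto
      also have "\<dots> = C ^ 7 * 2 powr (- \<gamma> * k * p) * h x powr q"
        by (simp add: power_Suc[symmetric] mult_ac eval_nat_numeral)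
      finally show ?thesis .
    qed simp
    finally show ?thesis using C by (simp add: ennreal_leI flip: ennreal_mult)
  qed
  have "mixed_integral q0 r0 (level (C\<^sup>2) u k) \<le> (\<integral>\<^sup>+x. ennreal (C ^ 7 * 2 powr (- \<gamma> * k * p)) * ennreal (h x powr q) \<partial>lborel)"
    unfolding mixed_integral_def p_def[symmetric] by (intro nn_integral_mono space)
  also have "\<dots> = ennreal (C ^ 7 * 2 powr (- \<gamma> * k * p)) * (\<integral>\<^sup>+x. ennreal (h x powr q) \<partial>lborel)"
    by (intro nn_integral_cmult) measurable
  also have "\<dots> \<le> ennreal (C ^ 7 * 2 powr (- \<gamma> * k * p)) * ennreal C" by (intro mult_left_mono h_int) auto
  also have "\<dots> = ennreal (C ^ 8 * 2 powr (- \<gamma> * k * p))"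
    using C by (simp add: mult_ac eval_nat_numeral flip: ennreal_mult)
  also have "\<dots> \<le> ennreal ((C ^ 8 * 2 powr (- (\<gamma> / r0) * k)) powr q0)"
  proof (rule ennreal_leI)
    have "C ^ 8 = (C ^ 8) powr 1" using C by simp
    also have "\<dots> \<le> (C ^ 8) powr q0" using C q by (intro powr_mono) (auto simp: one_le_power)
    finally have le: "C ^ 8 \<le> (C ^ 8) powr q0" .
    have eq: "2 powr (- \<gamma> * k * p) = (2 powr (- (\<gamma> / r0) * k)) powr q0"
      by (simp add: powr_powr p_def mult_ac)
    have "C ^ 8 * 2 powr (- \<gamma> * k * p) \<le> (C ^ 8) powr q0 * (2 powr (- (\<gamma> / r0) * k)) powr q0"
      unfolding eq by (intro mult_right_mono le) auto
    also have "(C ^ 8) powr q0 * (2 powr (- (\<gamma> / r0) * k)) powr q0 = (C ^ 8 * 2 powr (- (\<gamma> / r0) * k)) powr q0"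
      by (rule powr_mult[symmetric])
    finally show "C ^ 8 * 2 powr (- \<gamma> * k * p) \<le> (C ^ 8 * 2 powr (- (\<gamma> / r0) * k)) powr q0" .
  qed
  finally show ?thesis unfolding \<gamma>_def[symmetric] using C q by (subst mixed_norm_le_iff) auto
qed

end

section \<open>The estimate for integrable functions\<close>

definition local_restriction_estimate :: "(real^'n::finite \<Rightarrow> real) \<Rightarrow> real \<Rightarrow> real \<Rightarrow> bool" where
  "local_restriction_estimate \<Phi> q r \<longleftrightarrow> (\<forall>\<epsilon>>0. \<exists>C\<ge>0. \<forall>R>1. \<forall>f\<in>mixed_Lp q r.
     L2_norm (surface_measure \<Phi>) (restriction_op \<Phi> (cutoff R f)) \<le> ennreal (C * R powr \<epsilon>) * mixed_norm q r f)"

text \<open>\<open>B\<close> is fixed before \<open>u\<close> and \<open>h\<close>. Accordingly the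
  exponent \<open>\<eta> / 32\<close>, and with it \<open>C1\<close>, has to serve all levels of all
  functions, while the radius may depend on the level.\<close>

lemma fourier_sq_integral_bounded_of_majorant:
  fixes \<Phi> :: "real^'n::finite \<Rightarrow> real"
  assumes smooth: "Ck_on 2 \<Phi> (- {0})" and piece: "decaying_piece \<Phi> D"
    and q: "1 \<le> q" "q < q0" "q0 \<le> 2" and r: "1 \<le> r" "r < r0" "r0 \<le> 2" and C: "1 \<le> C"
    and hyp: "local_restriction_estimate \<Phi> q0 r0"
  shows "\<exists>B\<ge>0. \<forall>u h. integrable lborel u \<longrightarrow> h \<in> borel_measurable borel \<longrightarrow> (\<forall>x. 0 \<le> h x \<and> h x \<le> C) \<longrightarrow>
     (\<forall>x t. norm (u (x, t)) \<le> C * h x) \<longrightarrow> (\<forall>x. time_integral r u x \<le> ennreal (C * h x powr r)) \<longrightarrow>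
     (\<integral>\<^sup>+x. ennreal (h x powr q) \<partial>lborel) \<le> ennreal C \<longrightarrow>
     (fourier_energy \<Phi> D u) \<le> B"
proof -
  have D: "D \<in> sets borel" "D \<subseteq> annulus" using piece by (auto simp: decaying_piece_def)
  obtain K where K: "\<And>z. norm (kernel \<Phi> D z) * sqrt (norm z) \<le> K"
    using piece by (auto simp: decaying_piece_def)
  have K0: "0 \<le> K" using K[of 0] by simp
  have finD: "emeasure lborel D < \<infinity>"
    using D(2) by (rule emeasure_subset_annulus_finite)
  define \<gamma> where "\<gamma> = gain q r q0 r0"
  note gain_facts = gain[OF q(1,2) r, folded \<gamma>_def]
  define \<eta> where "\<eta> = \<gamma> / r0"
  have \<eta>: "0 < \<eta>" "\<eta> \<le> 1"
    using gain_facts r by (auto simp: \<eta>_def divide_le_eq)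
  obtain C1 where C1: "0 \<le> C1" "\<And>R f. R > 1 \<Longrightarrow> f \<in> mixed_Lp q0 r0 \<Longrightarrow>
      L2_norm (surface_measure \<Phi>) (restriction_op \<Phi> (cutoff R f)) \<le> ennreal (C1 * R powr (\<eta> / 32)) * mixed_norm q0 r0 f"
    using hyp \<eta> unfolding local_restriction_estimate_def by (metis half_gt_zero divide_pos_pos zero_less_numeral)
  define c where "c = 2 * (real CARD('n) + 1) * K"
  have c: "0 \<le> c" using K0 by (simp add: c_def)
  define B where "B = 8 * C1\<^sup>2 * C ^ 16 + c * C ^ 6"
  have B: "0 \<le> B" using c C by (simp add: B_def)
  \<comment> \<open>Its square \<open>2 powr (- \<eta>)\<close> is the decay left per level after
    the localisation loss.\<close>
  define x where "x = 2 powr (- \<eta> / 2)"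
  have x: "0 < x" "x < 1"
  proof -
    show "0 < x" by (simp add: x_def)
    have "x < 2 powr 0" unfolding x_def using \<eta> by (intro powr_less_mono) auto
    thus "x < 1" by simp
  qed
  have "(fourier_energy \<Phi> D u) \<le> B / (1 - x)\<^sup>2"
    if u: "integrable lborel u" and h_meas: "h \<in> borel_measurable borel" and h: "\<forall>x. 0 \<le> h x \<and> h x \<le> C"
      and u_le: "\<forall>x t. norm (u (x, t)) \<le> C * h x" and u_time: "\<forall>x. time_integral r u x \<le> ennreal (C * h x powr r)"
      and h_int: "(\<integral>\<^sup>+x. ennreal (h x powr q) \<partial>lborel) \<le> ennreal C" for u h
  proof (rule fourier_sq_integral_levels[OF u D(1) finD borel_measurable_surface_fun[OF smooth] _ _ x B])
    have u_meas: "u \<in> borel_measurable borel" using u by simp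
    have h': "\<And>x. 0 \<le> h x" "\<And>x. h x \<le> C" using h by auto
    note facts = u_meas h_meas C h' u_le[rule_format] u_time[rule_format] h_int q r
    show "0 \<le> C\<^sup>2" by simp
    show "norm (u z) \<le> C\<^sup>2" for z
      by (rule norm_le_C_sq[OF facts])
    fix k
    define v where "v = level (C\<^sup>2) u k"
    have v: "integrable lborel v"
      unfolding v_def using u by (rule Bochner_Integration.integrable_bound) (use u_meas in \<open>auto simp: norm_level_le\<close>)
    have v1: "(LINT z|lborel. norm (v z)) \<le> C ^ 3 * 4 ^ Suc k"
      unfolding v_def by (rule integral_norm_level_le[OF facts u])
    define A where "A = C ^ 8 * 2 powr (- \<eta> * k)"
    have A0: "0 \<le> A" using C by (simp add: A_def)
    have A: "mixed_norm q0 r0 v \<le> ennreal A"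
      using mixed_norm_level_le[OF facts, of k] by (simp add: v_def A_def \<eta>_def \<gamma>_def)
    \<comment> \<open>The squared localisation loss is
      \<open>2 powr (\<eta> * real (Suc k))\<close>, which up to a constant consumes half of the
      decay exponent of \<open>A\<^sup>2\<close>. On the other side \<open>1 / sqrt R\<close> is
      \<open>2 powr (- 8 * real (Suc k))\<close> and beats the growth
      \<open>2 powr (4 * real (Suc k))\<close> of the squared L1 bound.\<close>
    define R where "R = 2 powr (16 * real (Suc k))"
    have "2 powr 0 < R" unfolding R_def by (intro powr_less_mono) auto
    hence R: "1 < R" by simp
    have M0: "0 \<le> C1 * R powr (\<eta> / 32)" using C1 by simp
    have "(fourier_energy \<Phi> D v)
      \<le> 4 * (C1 * R powr (\<eta> / 32))\<^sup>2 * A\<^sup>2 + c / sqrt R * (LINT z|lborel. norm (v z))\<^sup>2"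
      unfolding c_def
      using fourier_sq_integral_split[OF smooth v D K _ q(3) _ r(3) A0 A _ M0 C1(2)[OF R]] q r R
      by simp
    also have "\<dots> \<le> 4 * (C1 * R powr (\<eta> / 32))\<^sup>2 * A\<^sup>2 + c / sqrt R * (C ^ 3 * 4 ^ Suc k)\<^sup>2"
      using v1 c R by (intro add_left_mono mult_left_mono power_mono) auto
    also have "4 * (C1 * R powr (\<eta> / 32))\<^sup>2 * A\<^sup>2 \<le> 8 * C1\<^sup>2 * C ^ 16 * 2 powr (- \<eta> * k)"
    proof -
      have "(R powr (\<eta> / 32))\<^sup>2 = 2 powr \<eta> * 2 powr (\<eta> * k)"
      proof -
        have "(R powr (\<eta> / 32))\<^sup>2 = 2 powr (\<eta> + \<eta> * k)"
          unfolding R_def powr_powr power2_eq_square powr_add[symmetric] by (simp add: algebra_simps)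
        thus ?thesis by (simp add: powr_add)
      qed
      moreover have "A\<^sup>2 = C ^ 16 * (2 powr (- \<eta> * k) * 2 powr (- \<eta> * k))"
        by (simp add: A_def power_mult_distrib power2_eq_square flip: power_add)
      moreover have "2 powr (\<eta> * k) * 2 powr (- \<eta> * k) = 1"
        by (simp flip: powr_add)
      ultimately have "(C1 * R powr (\<eta> / 32))\<^sup>2 * A\<^sup>2 = C1\<^sup>2 * 2 powr \<eta> * C ^ 16 * 2 powr (- \<eta> * k)"
        by (simp add: power_mult_distrib)
      also have "\<dots> \<le> C1\<^sup>2 * 2 powr 1 * C ^ 16 * 2 powr (- \<eta> * k)"
        using \<eta> C by (intro mult_right_mono mult_left_mono powr_mono) auto
      finally have "4 * ((C1 * R powr (\<eta> / 32))\<^sup>2 * A\<^sup>2) \<le> 4 * (C1\<^sup>2 * 2 powr 1 * C ^ 16 * 2 powr (- \<eta> * k))"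
        by (rule mult_left_mono) simp
      thus ?thesis by (simp add: mult.assoc)
    qed
    also have "c / sqrt R * (C ^ 3 * 4 ^ Suc k)\<^sup>2 \<le> c * C ^ 6 * 2 powr (- \<eta> * k)"
    proof -
      have "sqrt R = 2 powr (8 * real (Suc k))"
        unfolding R_def by (simp add: powr_half_sqrt[symmetric] powr_powr add_divide_distrib)
      moreover have "((4 :: real) ^ Suc k)\<^sup>2 = 2 powr (4 * real (Suc k))"
      proof -
        have "((4 :: real) ^ Suc k)\<^sup>2 = (2 ^ 4) ^ Suc k" by (simp add: power2_eq_square flip: power_mult_distrib)
        also have "\<dots> = 2 ^ (4 * Suc k)" by (simp only: power_mult)
        also have "\<dots> = 2 powr (4 * real (Suc k))" by (subst powr_realpow[symmetric]) auto
        finally show ?thesis .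
      qed
      ultimately have "(4 ^ Suc k)\<^sup>2 / sqrt R = 2 powr (- 4 * real (Suc k))"
        by (simp flip: powr_diff)
      also have "\<dots> \<le> 2 powr (- \<eta> * k)"
      proof (intro powr_mono)
        have "\<eta> * real k \<le> 1 * real k" using \<eta> by (intro mult_right_mono) auto
        thus "- 4 * real (Suc k) \<le> - \<eta> * real k" by simp
      qed simp
      finally have "c * C ^ 6 * ((4 ^ Suc k)\<^sup>2 / sqrt R) \<le> c * C ^ 6 * 2 powr (- \<eta> * k)"
        using c C by (intro mult_left_mono) auto
      moreover have "c / sqrt R * (C ^ 3 * 4 ^ Suc k)\<^sup>2 = c * C ^ 6 * ((4 ^ Suc k)\<^sup>2 / sqrt R)"
        unfolding power_mult_distrib[of "C ^ 3"] by (simp flip: power_mult)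
      ultimately show ?thesis by (simp only:)
    qed
    also have "8 * C1\<^sup>2 * C ^ 16 * 2 powr (- \<eta> * k) + c * C ^ 6 * 2 powr (- \<eta> * k) = B * x ^ (2 * k)"
    proof -
      have "x ^ (2 * k) = 2 powr (- \<eta> * k)"
        using x by (simp add: x_def powr_powr flip: powr_realpow)
      thus ?thesis by (simp add: B_def distrib_right)
    qed
    finally show "(fourier_energy \<Phi> D (level (C\<^sup>2) u k)) \<le> B * x ^ (2 * k)"
      by (simp add: v_def)
  qed
  thus ?thesis using B x by (intro exI[of _ "B / (1 - x)\<^sup>2"]) auto
qed

section \<open>Regular representatives and the estimate on one piece\<close>

lemma AE_lborel_prodI:
  assumes "{z. P z} \<in> sets (borel :: ('a::euclidean_space \<times> 'b::euclidean_space) measure)"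
    and "AE x in lborel. AE t in lborel. P (x, t)"
  shows "AE z in lborel. P z"
proof -
  have "AE z in lborel \<Otimes>\<^sub>M lborel. P z"
  proof (rule lborel_pair.AE_pair_measure)
    have "sets (lborel \<Otimes>\<^sub>M lborel) = sets (borel :: ('a \<times> 'b) measure)"
      by (simp only: lborel_prod sets_lborel)
    thus "{z \<in> space (lborel \<Otimes>\<^sub>M lborel). P z} \<in> sets (lborel \<Otimes>\<^sub>M lborel)"
      using assms(1) by (simp add: space_pair_measure)
  qed (use assms(2) in simp)
  thus ?thesis unfolding lborel_prod .
qed

lemma time_integral_eq_0_AE:
  assumes [measurable]: "f \<in> borel_measurable borel" and "time_integral r f x = 0"
  shows "AE t in lborel. f (x, t) = 0"
proof -
  have "AE t in lborel. ennreal (norm (f (x, t)) powr r) = 0"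
    using assms(2) unfolding time_integral_def by (subst (asm) nn_integral_0_iff_AE) auto
  thus ?thesis by eventually_elim simp
qed

text \<open>Slices with time integral 0 already vanish almost everywhere, and those with an infinite
  one form a null set because the mixed integral is finite. Setting both to zero makes the pointwise
  assumptions behind the majorant true for every \<open>x\<close>, with no exceptional set.\<close>

lemma exists_regular_representative:
  fixes f :: "(real^'n::finite) \<times> real \<Rightarrow> complex"
  assumes f[measurable]: "f \<in> borel_measurable borel" and fin: "mixed_integral q r f < \<infinity>" and q: "0 < q" and r: "0 < r"
  shows "\<exists>g. g \<in> borel_measurable borel \<and> (AE z in lborel. g z = f z) \<and> (\<forall>z. norm (g z) \<le> norm (f z)) \<and>
    (\<forall>x. time_integral r g x < \<infinity>) \<and> (\<forall>x t. time_integral r g x = 0 \<longrightarrow> g (x, t) = 0)"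
proof -
  define J where "J = time_integral r f"
  have [measurable]: "J \<in> borel_measurable borel" by (simp add: J_def)
  define g where "g z = (if J (fst z) \<noteq> 0 \<and> J (fst z) \<noteq> top then f z else 0)" for z
  have g_meas[measurable]: "g \<in> borel_measurable borel" unfolding g_def[abs_def] by measurable
  have Jg: "time_integral r g x = (if J x \<noteq> 0 \<and> J x \<noteq> top then J x else 0)" for x
    by (simp add: time_integral_def g_def J_def)
  have "AE x in lborel. ennpowr (J x) (q / r) \<noteq> \<infinity>"
    using fin unfolding mixed_integral_def J_def by (intro nn_integral_noteq_infinite) auto
  hence "AE x in lborel. AE t in lborel. g (x, t) = f (x, t)"
  proof eventually_elim
    case (elim x)
    show ?case
    proof (cases "J x = 0")
      case True
      from time_integral_eq_0_AE[OF f True[unfolded J_def]] show ?thesis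
        by eventually_elim (simp add: g_def True)
    next
      case False
      thus ?thesis using elim by (simp add: g_def)
    qed
  qed
  hence "AE z in lborel. g z = f z" by (intro AE_lborel_prodI) auto
  moreover have "norm (g z) \<le> norm (f z)" for z by (simp add: g_def)
  moreover have "time_integral r g x < \<infinity>" for x by (simp add: Jg less_top)
  moreover have "g (x, t) = 0" if "time_integral r g x = 0" for x t
    using that by (auto simp: Jg g_def split: if_splits)
  ultimately show ?thesis using g_meas by blast
qed

lemma fourier_transform_cong_AE:
  assumes "AE z in lborel. f z = g z" "f \<in> borel_measurable borel" "g \<in> borel_measurable borel"
  shows "fourier_transform f \<zeta> = fourier_transform g \<zeta>"
proof -
  note [measurable] = assms(2,3)
  show ?thesis
    unfolding fourier_transform_cis
    by (intro integral_cong_AE) (use assms(1) in \<open>auto elim: eventually_mono\<close>)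
qed

lemma piece_estimate:
  fixes \<Phi> :: "real^'n::finite \<Rightarrow> real"
  assumes smooth: "Ck_on 2 \<Phi> (- {0})" and piece: "decaying_piece \<Phi> D"
    and q: "1 \<le> q" "q < q0" "q0 \<le> 2" and r: "1 \<le> r" "r < r0" "r0 \<le> 2"
    and hyp: "local_restriction_estimate \<Phi> q0 r0"
  shows "\<exists>B\<ge>0. \<forall>f. integrable lborel f \<longrightarrow> mixed_integral q r f \<le> 1 \<longrightarrow>
     (fourier_energy \<Phi> D f) \<le> B"
proof -
  have D: "D \<in> sets borel" "D \<subseteq> annulus" using piece by (auto simp: decaying_piece_def)
  have finD: "emeasure lborel D < \<infinity>"
    using D(2) by (rule emeasure_subset_annulus_finite)
  have sub: "annulus \<subseteq> - {0 :: real^'n}" by (auto simp: annulus_def)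
  have "bounded ((\<lambda>\<xi>. (\<xi>, \<Phi> \<xi>)) ` annulus)"
    by (intro compact_imp_bounded compact_continuous_image compact_annulus continuous_intros
        continuous_on_subset[OF continuous_on_Ck_on_2(1)[OF smooth] sub])
  then obtain Z where Z: "Z > 0" "\<And>\<xi>. \<xi> \<in> annulus \<Longrightarrow> norm (\<xi>, \<Phi> \<xi>) \<le> Z"
    unfolding bounded_pos by auto
  \<comment> \<open>The density will live on a ball times an interval of size
    \<open>\<delta>\<close>, where \<open>norm w \<le> 2 * \<delta>\<close>; the phase against
    points of the surface is then at most 1.\<close>
  define \<delta> where "\<delta> = 1 / (2 * Z)"
  have \<delta>: "0 < \<delta>" using Z by (simp add: \<delta>_def)
  define V where "V = measure lborel (ball (0 :: real^'n) \<delta>)"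
  have V: "0 < V" using \<delta> by (simp add: V_def)
  define b where "b y = indicator (ball (0 :: real^'n) \<delta>) y / V" for y
  define d where "d s = indicator {0<..<\<delta>} s / \<delta>" for s :: real
  have bd: "b \<in> borel_measurable borel" "d \<in> borel_measurable borel" "\<And>y. 0 \<le> b y" "\<And>s. 0 \<le> d s"
    "\<And>y. b y \<le> 1 / V" "\<And>s. d s \<le> 1 / \<delta>"
    using V \<delta> by (auto simp: b_def[abs_def] d_def[abs_def] indicator_def divide_right_mono)
  have b_mass: "(\<integral>\<^sup>+y. ennreal (b y) \<partial>lborel) = 1"
  proof -
    have "emeasure lborel (ball (0 :: real^'n) \<delta>) = ennreal V"
      unfolding V_def by (intro emeasure_eq_ennreal_measure) (use emeasure_lborel_ball_finite[of "0 :: real^'n" \<delta>] in auto)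
    moreover have "(\<integral>\<^sup>+y. ennreal (b y) \<partial>lborel) = (\<integral>\<^sup>+y. ennreal (1 / V) * indicator (ball (0 :: real^'n) \<delta>) y \<partial>lborel)"
      using V by (intro nn_integral_cong) (auto simp: b_def indicator_def)
    ultimately show ?thesis using V by (simp add: nn_integral_cmult_indicator flip: ennreal_mult)
  qed
  have d_mass: "(\<integral>\<^sup>+s. ennreal (d s) \<partial>lborel) = 1"
  proof -
    have "(\<integral>\<^sup>+s. ennreal (d s) \<partial>lborel) = (\<integral>\<^sup>+s. ennreal (1 / \<delta>) * indicator {0<..<\<delta>} s \<partial>lborel)"
      using \<delta> by (intro nn_integral_cong) (auto simp: d_def indicator_def)
    thus ?thesis using \<delta> by (simp add: nn_integral_cmult_indicator flip: ennreal_mult)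
  qed
  note bd = bd b_mass d_mass
  have small: "\<bar>w \<bullet> (\<xi>, \<Phi> \<xi>)\<bar> \<le> 1" if "b (fst w) * d (snd w) \<noteq> 0" "\<xi> \<in> annulus" for w \<xi>
  proof -
    have "norm (fst w) < \<delta>" "\<bar>snd w\<bar> < \<delta>"
      using that(1) by (auto simp: b_def d_def indicator_def split: if_splits)
    hence "norm w \<le> 2 * \<delta>" using norm_Pair_le[of "fst w" "snd w"] by simp
    hence "norm w * norm (\<xi>, \<Phi> \<xi>) \<le> (2 * \<delta>) * Z"
      using Z that(2) \<delta> by (intro mult_mono) auto
    also have "\<dots> = 1" using Z by (simp add: \<delta>_def)
    finally show ?thesis using Cauchy_Schwarz_ineq2[of w "(\<xi>, \<Phi> \<xi>)"] by simp
  qed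
  \<comment> \<open>The 4 covers \<open>2 powr q\<close> and \<open>2 powr r\<close>; the other
    terms cover the suprema of the two densities.\<close>
  define C where "C = 4 + 1 / V + 1 / \<delta>"
  have C: "1 \<le> C" "4 \<le> C" "1 + 1 / V \<le> C" "1 + 1 / \<delta> \<le> C" using V \<delta> by (auto simp: C_def)
  obtain B where B: "0 \<le> B" "\<And>u h. integrable lborel u \<Longrightarrow> h \<in> borel_measurable borel \<Longrightarrow> (\<forall>x. 0 \<le> h x \<and> h x \<le> C) \<Longrightarrow>
     (\<forall>x t. norm (u (x, t)) \<le> C * h x) \<Longrightarrow> (\<forall>x. time_integral r u x \<le> ennreal (C * h x powr r)) \<Longrightarrow>
     (\<integral>\<^sup>+x. ennreal (h x powr q) \<partial>lborel) \<le> ennreal C \<Longrightarrow>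
     (fourier_energy \<Phi> D u) \<le> B"
    using fourier_sq_integral_bounded_of_majorant[OF smooth piece q r C(1) hyp] by blast
  have pow4: "2 powr p \<le> C" if "p \<le> 2" for p
  proof -
    have "2 powr p \<le> 2 powr 2" using that by (intro powr_mono) auto
    thus ?thesis using C(2) by simp
  qed
  have "(fourier_energy \<Phi> D f) \<le> 4 * B"
    if f: "integrable lborel f" and mixed: "mixed_integral q r f \<le> 1" for f
  proof -
    have f_meas: "f \<in> borel_measurable borel" using f by simp
    have "mixed_integral q r f < \<infinity>" using mixed by (auto simp: less_top[symmetric] top_unique)
    then obtain g where g_meas: "g \<in> borel_measurable borel" and gf: "AE z in lborel. g z = f z"
      "\<And>z. norm (g z) \<le> norm (f z)" and g_fin: "\<And>x. time_integral r g x < \<infinity>" "\<And>x t. time_integral r g x = 0 \<Longrightarrow> g (x, t) = 0"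
      using exists_regular_representative[OF f_meas, of q r] q r by auto
    have g: "integrable lborel g"
      using f by (rule Bochner_Integration.integrable_bound) (use g_meas gf in auto)
    have "mixed_integral q r g \<le> mixed_integral q r f" using gf q r by (intro mixed_integral_mono) auto
    hence g_mixed: "mixed_integral q r g \<le> 1" using mixed by (rule order_trans)
    note facts = g_meas q(1) r(1) g_fin g_mixed
    define u where "u = smoothing b d g"
    define h where "h = bound b g r"
    have u: "integrable lborel u" unfolding u_def by (rule integrable_smoothing[OF bd g])
    have Q: "(fourier_energy \<Phi> D u) \<le> B"
    proof (rule B(2)[OF u])
      show "h \<in> borel_measurable borel"
        unfolding h_def by (rule borel_measurable_bound[OF bd facts])
      have h0: "0 \<le> h x" for x unfolding h_def by (rule bound_nonneg[OF bd facts])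
      moreover have "h x \<le> C" for x
        using bound_le[OF bd facts, of x] C by (simp add: h_def)
      ultimately show "\<forall>x. 0 \<le> h x \<and> h x \<le> C" by blast
      have "norm (u (x, t)) \<le> (1 + 1 / \<delta>) * h x" for x t
        unfolding u_def h_def by (rule norm_smoothing_le[OF bd facts])
      moreover have "(1 + 1 / \<delta>) * h x \<le> C * h x" for x using C h0 by (intro mult_right_mono) auto
      ultimately show "\<forall>x t. norm (u (x, t)) \<le> C * h x" by (meson order_trans)
      have "time_integral r u x \<le> ennreal (2 powr r * h x powr r)" for x
        unfolding u_def h_def by (rule time_integral_smoothing_le[OF bd facts])
      moreover have "ennreal (2 powr r * h x powr r) \<le> ennreal (C * h x powr r)" for x
        using pow4[of r] r by (intro ennreal_leI mult_right_mono) auto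
      ultimately show "\<forall>x. time_integral r u x \<le> ennreal (C * h x powr r)" by (meson order_trans)
      have "(\<integral>\<^sup>+x. ennreal (h x powr q) \<partial>lborel) \<le> ennreal (2 powr q)"
        unfolding h_def by (rule nn_integral_bound[OF bd facts])
      also have "\<dots> \<le> ennreal C" using pow4[of q] q by (intro ennreal_leI) auto
      finally show "(\<integral>\<^sup>+x. ennreal (h x powr q) \<partial>lborel) \<le> ennreal C" .
    qed
    note meas = borel_measurable_surface_fun[OF smooth]
    have "(fourier_energy \<Phi> D f) \<le> (LINT \<xi>:D|lborel. 4 * (norm (fourier_transform u (\<xi>, \<Phi> \<xi>)))\<^sup>2)"
    proof (rule set_integral_mono[OF set_integrable_fourier_sq[OF f D(1) finD meas]])
      show "set_integrable lborel D (\<lambda>\<xi>. 4 * (norm (fourier_transform u (\<xi>, \<Phi> \<xi>)))\<^sup>2)"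
        using set_integrable_fourier_sq[OF u D(1) finD meas] by simp
      fix \<xi> assume "\<xi> \<in> D"
      hence \<xi>: "\<xi> \<in> annulus" using D by blast
      have "norm (fourier_transform f (\<xi>, \<Phi> \<xi>)) = norm (fourier_transform g (\<xi>, \<Phi> \<xi>))"
        using fourier_transform_cong_AE[OF gf(1) g_meas f_meas] by simp
      also have "\<dots> \<le> 2 * norm (fourier_transform u (\<xi>, \<Phi> \<xi>))"
        unfolding u_def by (rule fourier_transform_le_smoothing[OF bd g small[OF _ \<xi>]])
      finally have "(norm (fourier_transform f (\<xi>, \<Phi> \<xi>)))\<^sup>2 \<le> (2 * norm (fourier_transform u (\<xi>, \<Phi> \<xi>)))\<^sup>2"
        by (intro power_mono) auto
      thus "(norm (fourier_transform f (\<xi>, \<Phi> \<xi>)))\<^sup>2 \<le> 4 * (norm (fourier_transform u (\<xi>, \<Phi> \<xi>)))\<^sup>2"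
        by (simp add: power_mult_distrib)
    qed
    also have "\<dots> = 4 * (fourier_energy \<Phi> D u)" by simp
    also have "\<dots> \<le> 4 * B" using Q by simp
    finally show ?thesis .
  qed
  thus ?thesis using B(1) by (intro exI[of _ "4 * B"]) auto
qed

section \<open>Summation over the pieces and scaling\<close>

lemma AE_not_in_sphere: "AE \<xi> in lborel. \<xi> \<notin> sphere (a :: 'a::euclidean_space) r"
proof -
  have "sphere a r \<in> null_sets lebesgue" by (metis negligible_iff_null_sets negligible_sphere)
  hence "sphere a r \<in> null_sets lborel"
    by (subst (asm) null_sets_completion_iff) auto
  thus ?thesis by (rule AE_not_in)
qed

lemma restriction_bounded_on_unit_ball:
  fixes \<Phi> :: "real^'n::finite \<Rightarrow> real"
  assumes smooth: "Ck_on 2 \<Phi> (- {0})" and rank: "\<And>\<xi>. \<xi> \<noteq> 0 \<Longrightarrow> rank (hessian \<Phi> \<xi>) \<ge> 1"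
    and q: "1 \<le> q" "q < q0" "q0 \<le> 2" and r: "1 \<le> r" "r < r0" "r0 \<le> 2"
    and hyp: "local_restriction_estimate \<Phi> q0 r0"
  shows "\<exists>B\<ge>0. \<forall>f. integrable lborel f \<longrightarrow> mixed_norm q r f \<le> 1 \<longrightarrow>
     (L2_norm (surface_measure \<Phi>) (restriction_op \<Phi> f))\<^sup>2 \<le> ennreal B"
proof -
  obtain \<D> where \<D>: "finite \<D>" "\<And>D. D \<in> \<D> \<Longrightarrow> decaying_piece \<Phi> D" "annulus \<subseteq> \<Union>\<D> \<union> sphere 0 (1/2)"
    using annulus_covered_by_decaying_pieces[OF smooth rank] by blast
  have "\<forall>D\<in>\<D>. \<exists>B\<ge>0. \<forall>f. integrable lborel f \<longrightarrow> mixed_integral q r f \<le> 1 \<longrightarrow>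
     (fourier_energy \<Phi> D f) \<le> B"
    by (intro ballI piece_estimate[OF smooth \<D>(2) q r hyp])
  from bchoice[OF this] obtain B where B': "\<forall>D\<in>\<D>. 0 \<le> B D \<and> (\<forall>f. integrable lborel f \<longrightarrow> mixed_integral q r f \<le> 1 \<longrightarrow>
     (fourier_energy \<Phi> D f) \<le> B D)" ..
  have B: "0 \<le> B D" "integrable lborel f \<Longrightarrow> mixed_integral q r f \<le> 1 \<Longrightarrow>
     (fourier_energy \<Phi> D f) \<le> B D" if "D \<in> \<D>" for D f
    using B' that by simp_all
  obtain A where A: "0 \<le> A" "\<And>\<xi>. area_element \<Phi> \<xi> \<le> A" using area_element_bounded[OF smooth] by blast
  have "(L2_norm (surface_measure \<Phi>) (restriction_op \<Phi> f))\<^sup>2 \<le> ennreal (A * (\<Sum>D\<in>\<D>. B D))"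
    if f: "integrable lborel f" and mixed: "mixed_norm q r f \<le> 1" for f
  proof -
    have mixed': "mixed_integral q r f \<le> 1"
      using mixed mixed_norm_le_iff[of q 1 r f] q by simp
    define F where "F \<xi> = (norm (fourier_transform f (\<xi>, \<Phi> \<xi>)))\<^sup>2" for \<xi>
    have D_borel: "D \<in> sets borel" if "D \<in> \<D>" for D using \<D>(2)[OF that] by (simp add: decaying_piece_def)
    have F_int: "integrable lborel (\<lambda>\<xi>. indicator D \<xi> * F \<xi>)" if "D \<in> \<D>" for D
    proof -
      have "D \<subseteq> annulus" using \<D>(2)[OF that] by (simp add: decaying_piece_def)
      hence "emeasure lborel D < \<infinity>" by (rule emeasure_subset_annulus_finite)
      thus ?thesis
        using set_integrable_fourier_sq[OF f D_borel[OF that] _ borel_measurable_surface_fun[OF smooth]]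
        by (simp add: set_integrable_def F_def)
    qed
    have "(L2_norm (surface_measure \<Phi>) (restriction_op \<Phi> f))\<^sup>2 = (\<integral>\<^sup>+\<xi>. ennreal (area_element \<Phi> \<xi>) * ennreal (F \<xi>) \<partial>lborel)"
      unfolding F_def by (rule L2_norm_restriction_sq[OF smooth]) (use f in simp)
    \<comment> \<open>Off the inner sphere each point of the annulus lies in some piece, and further
      pieces only enlarge the sum. The area element enters here through its upper bound
      \<open>A\<close>.\<close>
    also have "\<dots> \<le> (\<integral>\<^sup>+\<xi>. (\<Sum>D\<in>\<D>. ennreal A * ennreal (indicator D \<xi> * F \<xi>)) \<partial>lborel)"
    proof (rule nn_integral_mono_AE)
      show "AE \<xi> in lborel. ennreal (area_element \<Phi> \<xi>) * ennreal (F \<xi>) \<le> (\<Sum>D\<in>\<D>. ennreal A * ennreal (indicator D \<xi> * F \<xi>))"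
        using AE_not_in_sphere[of 0 "1/2"]
      proof eventually_elim
        case (elim \<xi>)
        show ?case
        proof (cases "\<xi> \<in> annulus")
          case True
          then obtain D where D: "D \<in> \<D>" "\<xi> \<in> D" using \<D>(3) elim by blast
          have "ennreal (area_element \<Phi> \<xi>) * ennreal (F \<xi>) \<le> ennreal A * ennreal (indicator D \<xi> * F \<xi>)"
            using D A by (simp add: mult_right_mono ennreal_leI)
          also have "\<dots> \<le> (\<Sum>D\<in>\<D>. ennreal A * ennreal (indicator D \<xi> * F \<xi>))"
            using D \<D>(1) by (intro member_le_sum) auto
          finally show ?thesis .
        qed (simp add: area_element_eq_0)
      qed
    qed
    also have "\<dots> = (\<Sum>D\<in>\<D>. ennreal A * (\<integral>\<^sup>+\<xi>. ennreal (indicator D \<xi> * F \<xi>) \<partial>lborel))"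
      using F_int by (subst nn_integral_sum) (auto intro!: sum.cong nn_integral_cmult)
    also have "\<dots> \<le> (\<Sum>D\<in>\<D>. ennreal A * ennreal (B D))"
    proof (intro sum_mono mult_left_mono)
      fix D assume D: "D \<in> \<D>"
      have "(\<integral>\<^sup>+\<xi>. ennreal (indicator D \<xi> * F \<xi>) \<partial>lborel) = ennreal (LINT \<xi>|lborel. indicator D \<xi> * F \<xi>)"
        by (intro nn_integral_eq_integral F_int[OF D]) (simp add: F_def)
      also have "\<dots> \<le> ennreal (B D)"
        using B(2)[OF D f mixed'] by (intro ennreal_leI) (simp add: F_def set_lebesgue_integral_def)
      finally show "(\<integral>\<^sup>+\<xi>. ennreal (indicator D \<xi> * F \<xi>) \<partial>lborel) \<le> ennreal (B D)" .
    qed auto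
    also have "\<dots> = ennreal (A * (\<Sum>D\<in>\<D>. B D))"
      using B(1) A(1) by (simp add: sum_distrib_left sum_nonneg ennreal_mult flip: sum_ennreal)
    finally show ?thesis .
  qed
  thus ?thesis using A(1) B(1) by (intro exI[of _ "A * (\<Sum>D\<in>\<D>. B D)"]) (auto intro!: mult_nonneg_nonneg sum_nonneg)
qed

lemma fourier_transform_cmult: "fourier_transform (\<lambda>z. c * f z) \<zeta> = c * fourier_transform f \<zeta>"
proof -
  have "fourier_transform (\<lambda>z. c * f z) \<zeta> = (LINT z|lborel. c * (cis (- (z \<bullet> \<zeta>)) * f z))"
    unfolding fourier_transform_cis by (simp add: mult.left_commute)
  also have "\<dots> = c * fourier_transform f \<zeta>" unfolding fourier_transform_cis by (rule integral_mult_right_zero)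
  finally show ?thesis .
qed

lemma fourier_transform_add:
  assumes "integrable lborel f" "integrable lborel g"
  shows "fourier_transform (\<lambda>z. f z + g z) \<zeta> = fourier_transform f \<zeta> + fourier_transform g \<zeta>"
  unfolding fourier_transform_cis distrib_left
  by (intro Bochner_Integration.integral_add integrable_cis_mult assms)

lemma L2_norm_cmult:
  assumes [measurable]: "g \<in> borel_measurable M"
  shows "L2_norm M (\<lambda>z. c * g z) = ennreal (norm c) * L2_norm M g"
proof -
  have "(\<integral>\<^sup>+z. ennreal ((norm (c * g z))\<^sup>2) \<partial>M) = ennreal ((norm c)\<^sup>2) * (\<integral>\<^sup>+z. ennreal ((norm (g z))\<^sup>2) \<partial>M)"
    by (subst nn_integral_cmult[symmetric]) (auto simp: norm_mult power_mult_distrib ennreal_mult)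
  thus ?thesis
    unfolding L2_norm_def by (simp add: ennpowr_mult ennpowr_ennreal powr_half_sqrt)
qed

lemma L2_norm_add_le:
  assumes [measurable]: "f \<in> borel_measurable M" "g \<in> borel_measurable M"
  shows "L2_norm M (\<lambda>z. f z + g z) \<le> 4 * (L2_norm M f + L2_norm M g)"
proof -
  have "(\<integral>\<^sup>+z. ennreal ((norm (f z + g z))\<^sup>2) \<partial>M) \<le> (\<integral>\<^sup>+z. 2 * (ennreal ((norm (f z))\<^sup>2) + ennreal ((norm (g z))\<^sup>2)) \<partial>M)"
  proof (rule nn_integral_mono)
    fix z
    have "(norm (f z + g z))\<^sup>2 \<le> (norm (f z) + norm (g z))\<^sup>2" by (intro power_mono norm_triangle_ineq) auto
    also have "\<dots> \<le> 2 * ((norm (f z))\<^sup>2 + (norm (g z))\<^sup>2)"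
      using sum_squares_bound[of "norm (f z)" "norm (g z)"] by (simp add: power2_sum)
    finally show "ennreal ((norm (f z + g z))\<^sup>2) \<le> 2 * (ennreal ((norm (f z))\<^sup>2) + ennreal ((norm (g z))\<^sup>2))"
      by (metis ennreal_leI ennreal_mult ennreal_numeral ennreal_plus zero_le_numeral zero_le_power2 add_nonneg_nonneg)
  qed
  also have "\<dots> = 2 * ((\<integral>\<^sup>+z. ennreal ((norm (f z))\<^sup>2) \<partial>M) + (\<integral>\<^sup>+z. ennreal ((norm (g z))\<^sup>2) \<partial>M))"
    by (simp add: nn_integral_cmult nn_integral_add)
  finally have "L2_norm M (\<lambda>z. f z + g z) \<le> ennpowr (2 * ((\<integral>\<^sup>+z. ennreal ((norm (f z))\<^sup>2) \<partial>M) + (\<integral>\<^sup>+z. ennreal ((norm (g z))\<^sup>2) \<partial>M))) (1/2)"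
    unfolding L2_norm_def by (intro ennpowr_mono) auto
  also have "\<dots> = ennpowr 2 (1/2) * ennpowr ((\<integral>\<^sup>+z. ennreal ((norm (f z))\<^sup>2) \<partial>M) + (\<integral>\<^sup>+z. ennreal ((norm (g z))\<^sup>2) \<partial>M)) (1/2)"
    by (rule ennpowr_mult)
  also have "\<dots> \<le> ennpowr 2 (1/2) * (ennreal (2 powr (1/2)) * (L2_norm M f + L2_norm M g))"
    unfolding L2_norm_def by (intro mult_left_mono ennpowr_add_le) auto
  also have "\<dots> = ennreal (2 powr (1/2) * 2 powr (1/2)) * (L2_norm M f + L2_norm M g)"
    using ennpowr_ennreal[of 2 "1/2"] by (simp add: ennreal_mult mult.assoc)
  also have "2 powr (1/2) * 2 powr (1/2) = (2 :: real)" by (simp flip: powr_add)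
  also have "ennreal 2 * (L2_norm M f + L2_norm M g) \<le> 4 * (L2_norm M f + L2_norm M g)"
    by (intro mult_right_mono) auto
  finally show ?thesis .
qed

lemma restriction_bounded:
  fixes \<Phi> :: "real^'n::finite \<Rightarrow> real"
  assumes smooth: "Ck_on 2 \<Phi> (- {0})" and rank: "\<And>\<xi>. \<xi> \<noteq> 0 \<Longrightarrow> rank (hessian \<Phi> \<xi>) \<ge> 1"
    and q: "1 \<le> q" "q < q0" "q0 \<le> 2" and r: "1 \<le> r" "r < r0" "r0 \<le> 2"
    and hyp: "local_restriction_estimate \<Phi> q0 r0"
  shows "\<exists>C\<ge>0. \<forall>f\<in>mixed_Lp q r. integrable lborel f \<longrightarrow>
     L2_norm (surface_measure \<Phi>) (fourier_transform f) \<le> ennreal C * mixed_norm q r f"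
proof -
  obtain B where B: "0 \<le> B" "\<And>f. integrable lborel f \<Longrightarrow> mixed_norm q r f \<le> 1 \<Longrightarrow>
     (L2_norm (surface_measure \<Phi>) (restriction_op \<Phi> f))\<^sup>2 \<le> ennreal B"
    using restriction_bounded_on_unit_ball[OF smooth rank q r hyp] by blast
  define C where "C = sqrt B"
  have C: "0 \<le> C" "C\<^sup>2 = B" using B by (auto simp: C_def)
  have unit: "L2_norm (surface_measure \<Phi>) (fourier_transform f) \<le> ennreal C"
    if "integrable lborel f" "mixed_norm q r f \<le> 1" for f
  proof -
    have "(L2_norm (surface_measure \<Phi>) (fourier_transform f))\<^sup>2 \<le> (ennreal C)\<^sup>2"
      using B(2)[OF that] C by (simp add: L2_norm_restriction_op[OF smooth] ennreal_power)
    from ennpowr_mono[OF this, of "1/2"] show ?thesis by (simp add: ennpowr_ennpowr flip: ennpowr_2)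
  qed
  have "L2_norm (surface_measure \<Phi>) (fourier_transform f) \<le> ennreal C * mixed_norm q r f"
    if f: "f \<in> mixed_Lp q r" "integrable lborel f" for f
  proof -
    define L where "L = L2_norm (surface_measure \<Phi>) (fourier_transform f)"
    have f_meas: "f \<in> borel_measurable borel" using f by simp
    have ft_meas: "fourier_transform f \<in> borel_measurable (surface_measure \<Phi>)"
      using borel_measurable_fourier_transform[OF f_meas] by simp
    have scaled: "ennreal s * L \<le> ennreal C" if "0 < s" "ennreal s * mixed_norm q r f \<le> 1" for s
    proof -
      have "fourier_transform (\<lambda>z. complex_of_real s * f z) = (\<lambda>\<zeta>. of_real s * fourier_transform f \<zeta>)"
        by (simp add: fourier_transform_cmult fun_eq_iff)
      hence "ennreal s * L = L2_norm (surface_measure \<Phi>) (fourier_transform (\<lambda>z. complex_of_real s * f z))"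
        using L2_norm_cmult[OF ft_meas, of "of_real s"] that by (simp add: L_def)
      also have "\<dots> \<le> ennreal C"
        using that f f_meas q r by (intro unit) (auto simp: mixed_norm_cmult)
      finally show ?thesis .
    qed
    have "mixed_norm q r f < \<infinity>" using f by (simp add: mixed_Lp_def)
    then obtain N where N: "mixed_norm q r f = ennreal N" "0 \<le> N" by (cases "mixed_norm q r f") auto
    \<comment> \<open>Finiteness comes first: the scale \<open>1 / (N + 1)\<close> is positive and
      admissible even for \<open>N = 0\<close>.\<close>
    have "L < \<infinity>"
    proof -
      have "ennreal (1 / (N + 1)) * L \<le> ennreal C"
        using N by (intro scaled) (auto simp: field_simps simp flip: ennreal_mult ennreal_1)
      hence "ennreal (1 / (N + 1)) * L \<noteq> top" by (auto simp: top_unique)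
      thus ?thesis using N by (auto simp: ennreal_mult_eq_top_iff less_top)
    qed
    then obtain l where l: "L = ennreal l" "0 \<le> l" by (cases L) auto
    have "l \<le> C * N"
    proof (cases "N = 0")
      case True
      \<comment> \<open>Every positive multiple of a function of norm 0 is admissible, so a positive
        \<open>l\<close> could be scaled beyond \<open>C\<close>.\<close>
      have "s * l \<le> C" if "0 < s" for s
        using scaled[OF that] N True l that C by (simp flip: ennreal_mult)
      from this[of "(C + 1) / l"] have "\<not> 0 < l" using C by (auto split: if_splits)
      thus ?thesis using True by simp
    next
      case False
      hence "0 < N" using N by simp
      hence "1 / N * l \<le> C"
        using scaled[of "1 / N"] N l C by (simp flip: ennreal_mult)
      thus ?thesis using \<open>0 < N\<close> by (simp add: field_simps)
    qed
    thus ?thesis using l N C by (simp add: L_def[symmetric] flip: ennreal_mult)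
  qed
  thus ?thesis using C by blast
qed

section \<open>Extension by density\<close>

lemma tendsto_ennpowr_0:
  assumes "(a \<longlongrightarrow> 0) F" "0 < p"
  shows "((\<lambda>n. ennpowr (a n) p) \<longlongrightarrow> 0) F"
proof (rule order_tendstoI)
  fix y :: ennreal assume "0 < y"
  then obtain z where z: "0 < z" "z < y" using dense by blast
  hence "z \<noteq> top" by auto
  then obtain e where "z = ennreal e" by (cases z) auto
  with z have e: "0 < e" "ennreal e < y" by auto
  have "0 < ennreal (e powr (1 / p))" using e by simp
  hence "\<forall>\<^sub>F n in F. a n < ennreal (e powr (1 / p))" by (rule order_tendstoD(2)[OF assms(1)])
  thus "\<forall>\<^sub>F n in F. ennpowr (a n) p < y"
  proof eventually_elim
    case (elim n)
    have "ennpowr (a n) p \<le> ennpowr (ennreal (e powr (1 / p))) p" using elim assms(2) by (intro ennpowr_mono) auto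
    also have "\<dots> = ennreal e" using e assms(2) by (simp add: ennpowr_ennreal powr_powr)
    finally show ?case using e(2) by simp
  qed
qed auto

lemma mixed_Lp_iff: "f \<in> mixed_Lp q r \<longleftrightarrow> f \<in> borel_measurable borel \<and> mixed_norm q r f < \<infinity>"
  by (simp add: mixed_Lp_def)

lemma mixed_Lp_add:
  assumes "1 \<le> r" "1 \<le> q" "f \<in> mixed_Lp q r" "g \<in> mixed_Lp q r"
  shows "(\<lambda>z. f z + g z) \<in> mixed_Lp q r"
proof -
  have [measurable]: "f \<in> borel_measurable borel" "g \<in> borel_measurable borel"
    and fin: "mixed_norm q r f < top" "mixed_norm q r g < top" using assms by (auto simp: mixed_Lp_iff)
  have "8 * (mixed_norm q r f + mixed_norm q r g) < top"
    using fin by (auto simp: ennreal_mult_less_top)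
  hence "mixed_norm q r (\<lambda>z. f z + g z) < top"
    using mixed_norm_add_le[of f g r q] assms by (intro order_le_less_trans[OF mixed_norm_add_le]) auto
  thus ?thesis by (simp add: mixed_Lp_iff)
qed

lemma mixed_Lp_cmult:
  assumes "1 \<le> r" "1 \<le> q" "f \<in> mixed_Lp q r"
  shows "(\<lambda>z. c * f z) \<in> mixed_Lp q r"
proof -
  have f: "f \<in> borel_measurable borel" "mixed_norm q r f < top" using assms(3) by (simp_all add: mixed_Lp_iff)
  have "mixed_norm q r (\<lambda>z. c * f z) = ennreal (norm c) * mixed_norm q r f"
    using assms by (intro mixed_norm_cmult f) auto
  also have "\<dots> < top" using f(2) by (simp add: ennreal_mult_less_top)
  finally show ?thesis using f(1) by (simp add: mixed_Lp_iff)
qed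

lemma mixed_norm_diff_le:
  assumes "f \<in> borel_measurable borel" "g \<in> borel_measurable borel" "1 \<le> r" "1 \<le> q"
  shows "mixed_norm q r (\<lambda>z. f z - g z) \<le> 8 * (mixed_norm q r f + mixed_norm q r g)"
proof -
  have "mixed_norm q r (\<lambda>z. f z + - g z) \<le> 8 * (mixed_norm q r f + mixed_norm q r (\<lambda>z. - g z))"
    using assms by (intro mixed_norm_add_le) auto
  also have "mixed_norm q r (\<lambda>z. - g z) = mixed_norm q r g" by (rule mixed_norm_cong) simp
  finally show ?thesis by simp
qed

lemma L2_norm_diff_le:
  assumes "f \<in> borel_measurable M" "g \<in> borel_measurable M"
  shows "L2_norm M (\<lambda>z. f z - g z) \<le> 4 * (L2_norm M f + L2_norm M g)"
proof -
  have "L2_norm M (\<lambda>z. f z + - g z) \<le> 4 * (L2_norm M f + L2_norm M (\<lambda>z. - g z))"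
    using assms by (intro L2_norm_add_le) auto
  also have "L2_norm M (\<lambda>z. - g z) = L2_norm M g" by (rule L2_norm_cong_AE) simp
  finally show ?thesis by simp
qed

text \<open>Truncating in position and in size gives bounded functions of bounded support, hence
  integrable ones. The error is dominated by \<open>f\<close>, so dominated convergence applies on
  almost every time slice and then to the powers of the slice integrals.\<close>

lemma integrable_dense_in_mixed_Lp:
  fixes f :: "(real^'n::finite) \<times> real \<Rightarrow> complex"
  assumes q: "1 \<le> q" and r: "1 \<le> r" and f: "f \<in> mixed_Lp q r" and e: "0 < e"
  shows "\<exists>g\<in>mixed_Lp q r. integrable lborel g \<and> mixed_norm q r (\<lambda>z. f z - g z) \<le> ennreal e"
proof -
  have [measurable]: "f \<in> borel_measurable borel" and fin: "mixed_norm q r f < top" using f by (auto simp: mixed_Lp_iff)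
  define g where "g N z = (if norm z \<le> real N \<and> norm (f z) \<le> real N then f z else 0)" for N z
  have [measurable]: "g N \<in> borel_measurable borel" for N unfolding g_def[abs_def] by measurable
  have fg_le: "norm (f z - g N z) \<le> norm (f z)" and g_le: "norm (g N z) \<le> norm (f z)" for N z by (auto simp: g_def)
  have g_Lp: "g N \<in> mixed_Lp q r" for N
    using mixed_norm_mono[of "g N" f r q] g_le fin q r by (auto simp: mixed_Lp_iff intro: order_le_less_trans)
  have g_int: "integrable lborel (g N)" for N
  proof (rule Bochner_Integration.integrable_bound)
    show "integrable lborel (\<lambda>z. real N * indicator (cball (0 :: (real^'n) \<times> real) (real N)) z)"
      using emeasure_lborel_cball_finite[of "0 :: (real^'n) \<times> real" "real N"] by (intro integrable_mult_right) auto
  qed (auto simp: g_def)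
  have int_fin: "mixed_integral q r f < top" using fin by (simp add: mixed_norm_eq)
  have ae: "AE x in lborel. ennpowr (time_integral r f x) (q / r) \<noteq> \<infinity>"
    using int_fin unfolding mixed_integral_def by (intro nn_integral_noteq_infinite) auto
  have time: "(\<lambda>N. time_integral r (\<lambda>z. f z - g N z) x) \<longlonglongrightarrow> 0" if "time_integral r f x < top" for x
  proof -
    have "(\<lambda>N. \<integral>\<^sup>+t. ennreal (norm (f (x, t) - g N (x, t)) powr r) \<partial>lborel) \<longlonglongrightarrow> (\<integral>\<^sup>+t. 0 \<partial>(lborel :: real measure))"
    proof (rule nn_integral_dominated_convergence[where w = "\<lambda>t. ennreal (norm (f (x, t)) powr r)"])
      show "(\<integral>\<^sup>+t. ennreal (norm (f (x, t)) powr r) \<partial>lborel) < \<infinity>" using that by (simp add: time_integral_def)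
      show "AE t in lborel. ennreal (norm (f (x, t) - g N (x, t)) powr r) \<le> ennreal (norm (f (x, t)) powr r)" for N
        using fg_le r by (intro AE_I2 ennreal_leI powr_mono2) auto
      show "AE t in lborel. (\<lambda>N. ennreal (norm (f (x, t) - g N (x, t)) powr r)) \<longlonglongrightarrow> 0"
      proof (rule AE_I2)
        fix t
        obtain N0 :: nat where N0: "norm (x, t) \<le> N0" "norm (f (x, t)) \<le> N0"
          using real_arch_simple[of "max (norm (x, t)) (norm (f (x, t)))"] by auto
        have "\<forall>\<^sub>F N in sequentially. ennreal (norm (f (x, t) - g N (x, t)) powr r) = 0"
          using eventually_ge_at_top[of N0]
        proof eventually_elim
          case (elim N)
          hence "norm (x, t) \<le> N" "norm (f (x, t)) \<le> N" using N0 by linarith+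
          thus ?case by (simp add: g_def)
        qed
        thus "(\<lambda>N. ennreal (norm (f (x, t) - g N (x, t)) powr r)) \<longlonglongrightarrow> 0" by (rule tendsto_eventually)
      qed
    qed measurable
    thus ?thesis by (simp add: time_integral_def)
  qed
  have "(\<lambda>N. \<integral>\<^sup>+x. ennpowr (time_integral r (\<lambda>z. f z - g N z) x) (q / r) \<partial>lborel) \<longlonglongrightarrow> (\<integral>\<^sup>+x. 0 \<partial>(lborel :: (real^'n) measure))"
  proof (rule nn_integral_dominated_convergence[where w = "\<lambda>x. ennpowr (time_integral r f x) (q / r)"])
    show "(\<integral>\<^sup>+x. ennpowr (time_integral r f x) (q / r) \<partial>lborel) < \<infinity>" using int_fin by (simp add: mixed_integral_def)
    show "AE x in lborel. ennpowr (time_integral r (\<lambda>z. f z - g N z) x) (q / r) \<le> ennpowr (time_integral r f x) (q / r)" for N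
      using fg_le q r by (intro AE_I2 ennpowr_mono time_integral_mono) auto
    show "AE x in lborel. (\<lambda>N. ennpowr (time_integral r (\<lambda>z. f z - g N z) x) (q / r)) \<longlonglongrightarrow> 0"
      using ae
    proof eventually_elim
      case (elim x)
      hence "time_integral r f x < top" by (simp add: less_top)
      thus ?case using q r by (intro tendsto_ennpowr_0 time) auto
    qed
  qed measurable
  hence "(\<lambda>N. mixed_integral q r (\<lambda>z. f z - g N z)) \<longlonglongrightarrow> 0" by (simp add: mixed_integral_def)
  hence "(\<lambda>N. mixed_norm q r (\<lambda>z. f z - g N z)) \<longlonglongrightarrow> 0"
    unfolding mixed_norm_eq using q by (intro tendsto_ennpowr_0) auto
  hence "\<forall>\<^sub>F N in sequentially. mixed_norm q r (\<lambda>z. f z - g N z) < ennreal e"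
    using e by (intro order_tendstoD(2)) auto
  then obtain N where "mixed_norm q r (\<lambda>z. f z - g N z) < ennreal e"
    unfolding eventually_sequentially by blast
  thus ?thesis using g_Lp g_int by (intro bexI[of _ "g N"]) auto
qed

lemma L2_norm_le_iff:
  assumes "0 \<le> a"
  shows "L2_norm M g \<le> ennreal a \<longleftrightarrow> (\<integral>\<^sup>+z. ennreal ((norm (g z))\<^sup>2) \<partial>M) \<le> ennreal (a\<^sup>2)"
proof -
  have "(\<integral>\<^sup>+z. ennreal ((norm (g z))\<^sup>2) \<partial>M) \<le> ennreal (a\<^sup>2)" if "L2_norm M g \<le> ennreal a"
    unfolding L2_norm_sq[symmetric] using power_mono[OF that, of 2] assms by (simp add: ennreal_power)
  moreover have "L2_norm M g \<le> ennreal a" if "(\<integral>\<^sup>+z. ennreal ((norm (g z))\<^sup>2) \<partial>M) \<le> ennreal (a\<^sup>2)"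
    unfolding L2_norm_def using ennpowr_mono[OF that, of "1/2"] assms by (simp add: ennpowr_ennreal powr_half_sqrt)
  ultimately show ?thesis by blast
qed

lemma term_le_suminf: "f k \<le> (\<Sum>i. f i :: ennreal)"
  using sum_le_suminf[OF summableI, of "{k}" f] by simp

text \<open>The rate 1/4 leaves room for the weight \<open>4 ^ k\<close>: the weighted sum of
  squared increments still has a finite integral, so almost everywhere the increments are at most a
  multiple of \<open>(1 / 2) ^ k\<close> and the sequence converges. Fatou's lemma carries the
  Cauchy bound over to the limit with the same constant.\<close>

lemma L2_complete_geometric:
  fixes G :: "nat \<Rightarrow> 'b \<Rightarrow> complex"
  assumes [measurable]: "\<And>k. G k \<in> borel_measurable M" and A: "0 \<le> A"
    and cauchy: "\<And>j k. k \<le> j \<Longrightarrow> L2_norm M (\<lambda>z. G j z - G k z) \<le> ennreal (A * (1 / 4) ^ k)"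
  shows "\<exists>h\<in>borel_measurable M. \<forall>k. L2_norm M (\<lambda>z. h z - G k z) \<le> ennreal (A * (1 / 4) ^ k)"
proof -
  define h where "h z = lim (\<lambda>k. G k z)" for z
  have h[measurable]: "h \<in> borel_measurable M"
    unfolding h_def[abs_def] by (rule borel_measurable_lim_metric) measurable
  define S where "S z = (\<Sum>k. ennreal (4 ^ k * (norm (G (Suc k) z - G k z))\<^sup>2))" for z
  have "(\<integral>\<^sup>+z. S z \<partial>M) = (\<Sum>k. \<integral>\<^sup>+z. ennreal (4 ^ k * (norm (G (Suc k) z - G k z))\<^sup>2) \<partial>M)"
    unfolding S_def by (rule nn_integral_suminf) measurable
  also have "\<dots> \<le> (\<Sum>k. ennreal (A\<^sup>2 * (1 / 4) ^ k))"
  proof (intro suminf_le allI)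
    fix k
    have "(\<integral>\<^sup>+z. ennreal (4 ^ k * (norm (G (Suc k) z - G k z))\<^sup>2) \<partial>M) = ennreal (4 ^ k) * (\<integral>\<^sup>+z. ennreal ((norm (G (Suc k) z - G k z))\<^sup>2) \<partial>M)"
      by (subst nn_integral_cmult[symmetric]) (auto simp: ennreal_mult)
    also have "\<dots> \<le> ennreal (4 ^ k) * ennreal ((A * (1 / 4) ^ k)\<^sup>2)"
    proof (rule mult_left_mono)
      have "L2_norm M (\<lambda>z. G (Suc k) z - G k z) \<le> ennreal (A * (1 / 4) ^ k)" by (rule cauchy) simp
      thus "(\<integral>\<^sup>+z. ennreal ((norm (G (Suc k) z - G k z))\<^sup>2) \<partial>M) \<le> ennreal ((A * (1 / 4) ^ k)\<^sup>2)"
        using A by (subst (asm) L2_norm_le_iff) auto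
    qed simp
    also have "\<dots> = ennreal (A\<^sup>2 * (1 / 4) ^ k)"
      by (simp add: power_mult_distrib power2_eq_square power_divide flip: ennreal_mult)
    finally show "(\<integral>\<^sup>+z. ennreal (4 ^ k * (norm (G (Suc k) z - G k z))\<^sup>2) \<partial>M) \<le> ennreal (A\<^sup>2 * (1 / 4) ^ k)" .
  qed auto
  also have "\<dots> < \<infinity>"
  proof -
    have "summable (\<lambda>k. A\<^sup>2 * (1 / 4 :: real) ^ k)" by (intro summable_mult summable_geometric) auto
    thus ?thesis by (subst suminf_ennreal2) auto
  qed
  finally have "(\<integral>\<^sup>+z. S z \<partial>M) < \<infinity>" .
  hence "AE z in M. S z \<noteq> \<infinity>" unfolding S_def by (intro nn_integral_noteq_infinite) auto
  hence conv: "AE z in M. (\<lambda>k. G k z) \<longlonglongrightarrow> h z"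
  proof eventually_elim
    case (elim z)
    then obtain s where s: "S z = ennreal s" "0 \<le> s" by (cases "S z") auto
    have step_le: "norm (G (Suc k) z - G k z) \<le> sqrt s * (1 / 2) ^ k" for k
    proof -
      have "ennreal (4 ^ k * (norm (G (Suc k) z - G k z))\<^sup>2) \<le> S z"
        unfolding S_def by (rule term_le_suminf)
      hence "4 ^ k * (norm (G (Suc k) z - G k z))\<^sup>2 \<le> s" using s by simp
      moreover have "((2 :: real) ^ k)\<^sup>2 = 4 ^ k" unfolding power2_eq_square power_mult_distrib[symmetric] by simp
      ultimately have "(2 ^ k * norm (G (Suc k) z - G k z))\<^sup>2 \<le> s"
        by (simp only: power_mult_distrib)
      hence "2 ^ k * norm (G (Suc k) z - G k z) \<le> sqrt s" by (rule real_le_rsqrt)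
      thus ?thesis by (simp add: field_simps)
    qed
    have "summable (\<lambda>k. G (Suc k) z - G k z)"
      by (rule summable_comparison_test'[OF summable_mult[OF summable_geometric]]) (use step_le in auto)
    hence "(\<lambda>n. (\<Sum>k<n. G (Suc k) z - G k z)) \<longlonglongrightarrow> (\<Sum>k. G (Suc k) z - G k z)"
      by (rule summable_LIMSEQ)
    hence "(\<lambda>n. G n z - G 0 z) \<longlonglongrightarrow> (\<Sum>k. G (Suc k) z - G k z)"
      unfolding sum_lessThan_telescope[of "\<lambda>k. G k z"] .
    from tendsto_add[OF this tendsto_const[of "G 0 z"]] have "convergent (\<lambda>n. G n z)"
      by (auto simp: convergent_def)
    thus ?case unfolding h_def by (simp add: convergent_LIMSEQ_iff)
  qed
  have "L2_norm M (\<lambda>z. h z - G k z) \<le> ennreal (A * (1 / 4) ^ k)" for k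
  proof -
    have "(\<integral>\<^sup>+z. ennreal ((norm (h z - G k z))\<^sup>2) \<partial>M) = (\<integral>\<^sup>+z. liminf (\<lambda>j. ennreal ((norm (G j z - G k z))\<^sup>2)) \<partial>M)"
    proof (rule nn_integral_cong_AE)
      show "AE z in M. ennreal ((norm (h z - G k z))\<^sup>2) = liminf (\<lambda>j. ennreal ((norm (G j z - G k z))\<^sup>2))"
        using conv
      proof eventually_elim
        case (elim z)
        have "(\<lambda>j. ennreal ((norm (G j z - G k z))\<^sup>2)) \<longlonglongrightarrow> ennreal ((norm (h z - G k z))\<^sup>2)"
          by (intro tendsto_intros elim)
        thus ?case by (intro lim_imp_Liminf[symmetric]) auto
      qed
    qed
    also have "\<dots> \<le> liminf (\<lambda>j. \<integral>\<^sup>+z. ennreal ((norm (G j z - G k z))\<^sup>2) \<partial>M)"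
      by (rule nn_integral_liminf) measurable
    also have "\<dots> \<le> ennreal ((A * (1 / 4) ^ k)\<^sup>2)"
    proof (rule Liminf_le)
      show "\<forall>\<^sub>F j in sequentially. (\<integral>\<^sup>+z. ennreal ((norm (G j z - G k z))\<^sup>2) \<partial>M) \<le> ennreal ((A * (1 / 4) ^ k)\<^sup>2)"
        using eventually_ge_at_top[of k]
      proof eventually_elim
        case (elim j)
        thus ?case using cauchy[OF elim] A by (subst (asm) L2_norm_le_iff) auto
      qed
    qed auto
    finally show ?thesis using A by (subst L2_norm_le_iff) auto
  qed
  thus ?thesis using h by blast
qed

lemma numeral_mult_ennreal_add:
  assumes "0 \<le> a" "0 \<le> b"
  shows "numeral w * (ennreal a + ennreal b) = ennreal (numeral w * (a + b))"
  using assms by (subst ennreal_mult) auto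

context
  fixes M :: "'b measure" and F :: "((real^'n::finite) \<times> real \<Rightarrow> complex) \<Rightarrow> 'b \<Rightarrow> complex" and q r C :: real
  assumes q: "1 \<le> q" and r: "1 \<le> r" and C: "0 \<le> C"
    and F_meas: "\<And>f. f \<in> borel_measurable borel \<Longrightarrow> F f \<in> borel_measurable M"
    and F_add: "\<And>f g. integrable lborel f \<Longrightarrow> integrable lborel g \<Longrightarrow> F (\<lambda>z. f z + g z) = (\<lambda>\<zeta>. F f \<zeta> + F g \<zeta>)"
    and F_cmult: "\<And>c f. F (\<lambda>z. c * f z) = (\<lambda>\<zeta>. c * F f \<zeta>)"
    and F_bound: "\<And>f. f \<in> mixed_Lp q r \<Longrightarrow> integrable lborel f \<Longrightarrow> L2_norm M (F f) \<le> ennreal C * mixed_norm q r f"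
begin

text \<open>A relation in place of a limit along a chosen sequence: approximants for sums and
  multiples can be written down directly, and uniqueness almost everywhere later turns the relation
  into an operator.\<close>

definition extends_to :: "((real^'n) \<times> real \<Rightarrow> complex) \<Rightarrow> ('b \<Rightarrow> complex) \<Rightarrow> bool" where
  "extends_to f h \<longleftrightarrow> h \<in> borel_measurable M \<and>
     (\<forall>e>0. \<exists>g\<in>mixed_Lp q r. integrable lborel g \<and> mixed_norm q r (\<lambda>z. f z - g z) \<le> ennreal e
        \<and> L2_norm M (\<lambda>\<zeta>. h \<zeta> - F g \<zeta>) \<le> ennreal e)"

text \<open>The difference of two approximants is integrable and has mixed norm at most
  \<open>8 * (a + b)\<close>, the 8 being the constant of \<open>mixed_norm_add_le\<close>.
  Linearity and boundedness of \<open>F\<close> do the rest.\<close>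

lemma F_diff_bound:
  assumes f: "f \<in> mixed_Lp q r" and g: "g \<in> mixed_Lp q r" "integrable lborel g" "mixed_norm q r (\<lambda>z. f z - g z) \<le> ennreal a" "0 \<le> a"
    and g': "g' \<in> mixed_Lp q r" "integrable lborel g'" "mixed_norm q r (\<lambda>z. f z - g' z) \<le> ennreal b" "0 \<le> b"
  shows "L2_norm M (\<lambda>\<zeta>. F g \<zeta> - F g' \<zeta>) \<le> ennreal (8 * C * (a + b))"
proof -
  have [measurable]: "f \<in> borel_measurable borel" "g \<in> borel_measurable borel" "g' \<in> borel_measurable borel"
    using f g g' by (auto simp: mixed_Lp_iff)
  define d where "d z = g z + (- 1) * g' z" for z
  have d_int: "integrable lborel d" unfolding d_def[abs_def] using g g' by simp
  have d_Lp: "d \<in> mixed_Lp q r"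
    unfolding d_def[abs_def] by (intro mixed_Lp_add mixed_Lp_cmult g g' q r)
  have Fd: "F d = (\<lambda>\<zeta>. F g \<zeta> - F g' \<zeta>)"
    unfolding d_def[abs_def] using F_add[OF g(2), of "\<lambda>z. (- 1) * g' z"] F_cmult[of "- 1" g'] g'(2) by simp
  have "mixed_norm q r d = mixed_norm q r (\<lambda>z. (f z - g' z) - (f z - g z))"
    by (rule mixed_norm_cong) (simp add: d_def)
  also have "\<dots> \<le> 8 * (mixed_norm q r (\<lambda>z. f z - g' z) + mixed_norm q r (\<lambda>z. f z - g z))"
    by (intro mixed_norm_diff_le q r) measurable
  also have "\<dots> \<le> 8 * (ennreal b + ennreal a)" by (intro mult_left_mono add_mono g g') auto
  also have "\<dots> = ennreal (8 * (a + b))" using g(4) g'(4) by (subst numeral_mult_ennreal_add) (auto simp: add.commute)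
  finally have "ennreal C * mixed_norm q r d \<le> ennreal C * ennreal (8 * (a + b))" by (intro mult_left_mono) auto
  also have "\<dots> = ennreal (8 * C * (a + b))" using C g(4) g'(4) by (subst ennreal_mult[symmetric]) (auto simp: mult_ac)
  finally show ?thesis using F_bound[OF d_Lp d_int] unfolding Fd by (rule order_trans[rotated])
qed

lemma extends_to_exists:
  assumes f: "f \<in> mixed_Lp q r"
  shows "\<exists>h. extends_to f h"
proof -
  have "\<forall>k. \<exists>g. g \<in> mixed_Lp q r \<and> integrable lborel g \<and> mixed_norm q r (\<lambda>z. f z - g z) \<le> ennreal ((1 / 4) ^ k)"
    using integrable_dense_in_mixed_Lp[OF q r f] by (metis zero_less_divide_1_iff zero_less_numeral zero_less_power)
  then obtain G where G: "\<And>k. G k \<in> mixed_Lp q r" "\<And>k. integrable lborel (G k)"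
    "\<And>k. mixed_norm q r (\<lambda>z. f z - G k z) \<le> ennreal ((1 / 4) ^ k)" by metis
  have G_meas: "F (G k) \<in> borel_measurable M" for k using G(1)[of k] by (intro F_meas) (simp add: mixed_Lp_iff)
  \<comment> \<open>Two approximation errors of at most \<open>(1 / 4) ^ k\<close>, each with the
    factor \<open>8 * C\<close>.\<close>
  define A where "A = 16 * C"
  have "L2_norm M (\<lambda>\<zeta>. F (G j) \<zeta> - F (G k) \<zeta>) \<le> ennreal (A * (1 / 4) ^ k)" if "k \<le> j" for j k
  proof -
    have "L2_norm M (\<lambda>\<zeta>. F (G j) \<zeta> - F (G k) \<zeta>) \<le> ennreal (8 * C * ((1 / 4) ^ j + (1 / 4) ^ k))"
      by (intro F_diff_bound[OF f] G) auto
    also have "\<dots> \<le> ennreal (8 * C * ((1 / 4) ^ k + (1 / 4) ^ k))"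
      using C that by (intro ennreal_leI mult_left_mono add_right_mono power_decreasing) auto
    finally show ?thesis by (simp add: A_def mult.assoc)
  qed
  then obtain h where h: "h \<in> borel_measurable M" "\<And>k. L2_norm M (\<lambda>\<zeta>. h \<zeta> - F (G k) \<zeta>) \<le> ennreal (A * (1 / 4) ^ k)"
    using L2_complete_geometric[of "\<lambda>k. F (G k)" M A] G_meas C by (auto simp: A_def)
  have "extends_to f h"
    unfolding extends_to_def
  proof (intro conjI allI impI h(1))
    fix e :: real assume e: "0 < e"
    have "(\<lambda>k. (A + 1) * (1 / 4) ^ k) \<longlonglongrightarrow> (A + 1) * 0"
      by (intro tendsto_intros LIMSEQ_power_zero) auto
    hence "\<forall>\<^sub>F k in sequentially. (A + 1) * (1 / 4) ^ k < e" using e by (intro order_tendstoD(2)) auto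
    then obtain k where k: "(A + 1) * (1 / 4) ^ k < e" unfolding eventually_sequentially by blast
    have A: "0 \<le> A * (1 / 4) ^ k" "(0 :: real) \<le> (1 / 4) ^ k" using C by (auto simp: A_def)
    moreover have "A * (1 / 4) ^ k + (1 / 4) ^ k < e" using k by (simp add: distrib_right)
    ultimately have "A * (1 / 4) ^ k \<le> e" "(1 / 4) ^ k \<le> e" by linarith+
    hence "mixed_norm q r (\<lambda>z. f z - G k z) \<le> ennreal e" "L2_norm M (\<lambda>\<zeta>. h \<zeta> - F (G k) \<zeta>) \<le> ennreal e"
      using G(3)[of k] h(2)[of k] by (meson ennreal_leI order_trans)+
    thus "\<exists>g\<in>mixed_Lp q r. integrable lborel g \<and> mixed_norm q r (\<lambda>z. f z - g z) \<le> ennreal e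
        \<and> L2_norm M (\<lambda>\<zeta>. h \<zeta> - F g \<zeta>) \<le> ennreal e" using G by blast
  qed
  thus ?thesis by blast
qed

lemma extends_to_self:
  assumes f: "f \<in> mixed_Lp q r" "integrable lborel f"
  shows "extends_to f (F f)"
  unfolding extends_to_def
proof (intro conjI allI impI)
  show "F f \<in> borel_measurable M" using f by (intro F_meas) (simp add: mixed_Lp_iff)
  fix e :: real assume "0 < e"
  show "\<exists>g\<in>mixed_Lp q r. integrable lborel g \<and> mixed_norm q r (\<lambda>z. f z - g z) \<le> ennreal e
        \<and> L2_norm M (\<lambda>\<zeta>. F f \<zeta> - F g \<zeta>) \<le> ennreal e"
    using f by (intro bexI[of _ f]) (simp_all add: mixed_norm_def L2_norm_def)
qed

text \<open>Approximants of \<open>f\<close> to precision \<open>e\<close> have images within a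
  multiple of \<open>e\<close> of each other, so the distance of \<open>h\<close> and
  \<open>h'\<close> is below every positive number.\<close>

lemma extends_to_unique:
  assumes f: "f \<in> mixed_Lp q r" and h: "extends_to f h" "extends_to f h'"
  shows "AE \<zeta> in M. h \<zeta> = h' \<zeta>"
proof -
  have [measurable]: "h \<in> borel_measurable M" "h' \<in> borel_measurable M" using h by (auto simp: extends_to_def)
  define L where "L = L2_norm M (\<lambda>\<zeta>. h \<zeta> - h' \<zeta>)"
  have L_le: "L \<le> ennreal ((20 + 256 * C) * e)" if e: "0 < e" for e
  proof -
    obtain g where g: "g \<in> mixed_Lp q r" "integrable lborel g" "mixed_norm q r (\<lambda>z. f z - g z) \<le> ennreal e"
      "L2_norm M (\<lambda>\<zeta>. h \<zeta> - F g \<zeta>) \<le> ennreal e" using h(1) e unfolding extends_to_def by blast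
    obtain g' where g': "g' \<in> mixed_Lp q r" "integrable lborel g'" "mixed_norm q r (\<lambda>z. f z - g' z) \<le> ennreal e"
      "L2_norm M (\<lambda>\<zeta>. h' \<zeta> - F g' \<zeta>) \<le> ennreal e" using h(2) e unfolding extends_to_def by blast
    have [measurable]: "F g \<in> borel_measurable M" "F g' \<in> borel_measurable M"
      using g g' by (auto intro!: F_meas simp: mixed_Lp_iff)
    have "L2_norm M (\<lambda>\<zeta>. (F g \<zeta> - F g' \<zeta>) - (h' \<zeta> - F g' \<zeta>)) \<le> 4 * (L2_norm M (\<lambda>\<zeta>. F g \<zeta> - F g' \<zeta>) + L2_norm M (\<lambda>\<zeta>. h' \<zeta> - F g' \<zeta>))"
      by (intro L2_norm_diff_le) measurable
    also have "\<dots> \<le> 4 * (ennreal (8 * C * (e + e)) + ennreal e)"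
      using e by (intro mult_left_mono add_mono F_diff_bound[OF f] g g') auto
    also have "\<dots> = ennreal (4 * (8 * C * (e + e) + e))"
      using C e by (intro numeral_mult_ennreal_add) auto
    finally have 1: "L2_norm M (\<lambda>\<zeta>. F g \<zeta> - h' \<zeta>) \<le> ennreal (4 * (8 * C * (e + e) + e))" by simp
    have "L = L2_norm M (\<lambda>\<zeta>. (h \<zeta> - F g \<zeta>) + (F g \<zeta> - h' \<zeta>))" by (simp add: L_def)
    also have "\<dots> \<le> 4 * (L2_norm M (\<lambda>\<zeta>. h \<zeta> - F g \<zeta>) + L2_norm M (\<lambda>\<zeta>. F g \<zeta> - h' \<zeta>))"
      by (intro L2_norm_add_le) measurable
    also have "\<dots> \<le> 4 * (ennreal e + ennreal (4 * (8 * C * (e + e) + e)))"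
      by (intro mult_left_mono add_mono 1 g) auto
    also have "\<dots> = ennreal (4 * (e + 4 * (8 * C * (e + e) + e)))"
      using C e by (intro numeral_mult_ennreal_add) auto
    also have "4 * (e + 4 * (8 * C * (e + e) + e)) = (20 + 256 * C) * e" by (simp add: algebra_simps)
    finally show ?thesis .
  qed
  have "L \<le> 0"
  proof (rule ennreal_le_epsilon)
    fix e :: real assume e: "0 < e"
    have "0 < 20 + 256 * C" using C by simp
    thus "L \<le> 0 + ennreal e" using L_le[of "e / (20 + 256 * C)"] e by simp
  qed
  hence "(\<integral>\<^sup>+\<zeta>. ennreal ((norm (h \<zeta> - h' \<zeta>))\<^sup>2) \<partial>M) = 0" by (simp add: L_def L2_norm_def)
  hence "AE \<zeta> in M. ennreal ((norm (h \<zeta> - h' \<zeta>))\<^sup>2) = 0" by (subst (asm) nn_integral_0_iff_AE) auto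
  thus ?thesis by eventually_elim simp
qed

lemma extends_to_add:
  assumes f: "f \<in> mixed_Lp q r" "f' \<in> mixed_Lp q r" and h: "extends_to f h" "extends_to f' h'"
  shows "extends_to (\<lambda>z. f z + f' z) (\<lambda>\<zeta>. h \<zeta> + h' \<zeta>)"
  unfolding extends_to_def
proof (intro conjI allI impI)
  have [measurable]: "h \<in> borel_measurable M" "h' \<in> borel_measurable M" using h by (auto simp: extends_to_def)
  show "(\<lambda>\<zeta>. h \<zeta> + h' \<zeta>) \<in> borel_measurable M" by measurable
  fix e' :: real assume "0 < e'"
  \<comment> \<open>Two errors of size \<open>e\<close> under the constant 8 add up to
    \<open>e'\<close>.\<close>
  define e where "e = e' / 16"
  have e: "0 < e" using \<open>0 < e'\<close> by (simp add: e_def)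
  obtain g where g: "g \<in> mixed_Lp q r" "integrable lborel g" "mixed_norm q r (\<lambda>z. f z - g z) \<le> ennreal e"
    "L2_norm M (\<lambda>\<zeta>. h \<zeta> - F g \<zeta>) \<le> ennreal e" using h(1) e unfolding extends_to_def by blast
  obtain g' where g': "g' \<in> mixed_Lp q r" "integrable lborel g'" "mixed_norm q r (\<lambda>z. f' z - g' z) \<le> ennreal e"
    "L2_norm M (\<lambda>\<zeta>. h' \<zeta> - F g' \<zeta>) \<le> ennreal e" using h(2) e unfolding extends_to_def by blast
  have [measurable]: "F g \<in> borel_measurable M" "F g' \<in> borel_measurable M"
    "f \<in> borel_measurable borel" "f' \<in> borel_measurable borel" "g \<in> borel_measurable borel" "g' \<in> borel_measurable borel"
    using f g g' by (auto intro!: F_meas simp: mixed_Lp_iff)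
  show "\<exists>g\<in>mixed_Lp q r. integrable lborel g \<and> mixed_norm q r (\<lambda>z. (f z + f' z) - g z) \<le> ennreal e'
        \<and> L2_norm M (\<lambda>\<zeta>. (h \<zeta> + h' \<zeta>) - F g \<zeta>) \<le> ennreal e'"
  proof (intro bexI[of _ "\<lambda>z. g z + g' z"] conjI)
    show "(\<lambda>z. g z + g' z) \<in> mixed_Lp q r" by (intro mixed_Lp_add g g' q r)
    show "integrable lborel (\<lambda>z. g z + g' z)" using g g' by simp
    have "mixed_norm q r (\<lambda>z. (f z - g z) + (f' z - g' z)) \<le> 8 * (mixed_norm q r (\<lambda>z. f z - g z) + mixed_norm q r (\<lambda>z. f' z - g' z))"
      by (intro mixed_norm_add_le q r) measurable
    also have "\<dots> \<le> 8 * (ennreal e + ennreal e)" by (intro mult_left_mono add_mono g g') auto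
    also have "\<dots> = ennreal (8 * (e + e))" using e by (intro numeral_mult_ennreal_add) auto
    finally show "mixed_norm q r (\<lambda>z. (f z + f' z) - (g z + g' z)) \<le> ennreal e'"
      by (simp add: e_def algebra_simps)
    have "L2_norm M (\<lambda>\<zeta>. (h \<zeta> - F g \<zeta>) + (h' \<zeta> - F g' \<zeta>)) \<le> 4 * (L2_norm M (\<lambda>\<zeta>. h \<zeta> - F g \<zeta>) + L2_norm M (\<lambda>\<zeta>. h' \<zeta> - F g' \<zeta>))"
      by (intro L2_norm_add_le) measurable
    also have "\<dots> \<le> 4 * (ennreal e + ennreal e)" by (intro mult_left_mono add_mono g g') auto
    also have "\<dots> = ennreal (4 * (e + e))" using e by (intro numeral_mult_ennreal_add) auto
    also have "\<dots> \<le> ennreal e'" using e by (intro ennreal_leI) (simp add: e_def)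
    finally show "L2_norm M (\<lambda>\<zeta>. (h \<zeta> + h' \<zeta>) - F (\<lambda>z. g z + g' z) \<zeta>) \<le> ennreal e'"
      unfolding F_add[OF g(2) g'(2)] by (simp add: algebra_simps)
  qed
qed

lemma extends_to_cmult:
  assumes f: "f \<in> mixed_Lp q r" and h: "extends_to f h"
  shows "extends_to (\<lambda>z. c * f z) (\<lambda>\<zeta>. c * h \<zeta>)"
  unfolding extends_to_def
proof (intro conjI allI impI)
  have [measurable]: "h \<in> borel_measurable M" using h by (auto simp: extends_to_def)
  show "(\<lambda>\<zeta>. c * h \<zeta>) \<in> borel_measurable M" by measurable
  fix e' :: real assume "0 < e'"
  \<comment> \<open>The added 1 keeps the quotient meaningful for \<open>c = 0\<close>.\<close>
  define e where "e = e' / (norm c + 1)"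
  have nc: "0 < norm c + 1" by (simp add: add_nonneg_pos)
  have e: "0 < e" using \<open>0 < e'\<close> nc by (simp add: e_def)
  have ce: "norm c * e \<le> e'"
  proof -
    have "norm c * e \<le> (norm c + 1) * e" using e by (intro mult_right_mono) auto
    also have "\<dots> = e'" using nc by (simp add: e_def)
    finally show ?thesis .
  qed
  obtain g where g: "g \<in> mixed_Lp q r" "integrable lborel g" "mixed_norm q r (\<lambda>z. f z - g z) \<le> ennreal e"
    "L2_norm M (\<lambda>\<zeta>. h \<zeta> - F g \<zeta>) \<le> ennreal e" using h e unfolding extends_to_def by blast
  have [measurable]: "F g \<in> borel_measurable M" "f \<in> borel_measurable borel" "g \<in> borel_measurable borel"
    using f g by (auto intro!: F_meas simp: mixed_Lp_iff)
  have scale: "ennreal (norm c) * N \<le> ennreal e'" if "N \<le> ennreal e" for N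
  proof -
    have "ennreal (norm c) * N \<le> ennreal (norm c) * ennreal e" using that by (intro mult_left_mono) auto
    also have "\<dots> = ennreal (norm c * e)" using e by (simp add: ennreal_mult)
    also have "\<dots> \<le> ennreal e'" using ce by (rule ennreal_leI)
    finally show ?thesis .
  qed
  show "\<exists>g\<in>mixed_Lp q r. integrable lborel g \<and> mixed_norm q r (\<lambda>z. c * f z - g z) \<le> ennreal e'
        \<and> L2_norm M (\<lambda>\<zeta>. c * h \<zeta> - F g \<zeta>) \<le> ennreal e'"
  proof (intro bexI[of _ "\<lambda>z. c * g z"] conjI)
    show "(\<lambda>z. c * g z) \<in> mixed_Lp q r" by (intro mixed_Lp_cmult g q r)
    show "integrable lborel (\<lambda>z. c * g z)" using g by simp
    have "mixed_norm q r (\<lambda>z. c * (f z - g z)) = ennreal (norm c) * mixed_norm q r (\<lambda>z. f z - g z)"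
      using q r by (intro mixed_norm_cmult) auto
    thus "mixed_norm q r (\<lambda>z. c * f z - c * g z) \<le> ennreal e'"
      using scale[OF g(3)] by (simp add: right_diff_distrib)
    have "L2_norm M (\<lambda>\<zeta>. c * (h \<zeta> - F g \<zeta>)) = ennreal (norm c) * L2_norm M (\<lambda>\<zeta>. h \<zeta> - F g \<zeta>)"
      by (intro L2_norm_cmult) measurable
    thus "L2_norm M (\<lambda>\<zeta>. c * h \<zeta> - F (\<lambda>z. c * g z) \<zeta>) \<le> ennreal e'"
      using scale[OF g(4)] by (simp add: F_cmult right_diff_distrib)
  qed
qed

text \<open>The triangle inequalities at hand cost a factor 8 in the mixed norm and a factor 4 in
  L2, hence the 32. The remaining error tends to 0 with \<open>e\<close>.\<close>

lemma extends_to_bound: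
  assumes f: "f \<in> mixed_Lp q r" and h: "extends_to f h"
  shows "L2_norm M h \<le> ennreal (32 * C) * mixed_norm q r f"
proof -
  have [measurable]: "h \<in> borel_measurable M" using h by (auto simp: extends_to_def)
  obtain N where N: "mixed_norm q r f = ennreal N" "0 \<le> N"
    using f by (cases "mixed_norm q r f") (auto simp: mixed_Lp_iff)
  have le: "L2_norm M h \<le> ennreal (32 * C * N) + ennreal ((32 * C + 4) * e)" if e: "0 < e" for e
  proof -
    obtain g where g: "g \<in> mixed_Lp q r" "integrable lborel g" "mixed_norm q r (\<lambda>z. f z - g z) \<le> ennreal e"
      "L2_norm M (\<lambda>\<zeta>. h \<zeta> - F g \<zeta>) \<le> ennreal e" using h e unfolding extends_to_def by blast
    have [measurable]: "F g \<in> borel_measurable M" "f \<in> borel_measurable borel" "g \<in> borel_measurable borel"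
      using f g by (auto intro!: F_meas simp: mixed_Lp_iff)
    have "mixed_norm q r (\<lambda>z. f z - (f z - g z)) \<le> 8 * (mixed_norm q r f + mixed_norm q r (\<lambda>z. f z - g z))"
      by (intro mixed_norm_diff_le q r) measurable
    also have "\<dots> \<le> 8 * (ennreal N + ennreal e)"
      unfolding N(1) by (intro mult_left_mono add_mono g) auto
    also have "\<dots> = ennreal (8 * (N + e))" using e N by (intro numeral_mult_ennreal_add) auto
    finally have "ennreal C * mixed_norm q r g \<le> ennreal C * ennreal (8 * (N + e))" by (intro mult_left_mono) auto
    with F_bound[OF g(1,2)] have Fg: "L2_norm M (F g) \<le> ennreal (C * (8 * (N + e)))"
      using C N e by (subst ennreal_mult) (auto intro: order_trans)
    have "L2_norm M (\<lambda>\<zeta>. (h \<zeta> - F g \<zeta>) + F g \<zeta>) \<le> 4 * (L2_norm M (\<lambda>\<zeta>. h \<zeta> - F g \<zeta>) + L2_norm M (F g))"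
      by (intro L2_norm_add_le) measurable
    also have "\<dots> \<le> 4 * (ennreal e + ennreal (C * (8 * (N + e))))"
      by (intro mult_left_mono add_mono g Fg) auto
    also have "\<dots> = ennreal (4 * (e + C * (8 * (N + e))))"
      using C e N by (intro numeral_mult_ennreal_add) auto
    also have "4 * (e + C * (8 * (N + e))) = 32 * C * N + (32 * C + 4) * e" by (simp add: algebra_simps)
    also have "ennreal \<dots> = ennreal (32 * C * N) + ennreal ((32 * C + 4) * e)"
      using C N e by (intro ennreal_plus) auto
    finally show ?thesis by simp
  qed
  have "L2_norm M h \<le> ennreal (32 * C * N)"
  proof (rule ennreal_le_epsilon)
    fix e :: real assume e: "0 < e"
    have "0 < 32 * C + 4" using C by simp
    thus "L2_norm M h \<le> ennreal (32 * C * N) + ennreal e" using le[of "e / (32 * C + 4)"] e by simp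
  qed
  thus ?thesis using C N by (simp add: ennreal_mult)
qed

lemma bounded_extension_exists:
  "\<exists>T. (\<forall>f\<in>mixed_Lp q r. integrable lborel f \<longrightarrow> (AE \<zeta> in M. T f \<zeta> = F f \<zeta>)) \<and>
    (\<forall>f\<in>mixed_Lp q r. \<forall>g\<in>mixed_Lp q r. AE \<zeta> in M. T (\<lambda>z. f z + g z) \<zeta> = T f \<zeta> + T g \<zeta>) \<and>
    (\<forall>c. \<forall>f\<in>mixed_Lp q r. AE \<zeta> in M. T (\<lambda>z. c * f z) \<zeta> = c * T f \<zeta>) \<and>
    (\<forall>f\<in>mixed_Lp q r. T f \<in> borel_measurable M \<and> L2_norm M (T f) \<le> ennreal (32 * C) * mixed_norm q r f)"
proof -
  \<comment> \<open>The choice is among functions that agree almost everywhere, so linearity of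
    \<open>T\<close> holds in that sense.\<close>
  define T where "T f = (SOME h. extends_to f h)" for f
  have T: "extends_to f (T f)" if "f \<in> mixed_Lp q r" for f
    unfolding T_def using extends_to_exists[OF that] by (rule someI_ex)
  show ?thesis
  proof (intro exI[of _ T] conjI ballI allI impI)
    fix f g :: "(real^'n) \<times> real \<Rightarrow> complex" and c assume f: "f \<in> mixed_Lp q r"
    show "AE \<zeta> in M. T f \<zeta> = F f \<zeta>" if "integrable lborel f"
      by (rule extends_to_unique[OF f T[OF f] extends_to_self[OF f that]])
    show "AE \<zeta> in M. T (\<lambda>z. f z + g z) \<zeta> = T f \<zeta> + T g \<zeta>" if g: "g \<in> mixed_Lp q r"
      using mixed_Lp_add[OF r q f g] by (intro extends_to_unique[OF _ T extends_to_add] f g T)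
    show "AE \<zeta> in M. T (\<lambda>z. c * f z) \<zeta> = c * T f \<zeta>"
      using mixed_Lp_cmult[OF r q f] by (intro extends_to_unique[OF _ T extends_to_cmult] f T)
    show "T f \<in> borel_measurable M" using T[OF f] by (simp add: extends_to_def)
    show "L2_norm M (T f) \<le> ennreal (32 * C) * mixed_norm q r f" by (rule extends_to_bound[OF f T[OF f]])
  qed
qed

end

theorem proposition2p8:
  fixes \<Phi> :: "real^'n::finite \<Rightarrow> real" and \<mu> m q0 r0 :: real
  assumes "smooth_on \<Phi> (- {0})"
    and "\<And>\<xi>. \<xi> \<noteq> 0 \<Longrightarrow> norm (gradient \<Phi> \<xi>) \<noteq> 0"
    and "\<mu> \<ge> 1"
    and "\<And>\<xi>. norm \<xi> = 1 \<Longrightarrow> inverse \<mu> \<le> \<bar>\<Phi> \<xi>\<bar> \<and> \<bar>\<Phi> \<xi>\<bar> \<le> \<mu>"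
    and "m \<ge> 1"
    and "\<And>s \<xi>. s > 0 \<Longrightarrow> \<xi> \<noteq> 0 \<Longrightarrow> \<Phi> (s *\<^sub>R \<xi>) = s powr m * \<Phi> \<xi>"
    and "\<And>\<xi>. \<xi> \<noteq> 0 \<Longrightarrow> rank (hessian \<Phi> \<xi>) \<ge> 1"
    and "1 < q0" and "q0 \<le> 2" and "1 < r0" and "r0 \<le> 2"
    and "\<And>\<epsilon>::real. \<epsilon> > 0 \<Longrightarrow>
           \<exists>C::real. 0 \<le> C \<and> (\<forall>R>1. \<forall>f\<in>mixed_Lp q0 r0.
             L2_norm (surface_measure \<Phi>) (restriction_op \<Phi> (cutoff R f))
               \<le> ennreal (C * R powr \<epsilon>) * mixed_norm q0 r0 f)"
  shows "\<forall>q r. 1 \<le> q \<and> q < q0 \<and> 1 \<le> r \<and> r < r0 \<longrightarrow>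
           (\<exists>C. 0 \<le> C \<and> restriction_estimate \<Phi> q r C)"
proof (intro allI impI)
  fix q r assume "1 \<le> q \<and> q < q0 \<and> 1 \<le> r \<and> r < r0"
  hence q: "1 \<le> q" "q < q0" and r: "1 \<le> r" "r < r0" by auto
  have smooth: "Ck_on 2 \<Phi> (- {0})" using assms(1) by (simp add: smooth_on_def)
  have loc: "local_restriction_estimate \<Phi> q0 r0"
    unfolding local_restriction_estimate_def using assms(12) by blast
  define M where "M = surface_measure \<Phi>"
  obtain C where C: "0 \<le> C" "\<And>f. f \<in> mixed_Lp q r \<Longrightarrow> integrable lborel f \<Longrightarrow>
      L2_norm M (fourier_transform f) \<le> ennreal C * mixed_norm q r f"
    using restriction_bounded[OF smooth assms(7) q assms(9) r assms(11) loc] unfolding M_def by blast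
  have meas: "fourier_transform f \<in> borel_measurable M"
    if "f \<in> borel_measurable borel" for f :: "(real^'n) \<times> real \<Rightarrow> complex"
    using borel_measurable_fourier_transform[OF that] by (simp add: M_def)
  \<comment> \<open>Both clauses of \<open>restriction_estimate\<close> share one constant, so the
    sharper \<open>C\<close> on integrable functions is weakened to \<open>32 * C\<close>.\<close>
  have le: "L2_norm M (restriction_op \<Phi> f) \<le> ennreal (32 * C) * mixed_norm q r f"
    if "f \<in> mixed_Lp q r" "integrable lborel f" for f
  proof -
    have "L2_norm M (restriction_op \<Phi> f) \<le> ennreal C * mixed_norm q r f"
      using C(2)[OF that] by (simp add: M_def L2_norm_restriction_op[OF smooth])
    also have "\<dots> \<le> ennreal (32 * C) * mixed_norm q r f"
      using C(1) by (intro mult_right_mono ennreal_leI) auto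
    finally show ?thesis .
  qed
  obtain T where T: "\<forall>f\<in>mixed_Lp q r. integrable lborel f \<longrightarrow> (AE \<zeta> in M. T f \<zeta> = fourier_transform f \<zeta>)"
    "\<forall>f\<in>mixed_Lp q r. \<forall>g\<in>mixed_Lp q r. AE \<zeta> in M. T (\<lambda>z. f z + g z) \<zeta> = T f \<zeta> + T g \<zeta>"
    "\<forall>c. \<forall>f\<in>mixed_Lp q r. AE \<zeta> in M. T (\<lambda>z. c * f z) \<zeta> = c * T f \<zeta>"
    "\<forall>f\<in>mixed_Lp q r. T f \<in> borel_measurable M \<and> L2_norm M (T f) \<le> ennreal (32 * C) * mixed_norm q r f"
    using bounded_extension_exists[OF q(1) r(1) C(1) meas _ _ C(2)]
    by (fastforce simp: fourier_transform_add fourier_transform_cmult)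
  have "AE \<zeta> in M. T f \<zeta> = restriction_op \<Phi> f \<zeta>" if "f \<in> mixed_Lp q r" "integrable lborel f" for f
  proof -
    have "AE \<zeta> in M. T f \<zeta> = fourier_transform f \<zeta>" using T(1) that by blast
    moreover have "AE \<zeta> in M. restriction_op \<Phi> f \<zeta> = fourier_transform f \<zeta>"
      unfolding M_def by (rule restriction_op_AE[OF smooth])
    ultimately show ?thesis by eventually_elim simp
  qed
  hence "restriction_estimate \<Phi> q r (32 * C)"
    unfolding restriction_estimate_def M_def[symmetric] using T(2-4) le by blast
  thus "\<exists>C. 0 \<le> C \<and> restriction_estimate \<Phi> q r C" using C(1) by (intro exI[of _ "32 * C"]) auto
qed

end
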